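(* For every (possibly infinite) digraph $D$ there is a reversion sequence $\mathcal{C}\in\mathbb{RS}(D)$ (so that each edge is reversed only finitely often) such that, for $D^{*}:=D\circlearrowleft\mathcal{C}$, in each strong component of $D^{*}$ every local edge-connectivity is finite; that is, $\lambda(u,v;D^{*})$ is finite for any two distinct vertices $u,v$ in the same strong component of $D^{*}$.
   Context: Graphs may be infinite and may have multiple edges but no loops; an undirected graph is a set of edges and its vertex set is the set of end vertices of its edges. A digraph $D$ is an orientation of an undirected graph $\mathsf{Un}(D)$, and $V(D)$ is the vertex set of $\mathsf{Un}(D)$. For $E\subseteq \mathsf{Un}(D)$, $D(E)$ denotes the set of $D$-oriented elements of $E$. Cycles and paths are finite and directed; a cycle has at least two edges and no repeated vertices. Limit: if $\langle D_\xi:\xi<\alpha\rangle$ is a sequence of orientations of a graph $G$ such that for each $e\in G$ there is $\xi_e<\alpha$ with $D_\xi(e)=D_{\xi_e}(e)$ for all $\xi\ge\xi_e$, its limit is the orientation $D^*$ with $D^*(e)=D_{\xi_e}(e)$; otherwise it has no limit. Reversion sequences: the set $\mathbb{RS}(D)$ of transfinite sequences $\mathcal{C}=\langle C_\xi:\xi<\alpha\rangle$ and the reorientation $D\circlearrowleft\mathcal{C}$ of $D$ are defined by recursion on the ordinal $\alpha$. If $\alpha=0$, then $\mathcal{C}\in\mathbb{RS}(D)$ and $D\circlearrowleft\mathcal{C}=D$. If $\alpha=\beta+1$, then $\mathcal{C}\in\mathbb{RS}(D)$ iff $\mathcal{C}\upharpoonright\beta\in\mathbb{RS}(D)$ and $C_\beta$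 is a directed cycle in $D\circlearrowleft(\mathcal{C}\upharpoonright\beta)$; then $D\circlearrowleft\mathcal{C}$ is obtained from $D\circlearrowleft(\mathcal{C}\upharpoonright\beta)$ by reversing each edge of $C_\beta$. If $\alpha$ is a limit ordinal, then $\mathcal{C}\in\mathbb{RS}(D)$ iff $\mathcal{C}\upharpoonright\beta\in\mathbb{RS}(D)$ for all $\beta<\alpha$ and $\langle D\circlearrowleft(\mathcal{C}\upharpoonright\beta):\beta<\alpha\rangle$ has a limit, which is then $D\circlearrowleft\mathcal{C}$. (If $\mathcal{C}\in\mathbb{RS}(D)$ then each edge has an orientation lying in only finitely many of the $C_\xi$.) The local edge-connectivity $\lambda(u,v;D)$ is the maximal size of a system of pairwise edge-disjoint directed paths from $u$ to $v$ in $D$. Strong components are the classes of vertices mutually reachable by directed paths. *)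

theory Defs
  imports "Graph_Theory.Graph_Theory" "HOL-Library.Extended_Nat"
begin

text \<open>
  Edges are the arcs of a library digraph: the arc set plays the role of the undirected graph, and
  \<^term>\<open>arc_to_ends D e\<close> is the orientation that \<^term>\<open>D\<close> gives to \<^term>\<open>e\<close>. Parallel and
  antiparallel arcs and infinite arc sets are allowed. Since a graph is identified with its set of
  edges, there are no isolated vertices.
\<close>

definition graph_orientation :: "('v, 'e) pre_digraph \<Rightarrow> bool" where
  "graph_orientation D \<longleftrightarrow>
     loopfree_digraph D \<and> verts D = tail D ` arcs D \<union> head D ` arcs D"

definition reverse_arcs :: "'e set \<Rightarrow> ('v, 'e) pre_digraph \<Rightarrow> ('v, 'e) pre_digraph" where
  "reverse_arcs F D = D\<lparr>tail := (\<lambda>e. if e \<in> F then head D e else tail D e),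
                        head := (\<lambda>e. if e \<in> F then tail D e else head D e)\<rparr>"

text \<open>
  \<^term>\<open>orientation_limit r I S G L\<close>: the family \<^term>\<open>S\<close> of orientations of the underlying graph of
  \<^term>\<open>G\<close>, indexed by \<^term>\<open>I\<close> in the order \<^term>\<open>r\<close>, has limit \<^term>\<open>L\<close>. The clause on
  \<^term>\<open>e \<notin> arcs G\<close> only fixes the meaningless values outside the arc set, so that limits are
  unique as records.
\<close>

definition orientation_limit ::
    "'i rel \<Rightarrow> 'i set \<Rightarrow> ('i \<Rightarrow> ('v, 'e) pre_digraph) \<Rightarrow>
       ('v, 'e) pre_digraph \<Rightarrow> ('v, 'e) pre_digraph \<Rightarrow> bool" where
  "orientation_limit r I S G L \<longleftrightarrow>
     verts L = verts G \<and> arcs L = arcs G \<and>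
     (\<forall>e\<in>arcs G. \<exists>j\<in>I. \<forall>k\<in>I. (j, k) \<in> r \<longrightarrow> arc_to_ends (S k) e = arc_to_ends L e) \<and>
     (\<forall>e. e \<notin> arcs G \<longrightarrow> arc_to_ends L e = arc_to_ends G e)"

text \<open>
  A transfinite sequence of length \<open>\<alpha>\<close> is a pair of a well-order \<^term>\<open>r\<close> of type \<open>\<alpha>\<close> and a function
  \<^term>\<open>C\<close>, of which only the values on \<^term>\<open>Field r\<close> matter. The ordinals \<open>\<beta> \<le> \<alpha>\<close> correspond to the
  initial segments \<^term>\<open>I\<close> of \<^term>\<open>r\<close>; those with \<open>\<beta> < \<alpha>\<close> are the sets \<^term>\<open>underS r i\<close> with
  \<^term>\<open>i \<in> Field r\<close>, and \<^term>\<open>under r i\<close> is the ordinal successor of \<^term>\<open>underS r i\<close>.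
  The predicate below is the graph of the recursion on \<open>\<beta>\<close>: \<^term>\<open>reorients_to D r C I D'\<close> says
  that the restriction of the sequence to \<^term>\<open>I\<close> is a reversion sequence for \<^term>\<open>D\<close> and turns
  \<^term>\<open>D\<close> into \<^term>\<open>D'\<close>.

  Cycles are nonempty closed walks without repeated vertices, given as lists of arcs; having no
  loops, they have at least two arcs.
\<close>

inductive reorients_to ::
    "('v, 'e) pre_digraph \<Rightarrow> 'i rel \<Rightarrow> ('i \<Rightarrow> 'e list) \<Rightarrow> 'i set \<Rightarrow> ('v, 'e) pre_digraph \<Rightarrow> bool"
  for D :: "('v, 'e) pre_digraph" and r :: "'i rel" and C :: "'i \<Rightarrow> 'e list" where
  zero: "reorients_to D r C {} D"
| succ: "\<lbrakk>i \<in> Field r; reorients_to D r C (underS r i) D'; pre_digraph.cycle D' (C i)\<rbrakk>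
    \<Longrightarrow> reorients_to D r C (under r i) (reverse_arcs (set (C i)) D')"
| limit: "\<lbrakk>wo_rel.ofilter r I; I \<noteq> {}; \<forall>i\<in>I. \<exists>j\<in>I. j \<noteq> i \<and> (i, j) \<in> r;
     \<forall>i\<in>I. reorients_to D r C (underS r i) (S i);
     orientation_limit r I S D D'\<rbrakk>
    \<Longrightarrow> reorients_to D r C I D'"

text \<open>
  An index type \<open>'e \<times> nat\<close> accommodates reversion sequences of every ordinal length: each
  cycle is nonempty and each edge lies on only finitely many of the cycles, so mapping an index
  \<open>\<xi>\<close> to an edge of its cycle, together with the number of earlier cycles through that edge, is
  injective.
\<close>

definition reversion_sequences :: "('v, 'e) pre_digraph \<Rightarrow> ('i rel \<times> ('i \<Rightarrow> 'e list)) set" where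
  "reversion_sequences D =
     {(r, C). Well_order r \<and> (\<exists>D'. reorients_to D r C (Field r) D')}"

text \<open>Meaningful for reversion sequences only; see \<open>reorient_eq\<close> for uniqueness.\<close>

definition reorient ::
    "('v, 'e) pre_digraph \<Rightarrow> 'i rel \<times> ('i \<Rightarrow> 'e list) \<Rightarrow> ('v, 'e) pre_digraph" where
  "reorient D \<C> = (THE D'. reorients_to D (fst \<C>) (snd \<C>) (Field (fst \<C>)) D')"

definition edge_disjoint_path_systems ::
    "('v, 'e) pre_digraph \<Rightarrow> 'v \<Rightarrow> 'v \<Rightarrow> 'e list set set" where
  "edge_disjoint_path_systems D u v =
     {P. (\<forall>p\<in>P. pre_digraph.apath D u p v) \<and> pairwise (\<lambda>p q. set p \<inter> set q = {}) P}"

text \<open>All infinite sizes are identified with \<^term>\<open>\<infinity> :: enat\<close>.\<close>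

definition local_edge_connectivity :: "('v, 'e) pre_digraph \<Rightarrow> 'v \<Rightarrow> 'v \<Rightarrow> enat" where
  "local_edge_connectivity D u v =
     (SUP P\<in>edge_disjoint_path_systems D u v. if finite P then enat (card P) else \<infinity>)"

lemma orientation_limit_unique:
  assumes r: "Well_order r" and I: "I \<subseteq> Field r"
    and L: "orientation_limit r I S G L" and L': "orientation_limit r I S G L'"
  shows "L = L'"
proof -
  have *: "arc_to_ends L e = arc_to_ends L' e" for e
  proof (cases "e \<in> arcs G")
    case True
    obtain j where j: "j \<in> I" "\<And>k. k \<in> I \<Longrightarrow> (j, k) \<in> r \<Longrightarrow> arc_to_ends (S k) e = arc_to_ends L e"
      using L True unfolding orientation_limit_def by blast
    obtain j' where j': "j' \<in> I"
      "\<And>k. k \<in> I \<Longrightarrow> (j', k) \<in> r \<Longrightarrow> arc_to_ends (S k) e = arc_to_ends L' e"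
      using L' True unfolding orientation_limit_def by blast
    have wo: "wo_rel r" using r by (simp add: wo_rel_def)
    have "(j, j) \<in> r" "(j', j') \<in> r" "(j, j') \<in> r \<or> (j', j) \<in> r"
      using wo_rel.REFL[OF wo] wo_rel.TOTALS[OF wo] I j(1) j'(1)
      by (auto simp: refl_on_def subset_iff)
    then show ?thesis using j j' by metis
  next
    case False
    then show ?thesis using L L' by (simp add: orientation_limit_def)
  qed
  then have "tail L = tail L'" "head L = head L'" by (auto simp: arc_to_ends_def)
  moreover have "verts L = verts L'" "arcs L = arcs L'"
    using L L' by (simp_all add: orientation_limit_def)
  ultimately show ?thesis by simp
qed

lemma reorients_to_unique:
  assumes r: "Well_order r"
  shows "reorients_to D r C I D1 \<Longrightarrow> reorients_to D r C I D2 \<Longrightarrow> D1 = D2"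
proof (induction arbitrary: D2 rule: reorients_to.induct)
  have wo: "wo_rel r" using r by (simp add: wo_rel_def)
  have refl: "(i, i) \<in> r" if "i \<in> Field r" for i
    using wo_rel.REFL[OF wo] that by (auto simp: refl_on_def)
  have asym: "i = j" if "(i, j) \<in> r" "(j, i) \<in> r" for i j
    using wo_rel.ANTISYM[OF wo] that by (auto simp: antisym_def)
  have mem: "i \<in> under r i" if "i \<in> Field r" for i using refl[OF that] by (simp add: under_def)
  {
    case zero
    then show ?case
    proof (cases rule: reorients_to.cases)
      case (succ i D')
      then show ?thesis using mem by blast
    qed auto
  next
    case (succ i D')
    from succ.prems show ?case
    proof (cases rule: reorients_to.cases)
      case zero
      then show ?thesis using mem succ.hyps(1) by blast
    next
      case (succ j E)
      have "i \<in> under r j" "j \<in> under r i" using mem succ(1,3) \<open>i \<in> Field r\<close> by auto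
      then have "j = i" using asym by (auto simp: under_def)
      then show ?thesis using succ succ.IH by auto
    next
      case (limit S)
      obtain j where "j \<in> under r i" "j \<noteq> i" "(i, j) \<in> r"
        using limit(3) mem[OF succ.hyps(1)] by blast
      then show ?thesis using asym by (auto simp: under_def)
    qed
  next
    case (limit I S D')
    from limit.prems show ?case
    proof (cases rule: reorients_to.cases)
      case zero
      then show ?thesis using limit.hyps(2) by blast
    next
      case (succ i E)
      obtain j where "j \<in> under r i" "j \<noteq> i" "(i, j) \<in> r"
        using limit.hyps(3) mem[OF succ(3)] succ(1) by blast
      then show ?thesis using asym by (auto simp: under_def)
    next
      case l2: (limit S')
      have eq: "S i = S' i" if "i \<in> I" for i
        using limit.IH l2(4) that by blast
      have "orientation_limit r I S D D2"
        using l2(5) eq unfolding orientation_limit_def by simp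
      moreover have "I \<subseteq> Field r" using limit.hyps(1) by (simp add: wo_rel.ofilter_def[OF wo])
      ultimately show ?thesis using orientation_limit_unique[OF r] limit.hyps(4) by blast
    qed
  }
qed

lemma reorient_eq:
  assumes "Well_order r" "reorients_to D r C (Field r) D'"
  shows "reorient D (r, C) = D'"
  unfolding reorient_def using assms reorients_to_unique by (metis fst_conv snd_conv the_equality)

end

theory Submission
  imports Defs
begin

text \<open>
  Write \<open>u \<Rightarrow> v\<close> if no finite set of edges separates \<open>v\<close> from \<open>u\<close>. Strong components can only shrink
  under reversions, and so can finite out-cuts.

  If the graph is countable, fix a strict partial order \<open>A \<subseteq> (\<Rightarrow>)\<close> that is total on \<open>\<Rightarrow>\<close>, and regard
  its pairs as additional \<open>jumps\<close>. For a finite set \<open>H\<close> of edges, choose a state that is reachable by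
  finitely many reversals and maximises the total rise of \<open>H\<close> with respect to a height function
  that is increasing along \<open>A\<close>. In this state no closed walk of \<open>H\<close>-edges and jumps uses a jump:
  each jump could be replaced by a walk avoiding \<open>H\<close>, and reversing the resulting closed trail would
  increase the rise. By compactness such states converge to an orientation without such closed walks
  for the whole edge set, and two successive states differ by finitely many disjoint cycles.

  If the edge set \<open>M\<close> is uncountable, write it as the union of a continuous chain of smaller sets such
  that vertices of a member that are connected outside of it are highly connected in the next layer,
  and solve the layers separately, by induction on the cardinality, with orders \<open>A\<close> that are induced by
  one linear order of the vertices. This order extends one-way reachability outside the members of
  the chain; hence a walk outside of a member behaves as a jump inside it. To make the induction
  work, jumps between vertices that no set of fewer than \<open>|M|\<close> edges separates may be prescribed.
\<close>


text \<open>Two obstacles shape the proof. A limit of good states may be bad: a closed walk through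
  a jump may appear, or a finite separator may be lost. The first cannot happen since a closed walk
  is finite and already present at some stage; the second because reversing a balanced set keeps the
  size of each finite out-cut, and the limit can only lower it. The order \<open>A\<close> precedes
  the stages, since it decides once and for all which direction of a pair has to be cut.

  An uncountable edge set is not exhausted by a sequence of finite sets, and pieces solved
  independently could still merge through walks that wander between them. An excursion into a piece,
  seen from the earlier part, follows the linear order: against the order, the high connectivity of
  the piece would make the reverse pair a prescribed jump of that piece, closed by the excursion.
  Hence the invariant along the chain: no jump of a member lies on a closed walk. It forces the
  vertices of a member that share a strong component to be connected inside that member.\<close>

text \<open>The edges whose orientation has changed after the cycles with index in \<^term>\<open>J\<close> are reversed.\<close>

definition par :: "('i \<Rightarrow> 'e list) \<Rightarrow> 'i set \<Rightarrow> 'e set" where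
  "par C J = {e. odd (card {i \<in> J. e \<in> set (C i)})}"

lemma par_empty [simp]: "par C {} = {}"
  by (simp add: par_def)

lemma par_cong:
  assumes "\<And>i. i \<in> J \<Longrightarrow> set (C i) = set (C' i)"
  shows "par C J = par C' J"
proof -
  have "{i \<in> J. e \<in> set (C i)} = {i \<in> J. e \<in> set (C' i)}" for e using assms by auto
  then show ?thesis by (simp add: par_def)
qed

text \<open>Finiteness matters because \<open>card\<close> of an infinite set is 0, hence even:
  infinite multiplicities would break the addition of parities.\<close>

lemma par_Un:
  assumes "I \<inter> J = {}" "\<And>e. finite {i \<in> I \<union> J. e \<in> set (C i)}"
  shows "par C (I \<union> J) = sym_diff (par C I) (par C J)"
proof -
  have "card {i \<in> I \<union> J. e \<in> set (C i)} = card {i \<in> I. e \<in> set (C i)} + card {i \<in> J. e \<in> set (C i)}"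
    for e
  proof -
    have "{i \<in> I \<union> J. e \<in> set (C i)} = {i \<in> I. e \<in> set (C i)} \<union> {i \<in> J. e \<in> set (C i)}" by blast
    moreover have "{i \<in> I. e \<in> set (C i)} \<inter> {i \<in> J. e \<in> set (C i)} = {}" using assms(1) by blast
    moreover have "finite {i \<in> I. e \<in> set (C i)}" "finite {i \<in> J. e \<in> set (C i)}"
      using assms(2)[of e] by (rule rev_finite_subset; blast)+
    ultimately show ?thesis by (simp add: card_Un_disjoint)
  qed
  then show ?thesis unfolding par_def by auto
qed

lemma par_singleton [simp]: "par C {i} = set (C i)"
proof -
  have "{j \<in> {i}. e \<in> set (C j)} = (if e \<in> set (C i) then {i} else {})" for e by auto
  then show ?thesis by (auto simp: par_def)
qed

lemma par_subset: "(\<And>i. i \<in> J \<Longrightarrow> set (C i) \<subseteq> M) \<Longrightarrow> par C J \<subseteq> M"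
proof
  fix e assume *: "\<And>i. i \<in> J \<Longrightarrow> set (C i) \<subseteq> M" and "e \<in> par C J"
  then have "{i \<in> J. e \<in> set (C i)} \<noteq> {}" by (auto simp: par_def simp del: Collect_empty_eq)
  then show "e \<in> M" using * by blast
qed

lemma par_image:
  assumes "inj_on g J"
  shows "par C (g ` J) = par (C \<circ> g) J"
proof -
  have "card {i \<in> g ` J. e \<in> set (C i)} = card {i \<in> J. e \<in> set ((C \<circ> g) i)}" for e
  proof -
    have "{i \<in> g ` J. e \<in> set (C i)} = g ` {i \<in> J. e \<in> set ((C \<circ> g) i)}" by auto
    moreover have "inj_on g {i \<in> J. e \<in> set ((C \<circ> g) i)}" using assms by (auto simp: inj_on_def)
    ultimately show ?thesis by (simp add: card_image)
  qed
  then show ?thesis by (simp add: par_def)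
qed

section \<open>Ordered sums of well-orders, which index concatenated sequences\<close>

definition lexsum :: "'a rel \<Rightarrow> ('a \<Rightarrow> 'i rel) \<Rightarrow> ('a \<times> 'i) rel" where
  "lexsum r R = {((a, i), (b, j)). a \<in> Field r \<and> b \<in> Field r \<and> i \<in> Field (R a) \<and> j \<in> Field (R b) \<and>
     ((a, b) \<in> r \<and> a \<noteq> b \<or> a = b \<and> (i, j) \<in> R a)}"

lemma Well_order_wf: "Well_order r \<Longrightarrow> wf (r - Id)"
  by (simp add: well_order_on_def)

lemma Field_lexsum:
  assumes "\<And>a. a \<in> Field r \<Longrightarrow> Well_order (R a)"
  shows "Field (lexsum r R) = Sigma (Field r) (\<lambda>a. Field (R a))"
proof -
  have "(i, i) \<in> R a" if "a \<in> Field r" "i \<in> Field (R a)" for a i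
    using assms[OF that(1)] that(2) by (auto simp: order_on_defs refl_on_def)
  then have "((a, i), (a, i)) \<in> lexsum r R" if "a \<in> Field r" "i \<in> Field (R a)" for a i
    using that by (auto simp: lexsum_def)
  then have "Sigma (Field r) (\<lambda>a. Field (R a)) \<subseteq> Field (lexsum r R)" by (auto intro: FieldI1)
  moreover have "lexsum r R \<subseteq> Sigma (Field r) (\<lambda>a. Field (R a)) \<times> Sigma (Field r) (\<lambda>a. Field (R a))"
    by (auto simp: lexsum_def)
  then have "Field (lexsum r R) \<subseteq> Sigma (Field r) (\<lambda>a. Field (R a))" unfolding Field_def by blast
  ultimately show ?thesis by blast
qed

lemma Well_order_lexsum:
  assumes r: "Well_order r" and R: "\<And>a. a \<in> Field r \<Longrightarrow> Well_order (R a)"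
  shows "Well_order (lexsum r R)"
proof -
  have F: "Field (lexsum r R) = Sigma (Field r) (\<lambda>a. Field (R a))" by (rule Field_lexsum) (rule R)
  have tr: "trans r" "antisym r" "total_on (Field r) r" using r by (auto simp: order_on_defs)
  have tR: "trans (R a)" "antisym (R a)" "total_on (Field (R a)) (R a)" "refl_on (Field (R a)) (R a)"
    if "a \<in> Field r" for a using R[OF that] by (auto simp: order_on_defs)
  have "refl_on (Field (lexsum r R)) (lexsum r R)"
    unfolding F using tR(4) by (auto simp: refl_on_def lexsum_def)
  moreover have "trans (lexsum r R)"
  proof (rule transI)
    fix x y z assume "(x, y) \<in> lexsum r R" "(y, z) \<in> lexsum r R"
    then show "(x, z) \<in> lexsum r R"
      using tr(1,2) tR(1) unfolding lexsum_def by (auto dest: transD antisymD)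
  qed
  moreover have "antisym (lexsum r R)"
  proof (rule antisymI)
    fix x y assume "(x, y) \<in> lexsum r R" "(y, x) \<in> lexsum r R"
    then show "x = y" using tr(2) tR(2) unfolding lexsum_def by (auto dest: antisymD)
  qed
  moreover have "total_on (Field (lexsum r R)) (lexsum r R)"
    unfolding F
  proof (rule total_onI)
    fix x y assume xy: "x \<in> Sigma (Field r) (\<lambda>a. Field (R a))" "y \<in> Sigma (Field r) (\<lambda>a. Field (R a))" "x \<noteq> y"
    then obtain a i b j where ab: "x = (a, i)" "y = (b, j)" "a \<in> Field r" "b \<in> Field r"
      "i \<in> Field (R a)" "j \<in> Field (R b)" by auto
    show "(x, y) \<in> lexsum r R \<or> (y, x) \<in> lexsum r R"
    proof (cases "a = b")
      case True
      then have "(i, j) \<in> R a \<or> (j, i) \<in> R a" using tR(3)[of a] ab xy(3) by (auto simp: total_on_def)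
      then show ?thesis using ab True by (auto simp: lexsum_def)
    next
      case False
      then have "(a, b) \<in> r \<or> (b, a) \<in> r" using tr(3) ab by (auto simp: total_on_def)
      then show ?thesis using ab False by (auto simp: lexsum_def)
    qed
  qed
  moreover have "wf (lexsum r R - Id)"
    unfolding wf_eq_minimal
  proof (intro allI impI)
    fix Q and x assume x: "x \<in> (Q :: ('a \<times> 'b) set)"
    show "\<exists>z\<in>Q. \<forall>y. (y, z) \<in> lexsum r R - Id \<longrightarrow> y \<notin> Q"
    proof (cases "Q \<subseteq> Field (lexsum r R)")
      case False
      then obtain z where "z \<in> Q" "z \<notin> Field (lexsum r R)" by blast
      then show ?thesis by (auto simp: Field_def)
    next
      case True
      \<comment> \<open>The least block that meets \<open>Q\<close>, then the least index inside
        that block.\<close>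
      have "fst x \<in> fst ` Q" using x by simp
      then obtain a where a: "a \<in> fst ` Q" "\<And>b. (b, a) \<in> r - Id \<Longrightarrow> b \<notin> fst ` Q"
        using wfE_min[OF Well_order_wf[OF r]] by metis
      then have aF: "a \<in> Field r" using True F by fastforce
      obtain i0 where "i0 \<in> {i. (a, i) \<in> Q}" using a(1) by auto
      then obtain i where i: "(a, i) \<in> Q" "\<And>j. (j, i) \<in> R a - Id \<Longrightarrow> (a, j) \<notin> Q"
        using wfE_min[OF Well_order_wf[OF R[OF aF]]] by (metis mem_Collect_eq)
      have "y \<notin> Q" if "(y, (a, i)) \<in> lexsum r R - Id" for y
      proof
        assume yQ: "y \<in> Q"
        obtain b j where y: "y = (b, j)" by (cases y)
        then have "(b, a) \<in> r \<and> b \<noteq> a \<or> b = a \<and> (j, i) \<in> R a \<and> j \<noteq> i"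
          using that by (auto simp: lexsum_def)
        moreover have "b \<in> fst ` Q" using yQ y by force
        ultimately show False using a(2)[of b] i(2)[of j] yQ y by auto
      qed
      then show ?thesis using i(1) by blast
    qed
  qed
  ultimately show ?thesis
    unfolding order_on_defs by (auto simp: Field_def)
qed

text \<open>What precedes \<open>(a, i)\<close> is all earlier blocks and the start of block
  \<open>a\<close>; the state before a reversal splits accordingly in
  \<open>reaches_concat\<close>.\<close>

lemma underS_lexsum:
  assumes "Well_order r" "\<And>a. a \<in> Field r \<Longrightarrow> Well_order (R a)" "a \<in> Field r" "i \<in> Field (R a)"
  shows "underS (lexsum r R) (a, i) =
    Sigma (underS r a) (\<lambda>b. Field (R b)) \<union> Pair a ` underS (R a) i"
proof (intro equalityI subsetI)
  fix x assume "x \<in> underS (lexsum r R) (a, i)"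
  then show "x \<in> Sigma (underS r a) (\<lambda>b. Field (R b)) \<union> Pair a ` underS (R a) i"
    by (cases x) (auto simp: underS_def lexsum_def)
next
  fix x assume "x \<in> Sigma (underS r a) (\<lambda>b. Field (R b)) \<union> Pair a ` underS (R a) i"
  then show "x \<in> underS (lexsum r R) (a, i)"
    using assms(3,4) by (auto simp: underS_def lexsum_def intro: FieldI1)
qed

section \<open>Orientations as sets of reversed edges; walks, cycles and potentials\<close>

locale edge_ends =
  fixes t h :: "'e \<Rightarrow> 'v"
begin

text \<open>An orientation is encoded by the set \<open>F\<close> of edges reversed against the
  fixed \<open>t\<close> and \<open>h\<close>. Reversing edges becomes a symmetric difference, and a
  limit of orientations becomes a pointwise limit of sets.\<close>

definition src :: "'e set \<Rightarrow> 'e \<Rightarrow> 'v" where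
  "src F e = (if e \<in> F then h e else t e)"

definition trg :: "'e set \<Rightarrow> 'e \<Rightarrow> 'v" where
  "trg F e = (if e \<in> F then t e else h e)"

definition ends :: "'e set \<Rightarrow> 'v set" where
  "ends X = t ` X \<union> h ` X"

definition step :: "'e set \<Rightarrow> 'e set \<Rightarrow> 'v rel" where
  "step F X = (\<lambda>e. (src F e, trg F e)) ` X"

fun walk :: "'e set \<Rightarrow> 'v \<Rightarrow> 'e list \<Rightarrow> 'v \<Rightarrow> bool" where
  "walk F u [] v \<longleftrightarrow> u = v"
| "walk F u (e # p) v \<longleftrightarrow> src F e = u \<and> walk F (trg F e) p v"

definition dicycle :: "'e set \<Rightarrow> 'e list \<Rightarrow> bool" where
  "dicycle F p \<longleftrightarrow> p \<noteq> [] \<and> distinct (map (src F) p) \<and> (\<exists>u. walk F u p u)"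

definition rise :: "'e set \<Rightarrow> ('v \<Rightarrow> int) \<Rightarrow> 'e \<Rightarrow> int" where
  "rise F f e = f (trg F e) - f (src F e)"

text \<open>With indicators of vertices for \<open>f\<close> this says that every vertex has equal
  in- and out-degree in \<open>S\<close>. So these are the finite edge-disjoint unions of directed
  cycles, described by potentials.\<close>

definition balanced :: "'e set \<Rightarrow> 'e set \<Rightarrow> bool" where
  "balanced F S \<longleftrightarrow> finite S \<and> (\<forall>f. sum (rise F f) S = 0)"

lemma step_mono: "X \<subseteq> Y \<Longrightarrow> step F X \<subseteq> step F Y"
  by (auto simp: step_def)

lemma step_Un: "step F (X \<union> Y) = step F X \<union> step F Y"
  by (auto simp: step_def)

lemma step_UN: "step F (\<Union>i\<in>I. X i) = (\<Union>i\<in>I. step F (X i))"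
  by (auto simp: step_def)

lemma step_cong: "F \<inter> X = G \<inter> X \<Longrightarrow> step F X = step G X"
  unfolding step_def src_def trg_def by (intro image_cong) auto

lemma stepI: "e \<in> X \<Longrightarrow> (src F e, trg F e) \<in> step F X"
  by (auto simp: step_def)

lemma step_ends: "step F X \<subseteq> ends X \<times> ends X"
  by (auto simp: step_def ends_def src_def trg_def)

lemma ends_mono: "X \<subseteq> Y \<Longrightarrow> ends X \<subseteq> ends Y"
  by (auto simp: ends_def)

lemma ends_UN: "ends (\<Union>i\<in>I. X i) = (\<Union>i\<in>I. ends (X i))"
  by (auto simp: ends_def)

lemma ends_empty [simp]: "ends {} = {}"
  by (simp add: ends_def)

lemma reach_mono: "X \<subseteq> Y \<Longrightarrow> (x, y) \<in> (step F X)\<^sup>* \<Longrightarrow> (x, y) \<in> (step F Y)\<^sup>*"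
  by (meson rtrancl_mono step_mono subsetD)

lemma reach_ends:
  assumes "(x, y) \<in> (step F X)\<^sup>*" "x \<noteq> y"
  shows "x \<in> ends X" "y \<in> ends X"
  using assms step_ends[of F X] by (meson converse_rtranclE mem_Sigma_iff subsetD rtranclE)+

lemma walk_append: "walk F u (p @ q) v \<longleftrightarrow> (\<exists>w. walk F u p w \<and> walk F w q v)"
  by (induction p arbitrary: u) auto

lemma walk_reach: "walk F u p v \<Longrightarrow> (u, v) \<in> (step F (set p))\<^sup>*"
proof (induction p arbitrary: u)
  case (Cons e p)
  then have "(u, trg F e) \<in> step F (set (e # p))" by (auto simp: step_def)
  moreover have "(trg F e, v) \<in> (step F (set (e # p)))\<^sup>*"
    using Cons reach_mono[of "set p" "set (e # p)"] by auto
  ultimately show ?case by (rule converse_rtrancl_into_rtrancl)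
qed auto

text \<open>Distinct sources make the edges distinct, as \<open>sum_rise_walk\<close> requires.
  Whenever a new start already occurs as a source, the walk is cut back to that occurrence.\<close>

lemma reach_walk:
  assumes "(x, y) \<in> (step F X)\<^sup>*"
  obtains p where "walk F x p y" "distinct (map (src F) p)" "set p \<subseteq> X"
proof -
  have "\<exists>p. walk F x p y \<and> distinct (map (src F) p) \<and> set p \<subseteq> X"
    using assms
  proof (induction rule: converse_rtrancl_induct)
    case base
    show ?case by (rule exI[of _ "[]"]) simp
  next
    case (step x z)
    then obtain p e where p: "walk F z p y" "distinct (map (src F) p)" "set p \<subseteq> X"
      and e: "e \<in> X" "x = src F e" "z = trg F e"
      by (auto simp: step_def)
    show ?case
    proof (cases "x \<in> src F ` set p")
      case False
      then show ?thesis using p e by (intro exI[of _ "e # p"]) auto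
    next
      case True
      then obtain e' p1 p2 where q: "p = p1 @ e' # p2" "x = src F e'"
        by (auto dest: split_list)
      then have "walk F x (e' # p2) y" using p(1) by (auto simp: walk_append)
      then show ?thesis using p q by (intro exI[of _ "e' # p2"]) auto
    qed
  qed
  then show ?thesis using that by blast
qed

lemma reach_finite:
  assumes "(x, y) \<in> (step F X)\<^sup>*"
  obtains Q where "finite Q" "Q \<subseteq> X" "(x, y) \<in> (step F Q)\<^sup>*"
  using reach_walk[OF assms] walk_reach by (metis List.finite_set)

lemma sum_rise_walk:
  "walk F u p v \<Longrightarrow> distinct p \<Longrightarrow> sum (rise F f) (set p) = f v - f u"
  by (induction p arbitrary: u) (auto simp: rise_def)

lemma dicycle_balanced: "dicycle F p \<Longrightarrow> balanced F (set p)"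
  unfolding dicycle_def balanced_def using sum_rise_walk by (auto simp: distinct_map)

lemma dicycle_reach_back:
  assumes "dicycle F p" "e \<in> set p"
  shows "(trg F e, src F e) \<in> (step F (set p))\<^sup>*"
proof -
  obtain u where u: "walk F u p u" using assms by (auto simp: dicycle_def)
  obtain p1 p2 where p: "p = p1 @ e # p2" using assms(2) by (auto dest: split_list)
  have "walk F u p1 (src F e)" "walk F (trg F e) p2 u"
    using u by (auto simp: p walk_append)
  then have "walk F (trg F e) (p2 @ p1) (src F e)" by (auto simp: walk_append)
  then have "(trg F e, src F e) \<in> (step F (set (p2 @ p1)))\<^sup>*" by (rule walk_reach)
  moreover have "set (p2 @ p1) \<subseteq> set p" by (auto simp: p)
  ultimately show ?thesis using reach_mono by blast
qed

lemma walk_cong: "F \<inter> set p = G \<inter> set p \<Longrightarrow> walk F u p v \<longleftrightarrow> walk G u p v"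
proof (induction p arbitrary: u)
  case (Cons e p)
  then have "src F e = src G e" "trg F e = trg G e" "F \<inter> set p = G \<inter> set p"
    by (auto simp: src_def trg_def)
  then show ?case using Cons.IH by simp
qed simp

text \<open>Locality: reversals off \<open>p\<close> do not affect whether \<open>p\<close> is a
  directed cycle.\<close>

lemma dicycle_cong:
  assumes "F \<inter> set p = G \<inter> set p"
  shows "dicycle F p \<longleftrightarrow> dicycle G p"
proof -
  have "map (src F) p = map (src G) p" using assms by (auto simp: src_def)
  then show ?thesis unfolding dicycle_def walk_cong[OF assms] by (simp only:)
qed

lemma rise_sym_diff: "rise (sym_diff F S) f e = (if e \<in> S then - rise F f e else rise F f e)"
  by (auto simp: rise_def src_def trg_def)

text \<open>The edges of \<open>N \<inter> S\<close> cancel, because reversing \<open>N\<close>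
  changes the sign of their rise.\<close>

lemma sum_rise_sym_diff:
  assumes "finite N" "finite S"
  shows "sum (rise F f) (sym_diff N S) = sum (rise F f) N + sum (rise (sym_diff F N) f) S"
proof -
  have "sum (rise F f) (sym_diff N S) = sum (rise F f) (N - S) + sum (rise F f) (S - N)"
    using assms by (intro sum.union_disjoint) auto
  moreover have "sum (rise F f) N = sum (rise F f) (N - S) + sum (rise F f) (N \<inter> S)"
    using assms by (metis sum.Int_Diff add.commute)
  moreover have "sum (rise (sym_diff F N) f) S
      = sum (rise (sym_diff F N) f) (S \<inter> N) + sum (rise (sym_diff F N) f) (S - N)"
    using assms by (simp add: sum.Int_Diff)
  moreover have "sum (rise (sym_diff F N) f) (S \<inter> N) = (\<Sum>e\<in>S \<inter> N. - rise F f e)"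
    by (intro sum.cong refl) (use rise_sym_diff in auto)
  moreover have "sum (rise (sym_diff F N) f) (S - N) = sum (rise F f) (S - N)"
    by (intro sum.cong refl) (use rise_sym_diff in auto)
  ultimately show ?thesis by (simp add: sum_negf Int_commute)
qed

lemma balanced_sym_diff:
  assumes "balanced F N" "balanced (sym_diff F N) S"
  shows "balanced F (sym_diff N S)"
  using assms sum_rise_sym_diff[of N S F] by (auto simp: balanced_def)

lemma sym_diff_cancel: "sym_diff N (sym_diff N N') = N'"
  by blast

text \<open>Two states obtained by finitely many reversals thus differ by finitely many cycles
  (\<open>balanced_cycles\<close>); this joins consecutive states in
  \<open>reaches_limit\<close>.\<close>

lemma balanced_difference:
  assumes "balanced F N" "balanced F N'"
  shows "balanced (sym_diff F N) (sym_diff N N')"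
proof -
  have fin: "finite N" "finite (sym_diff N N')" using assms by (auto simp: balanced_def)
  show ?thesis
    using assms sum_rise_sym_diff[OF fin, of F, unfolded sym_diff_cancel] fin
    by (auto simp: balanced_def)
qed

text \<open>The end of a longest path in \<open>N\<close> has an outgoing edge in \<open>N\<close>,
  and by maximality its source has been visited before.\<close>

lemma balanced_dicycle_ex:
  assumes bal: "balanced F N" and ne: "N \<noteq> {}"
  obtains p where "dicycle F p" "set p \<subseteq> N"
proof -
  have fin: "finite N" using bal by (simp add: balanced_def)
  have out: "\<exists>e'\<in>N. src F e' = trg F e" if e: "e \<in> N" for e
  proof (rule ccontr)
    assume no: "\<not> ?thesis"
    \<comment> \<open>If no edge of \<open>N\<close> left the target of \<open>e\<close>, then its
      indicator would rise nowhere negatively on \<open>N\<close> and by 1 along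
      \<open>e\<close>.\<close>
    let ?f = "\<lambda>x. if x = trg F e then 1 else 0 :: int"
    have "rise F ?f e \<le> sum (rise F ?f) N"
      using fin no by (intro member_le_sum e) (auto simp: rise_def)
    moreover have "rise F ?f e = 1" using no e by (auto simp: rise_def)
    ultimately show False using bal by (auto simp: balanced_def)
  qed
  let ?P = "\<lambda>p. p \<noteq> [] \<and> distinct (map (src F) p) \<and> set p \<subseteq> N \<and> (\<exists>u v. walk F u p v)"
  obtain e where "e \<in> N" using ne by blast
  then have "?P [e]" by auto
  moreover have "\<forall>p. ?P p \<longrightarrow> length p < Suc (card N)"
  proof (intro allI impI)
    fix p assume "?P p"
    then have "card (set p) = length p" "set p \<subseteq> N" by (auto simp: distinct_map distinct_card)
    then show "length p < Suc (card N)" using card_mono[OF fin] by (metis le_imp_less_Suc)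
  qed
  ultimately have "\<exists>p. ?P p \<and> (\<forall>q. ?P q \<longrightarrow> length q \<le> length p)"
    by (rule ex_has_greatest_nat[where P = ?P and f = length])
  then obtain p where p: "?P p" and max: "\<And>q. ?P q \<Longrightarrow> length q \<le> length p" by blast
  then obtain u v where w: "walk F u p v" by blast
  obtain q e where pq: "p = q @ [e]" using p by (cases p rule: rev_cases) auto
  have "v = trg F e" using w by (simp add: pq walk_append)
  moreover have "e \<in> N" using p pq by simp
  ultimately obtain e' where e': "e' \<in> N" "src F e' = v" using out by blast
  have "v \<in> src F ` set p"
  proof (rule ccontr)
    assume nv: "v \<notin> src F ` set p"
    have "walk F u (p @ [e']) (trg F e')" using w e' by (auto simp: walk_append)
    then have "?P (p @ [e'])" using p e' nv by auto
    then show False using max[of "p @ [e']"] by simp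
  qed
  then obtain a p1 p2 where a: "p = p1 @ a # p2" "src F a = v" by (auto dest: split_list)
  have "walk F v (a # p2) v" using w a by (auto simp: walk_append)
  then have "dicycle F (a # p2)" "set (a # p2) \<subseteq> N" using p a by (auto simp: dicycle_def)
  then show ?thesis using that by blast
qed

lemma balanced_cycles:
  assumes "balanced F N"
  obtains n :: nat and C :: "nat \<Rightarrow> 'e list" where
    "\<And>i. i < n \<Longrightarrow> dicycle (sym_diff F (par C {..<i})) (C i) \<and> set (C i) \<subseteq> N" "par C {..<n} = N"
proof -
  have "finite N" using assms by (simp add: balanced_def)
  then have "\<exists>n (C :: nat \<Rightarrow> 'e list). (\<forall>i<n. dicycle (sym_diff F (par C {..<i})) (C i) \<and> set (C i) \<subseteq> N)
      \<and> par C {..<n} = N"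
    using assms
  proof (induction N rule: finite_psubset_induct)
    case (psubset N)
    show ?case
    proof (cases "N = {}")
      case True
      then show ?thesis by (intro exI[of _ 0]) simp
    next
      case False
      then obtain p where p: "dicycle F p" "set p \<subseteq> N" using balanced_dicycle_ex psubset.prems by metis
      have "p \<noteq> []" using p by (simp add: dicycle_def)
      then have less: "N - set p \<subset> N" using p by (cases p) auto
      have "sum (rise F f) N = sum (rise F f) (N - set p) + sum (rise F f) (set p)" for f
        using sum.subset_diff[OF p(2)] psubset.hyps by blast
      then have "balanced F (N - set p)"
        using psubset.prems dicycle_balanced[OF p(1)] by (simp add: balanced_def)
      then obtain n and C :: "nat \<Rightarrow> 'e list" where C:
        "\<And>i. i < n \<Longrightarrow> dicycle (sym_diff F (par C {..<i})) (C i) \<and> set (C i) \<subseteq> N - set p"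
        "par C {..<n} = N - set p"
        using psubset.IH[OF less] by blast
      \<comment> \<open>The cycle \<open>p\<close> that was split off is reversed last. The state
        then reached is \<open>sym_diff F (N - set p)\<close>, which agrees with \<open>F\<close> on
        \<open>p\<close>, so \<open>p\<close> is still directed.\<close>
      define C' where "C' = C(n := p)"
      have par: "par C' {..<i} = par C {..<i}" if "i \<le> n" for i
        using that by (intro par_cong) (auto simp: C'_def)
      have 1: "dicycle (sym_diff F (par C' {..<i})) (C' i) \<and> set (C' i) \<subseteq> N" if "i < Suc n" for i
      proof (cases "i = n")
        case True
        have "sym_diff F (N - set p) \<inter> set p = F \<inter> set p" by blast
        then have "dicycle (sym_diff F (N - set p)) p" using dicycle_cong p(1) by blast
        then show ?thesis using True C(2) par[of n] p(2) by (simp add: C'_def)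
      next
        case False
        then show ?thesis using that C(1)[of i] par[of i] by (auto simp: C'_def)
      qed
      have "par C' ({..<n} \<union> {n}) = sym_diff (par C' {..<n}) (par C' {n})"
        by (rule par_Un) simp_all
      then have "par C' {..<Suc n} = N"
        using par[of n] C(2) p(2) by (auto simp: lessThan_Suc C'_def)
      then show ?thesis using 1 by blast
    qed
  qed
  then show ?thesis using that by blast
qed

subsection \<open>Transfinite sequences of reversals\<close>

text \<open>Limit stages are implicit: since each edge occurs finitely often, its orientation is
  eventually constant below every limit, and \<open>par C (underS r i)\<close> describes the state
  before step \<open>i\<close>. \<open>revseq_reorients\<close> recovers the recursive
  notion.\<close>

definition revseq :: "'e set \<Rightarrow> 'i rel \<Rightarrow> ('i \<Rightarrow> 'e list) \<Rightarrow> bool" where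
  "revseq M r C \<longleftrightarrow> Well_order r \<and>
     (\<forall>i\<in>Field r. set (C i) \<subseteq> M \<and> dicycle (par C (underS r i)) (C i)) \<and>
     (\<forall>e. finite {i \<in> Field r. e \<in> set (C i)})"

definition reaches :: "'e set \<Rightarrow> 'e set \<Rightarrow> bool" where
  "reaches M F \<longleftrightarrow> (\<exists>(r :: ('e \<times> nat) rel) C. revseq M r C \<and> F = par C (Field r))"

lemma reaches_subset: "reaches M F \<Longrightarrow> F \<subseteq> M"
proof -
  assume "reaches M F"
  then obtain r :: "('e \<times> nat) rel" and C where "revseq M r C" "F = par C (Field r)"
    unfolding reaches_def by blast
  then show "F \<subseteq> M" using par_subset[of "Field r" C M] by (auto simp: revseq_def)
qed

text \<open>Concatenation pairs up index types; the return to the fixed type in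
  \<open>reaches\<close> keeps the induction on cardinality within one type.\<close>

lemma revseq_reindex:
  fixes r :: "'i rel"
  assumes rs: "revseq M r C"
  shows "reaches M (par C (Field r))"
proof -
  have wo: "Well_order r" and fin: "\<And>e. finite {i \<in> Field r. e \<in> set (C i)}"
    using rs by (auto simp: revseq_def)
  have ne: "hd (C i) \<in> set (C i)" if "i \<in> Field r" for i
    using rs that by (auto simp: revseq_def dicycle_def)
  define g where "g i = (hd (C i), card {j \<in> underS r i. hd (C i) \<in> set (C j)})" for i
  have neq: "g i \<noteq> g j" if ij: "(i, j) \<in> r" "i \<noteq> j" for i j
  proof (cases "hd (C i) = hd (C j)")
    case True
    have F: "i \<in> Field r" "j \<in> Field r" using ij by (auto simp: Field_def)
    have "underS r i \<subseteq> underS r j"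
      using wo ij(1) by (intro underS_incr) (auto simp: order_on_defs)
    moreover have "i \<in> underS r j" "i \<notin> underS r i" using ij by (auto simp: underS_def)
    ultimately have sub: "{k \<in> underS r i. hd (C j) \<in> set (C k)} \<subseteq> {k \<in> underS r j. hd (C j) \<in> set (C k)}"
      and "i \<in> {k \<in> underS r j. hd (C j) \<in> set (C k)}" "i \<notin> {k \<in> underS r i. hd (C j) \<in> set (C k)}"
      using ne[OF F(1)] True by auto
    then have "{k \<in> underS r i. hd (C j) \<in> set (C k)} \<subset> {k \<in> underS r j. hd (C j) \<in> set (C k)}"
      by (metis psubsetI)
    moreover have "finite {k \<in> underS r j. hd (C j) \<in> set (C k)}"
      using fin[of "hd (C j)"] by (rule rev_finite_subset) (use Order_Relation.underS_Field[of r j] in auto)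
    ultimately have "card {k \<in> underS r i. hd (C j) \<in> set (C k)} < card {k \<in> underS r j. hd (C j) \<in> set (C k)}"
      by (intro psubset_card_mono)
    then show ?thesis using True by (simp add: g_def)
  qed (auto simp: g_def)
  have inj: "inj_on g (Field r)"
  proof (rule inj_onI, rule ccontr)
    fix i j assume "i \<in> Field r" "j \<in> Field r" "g i = g j" "i \<noteq> j"
    then have "(i, j) \<in> r \<or> (j, i) \<in> r" using wo by (auto simp: order_on_defs total_on_def)
    then show False using neq \<open>g i = g j\<close> \<open>i \<noteq> j\<close> by metis
  qed
  define r' where "r' = dir_image r g"
  define C' where "C' = C \<circ> the_inv_into (Field r) g"
  have C'g: "C' (g i) = C i" if "i \<in> Field r" for i
    using inj that by (simp add: C'_def the_inv_into_f_f)
  have Fr': "Field r' = g ` Field r" by (simp add: r'_def dir_image_Field)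
  have par: "par C' (g ` J) = par C J" if "J \<subseteq> Field r" for J
  proof -
    have "par C' (g ` J) = par (C' \<circ> g) J" using inj that by (intro par_image) (auto simp: inj_on_def)
    also have "\<dots> = par C J" using C'g that by (intro par_cong) auto
    finally show ?thesis .
  qed
  have under: "underS r' (g i) = g ` underS r i" if "i \<in> Field r" for i
  proof -
    have eq: "(g j, g i) \<in> r' \<longleftrightarrow> (j, i) \<in> r" if j: "j \<in> Field r" for j
    proof
      assume "(g j, g i) \<in> r'"
      then obtain a b where ab: "g j = g a" "g i = g b" "(a, b) \<in> r" by (auto simp: r'_def dir_image_def)
      then have "a \<in> Field r" "b \<in> Field r" by (auto simp: Field_def)
      then have "j = a" "i = b" using inj ab(1,2) j \<open>i \<in> Field r\<close> by (auto dest: inj_onD)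
      then show "(j, i) \<in> r" using ab by simp
    qed (auto simp: r'_def dir_image_def)
    have geq: "g j = g i \<longleftrightarrow> j = i" if "j \<in> Field r" for j
      using inj that \<open>i \<in> Field r\<close> by (auto dest: inj_onD)
    show ?thesis
    proof (intro equalityI subsetI)
      fix x assume x: "x \<in> underS r' (g i)"
      then have "x \<in> g ` Field r" using Order_Relation.underS_Field[of r' "g i"] Fr' by blast
      then obtain j where "j \<in> Field r" "x = g j" by blast
      then show "x \<in> g ` underS r i" using x eq geq by (auto simp: underS_def)
    next
      fix x assume "x \<in> g ` underS r i"
      then obtain j where j: "x = g j" "j \<in> underS r i" by blast
      then have "j \<in> Field r" using Order_Relation.underS_Field[of r] by blast
      then show "x \<in> underS r' (g i)" using j eq geq by (auto simp: underS_def)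
    qed
  qed
  have "revseq M r' C'"
    unfolding revseq_def
  proof (intro conjI ballI allI)
    show "Well_order r'" unfolding r'_def by (rule Well_order_dir_image[OF wo inj])
  next
    fix x assume "x \<in> Field r'"
    then obtain i where i: "i \<in> Field r" "x = g i" using Fr' by auto
    have "par C' (underS r' x) = par C (underS r i)"
      using under[OF i(1)] par[OF Order_Relation.underS_Field, of i] i(2) by simp
    then show "set (C' x) \<subseteq> M" "dicycle (par C' (underS r' x)) (C' x)"
      using rs C'g[OF i(1)] i by (auto simp: revseq_def)
  next
    fix e
    have "{x \<in> Field r'. e \<in> set (C' x)} = g ` {i \<in> Field r. e \<in> set (C i)}"
      using C'g Fr' by auto
    then show "finite {x \<in> Field r'. e \<in> set (C' x)}" using fin by simp
  qed
  moreover have "par C (Field r) = par C' (Field r')" using par[of "Field r"] Fr' by simp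
  ultimately show ?thesis unfolding reaches_def by blast
qed

text \<open>The common source of the two concatenations used later: independent blocks
  (\<open>reaches_disjoint\<close>) and converging finite blocks
  (\<open>reaches_limit\<close>).\<close>

lemma reaches_concat:
  assumes r: "Well_order r" and R: "\<And>a. a \<in> Field r \<Longrightarrow> Well_order (R a)"
    and cyc: "\<And>a i. a \<in> Field r \<Longrightarrow> i \<in> Field (R a) \<Longrightarrow> set (C a i) \<subseteq> M \<and>
      dicycle (sym_diff (par (case_prod C) (Sigma (underS r a) (\<lambda>b. Field (R b))))
        (par (C a) (underS (R a) i))) (C a i)"
    and fin: "\<And>e. finite {x \<in> Sigma (Field r) (\<lambda>a. Field (R a)). e \<in> set (case_prod C x)}"
  shows "reaches M (par (case_prod C) (Sigma (Field r) (\<lambda>a. Field (R a))))"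
proof -
  have F: "Field (lexsum r R) = Sigma (Field r) (\<lambda>a. Field (R a))" by (rule Field_lexsum) (rule R)
  have "revseq M (lexsum r R) (case_prod C)"
    unfolding revseq_def
  proof (intro conjI ballI allI)
    show "Well_order (lexsum r R)" by (rule Well_order_lexsum[OF r]) (rule R)
  next
    fix x assume "x \<in> Field (lexsum r R)"
    then obtain a i where x: "x = (a, i)" "a \<in> Field r" "i \<in> Field (R a)" using F by auto
    have U: "underS (lexsum r R) (a, i) = Sigma (underS r a) (\<lambda>b. Field (R b)) \<union> Pair a ` underS (R a) i"
      using underS_lexsum[of r R a i] r R x by blast
    have "par (case_prod C) (underS (lexsum r R) x) =
        sym_diff (par (case_prod C) (Sigma (underS r a) (\<lambda>b. Field (R b))))
          (par (case_prod C) (Pair a ` underS (R a) i))"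
      unfolding x(1) U
    proof (rule par_Un)
      show "Sigma (underS r a) (\<lambda>b. Field (R b)) \<inter> Pair a ` underS (R a) i = {}"
        by (auto simp: underS_def)
      fix e
      show "finite {y \<in> Sigma (underS r a) (\<lambda>b. Field (R b)) \<union> Pair a ` underS (R a) i.
          e \<in> set (case_prod C y)}"
        using fin[of e] by (rule rev_finite_subset) (use x(2) Order_Relation.underS_Field[of r a] Order_Relation.underS_Field[of "R a" i] in auto)
    qed
    moreover have "par (case_prod C) (Pair a ` underS (R a) i) = par (C a) (underS (R a) i)"
      by (subst par_image) (auto simp: inj_on_def comp_def)
    ultimately show "set (case_prod C x) \<subseteq> M" "dicycle (par (case_prod C) (underS (lexsum r R) x)) (case_prod C x)"
      using cyc[OF x(2,3)] x(1) by auto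
  next
    fix e show "finite {x \<in> Field (lexsum r R). e \<in> set (case_prod C x)}" using fin F by simp
  qed
  then show ?thesis using revseq_reindex F by metis
qed

text \<open>Blocks on disjoint edge sets do not see each other by \<open>dicycle_cong\<close>, and
  each edge keeps the finite multiplicity that it has in its own block.\<close>

lemma reaches_disjoint:
  fixes r :: "'a rel"
  assumes r: "Well_order r"
    and re: "\<And>a. a \<in> Field r \<Longrightarrow> reaches (P a) (G a)"
    and dis: "\<And>a b. a \<in> Field r \<Longrightarrow> b \<in> Field r \<Longrightarrow> a \<noteq> b \<Longrightarrow> P a \<inter> P b = {}"
  shows "reaches (\<Union>a\<in>Field r. P a) (\<Union>a\<in>Field r. G a)"
proof -
  have "\<forall>a\<in>Field r. \<exists>R C. revseq (P a) (R :: ('e \<times> nat) rel) C \<and> G a = par C (Field R)"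
    using re unfolding reaches_def by blast
  from bchoice[OF this] obtain R :: "'a \<Rightarrow> ('e \<times> nat) rel" where
    "\<forall>a\<in>Field r. \<exists>C. revseq (P a) (R a) C \<and> G a = par C (Field (R a))" by blast
  from bchoice[OF this] obtain C where
    RC: "\<And>a. a \<in> Field r \<Longrightarrow> revseq (P a) (R a) (C a)"
    and G: "\<And>a. a \<in> Field r \<Longrightarrow> G a = par (C a) (Field (R a))"
    by blast
  let ?S = "\<lambda>A. Sigma A (\<lambda>b. Field (R b))"
  have sub: "set (C a i) \<subseteq> P a" if "a \<in> Field r" "i \<in> Field (R a)" for a i
    using RC[OF that(1)] that(2) by (auto simp: revseq_def)
  have slice: "{x \<in> ?S (Field r). e \<in> set (case_prod C x)} = Pair a ` {i \<in> Field (R a). e \<in> set (C a i)}"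
    if "a \<in> Field r" "e \<in> P a" for a e
  proof (intro equalityI subsetI)
    fix x assume "x \<in> {x \<in> ?S (Field r). e \<in> set (case_prod C x)}"
    then obtain b i where x: "x = (b, i)" "b \<in> Field r" "i \<in> Field (R b)" "e \<in> set (C b i)" by auto
    then have "e \<in> P b" using sub by blast
    then have "b = a" using dis[of a b] x(2) that by blast
    then show "x \<in> Pair a ` {i \<in> Field (R a). e \<in> set (C a i)}" using x by simp
  qed (use that in auto)
  have fin: "finite {x \<in> ?S (Field r). e \<in> set (case_prod C x)}" for e
  proof (cases "\<exists>a\<in>Field r. e \<in> P a")
    case True
    then show ?thesis using slice RC by (auto simp: revseq_def)
  next
    case False
    then have "{x \<in> ?S (Field r). e \<in> set (case_prod C x)} = {}" using sub by fastforce
    then show ?thesis by (simp only: finite.emptyI)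
  qed
  have "reaches (\<Union>a\<in>Field r. P a) (par (case_prod C) (?S (Field r)))"
  proof (rule reaches_concat[OF r _ _ fin])
    show "Well_order (R a)" if "a \<in> Field r" for a using RC[OF that] by (simp add: revseq_def)
    fix a i assume ai: "a \<in> Field r" "i \<in> Field (R a)"
    have "par (case_prod C) (?S (underS r a)) \<subseteq> (\<Union>b\<in>underS r a. P b)"
      using sub Order_Relation.underS_Field[of r a] by (intro par_subset) fastforce
    moreover have "(\<Union>b\<in>underS r a. P b) \<inter> P a = {}"
      using dis ai(1) Order_Relation.underS_Field[of r a] by (fastforce simp: underS_def)
    ultimately have "sym_diff (par (case_prod C) (?S (underS r a))) (par (C a) (underS (R a) i)) \<inter> set (C a i)
        = par (C a) (underS (R a) i) \<inter> set (C a i)"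
      using sub[OF ai] by blast
    then have "dicycle (sym_diff (par (case_prod C) (?S (underS r a))) (par (C a) (underS (R a) i))) (C a i)
        \<longleftrightarrow> dicycle (par (C a) (underS (R a) i)) (C a i)"
      by (rule dicycle_cong)
    then show "set (C a i) \<subseteq> (\<Union>a\<in>Field r. P a) \<and>
        dicycle (sym_diff (par (case_prod C) (?S (underS r a))) (par (C a) (underS (R a) i))) (C a i)"
      using RC[OF ai(1)] ai by (auto simp: revseq_def)
  qed
  moreover have "par (case_prod C) (?S (Field r)) = (\<Union>a\<in>Field r. G a)"
  proof -
    have iff: "e \<in> par (case_prod C) (?S (Field r)) \<longleftrightarrow> e \<in> G a" if "a \<in> Field r" "e \<in> P a" for a e
      using slice[OF that] G[OF that(1)] by (simp add: par_def card_image inj_on_def)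
    moreover have "par (case_prod C) (?S (Field r)) \<subseteq> (\<Union>a\<in>Field r. P a)"
      using sub by (intro par_subset) fastforce
    moreover have GP: "G a \<subseteq> P a" if "a \<in> Field r" for a using re[OF that] by (rule reaches_subset)
    ultimately show ?thesis
    proof (intro equalityI subsetI)
      fix e assume "e \<in> par (case_prod C) (?S (Field r))"
      moreover from this obtain a where "a \<in> Field r" "e \<in> P a"
        using \<open>par (case_prod C) (?S (Field r)) \<subseteq> (\<Union>a\<in>Field r. P a)\<close> by auto
      ultimately show "e \<in> (\<Union>a\<in>Field r. G a)" using iff by auto
    next
      fix e assume "e \<in> (\<Union>a\<in>Field r. G a)"
      then obtain a where "a \<in> Field r" "e \<in> G a" by blast
      then show "e \<in> par (case_prod C) (?S (Field r))" using iff GP by (meson subsetD)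
    qed
  qed
  ultimately show ?thesis by simp
qed

text \<open>Block \<open>k\<close> turns \<open>N k\<close> into \<open>N (Suc k)\<close> by
  finitely many cycles inside their difference. An edge whose membership is eventually constant lies
  in finitely many differences, hence on finitely many cycles.\<close>

lemma reaches_limit:
  fixes N :: "nat \<Rightarrow> 'e set"
  assumes N0: "N 0 = {}" and bal: "\<And>k. balanced {} (N k)" and sub: "\<And>k. N k \<subseteq> M"
    and lim: "\<And>e. \<exists>k. \<forall>j\<ge>k. e \<in> N j \<longleftrightarrow> e \<in> L"
  shows "reaches M L"
proof -
  have "\<exists>n (C :: nat \<Rightarrow> 'e list). (\<forall>i<n. dicycle (sym_diff (N k) (par C {..<i})) (C i) \<and>
      set (C i) \<subseteq> sym_diff (N k) (N (Suc k))) \<and> par C {..<n} = sym_diff (N k) (N (Suc k))" for k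
  proof -
    have b: "balanced (N k) (sym_diff (N k) (N (Suc k)))"
      using balanced_difference[OF bal bal, of k "Suc k"] by simp
    show ?thesis
    proof (rule balanced_cycles[OF b])
      fix n and C :: "nat \<Rightarrow> 'e list"
      assume "\<And>i. i < n \<Longrightarrow> dicycle (sym_diff (N k) (par C {..<i})) (C i) \<and>
          set (C i) \<subseteq> sym_diff (N k) (N (Suc k))"
        and "par C {..<n} = sym_diff (N k) (N (Suc k))"
      then show ?thesis by (intro exI[of _ n] exI[of _ C] conjI) simp_all
    qed
  qed
  then have "\<forall>k. \<exists>n. \<exists>C :: nat \<Rightarrow> 'e list. (\<forall>i<n. dicycle (sym_diff (N k) (par C {..<i})) (C i) \<and>
      set (C i) \<subseteq> sym_diff (N k) (N (Suc k))) \<and> par C {..<n} = sym_diff (N k) (N (Suc k))" ..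
  from choice[OF this] obtain n :: "nat \<Rightarrow> nat" where
    "\<forall>k. \<exists>C :: nat \<Rightarrow> 'e list. (\<forall>i<n k. dicycle (sym_diff (N k) (par C {..<i})) (C i) \<and>
      set (C i) \<subseteq> sym_diff (N k) (N (Suc k))) \<and> par C {..<n k} = sym_diff (N k) (N (Suc k))" ..
  from choice[OF this] obtain C :: "nat \<Rightarrow> nat \<Rightarrow> 'e list" where
    cyc: "\<And>k i. i < n k \<Longrightarrow> dicycle (sym_diff (N k) (par (C k) {..<i})) (C k i)"
    and Csub: "\<And>k i. i < n k \<Longrightarrow> set (C k i) \<subseteq> sym_diff (N k) (N (Suc k))"
    and Cpar: "\<And>k. par (C k) {..<n k} = sym_diff (N k) (N (Suc k))"
    by blast
  let ?R = "\<lambda>k. natLeq_on (n k)"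
  have FR: "Field (?R k) = {..<n k}" for k using Field_natLeq_on by auto
  have uR: "underS (?R k) i = {..<i}" if "i < n k" for k i using that by (auto simp: underS_def)
  have uN: "underS natLeq k = {..<k}" for k by (auto simp: underS_def natLeq_def)
  have FN: "Field natLeq = (UNIV :: nat set)" by (rule Field_natLeq)
  let ?S = "\<lambda>A. Sigma A (\<lambda>k. Field (?R k))"
  have fin: "finite {x \<in> ?S (UNIV :: nat set). e \<in> set (case_prod C x)}" for e
  proof -
    obtain k where k: "\<And>j. j \<ge> k \<Longrightarrow> e \<in> N j \<longleftrightarrow> e \<in> L" using lim by blast
    have "e \<notin> set (C j i)" if "i < n j" "j \<ge> k" for i j
      using Csub[OF that(1)] k[of j] k[of "Suc j"] that(2) by auto
    then have "{x \<in> ?S (UNIV :: nat set). e \<in> set (case_prod C x)} \<subseteq> Sigma {..<k} (\<lambda>k. {..<n k})"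
      unfolding FR by (auto simp: not_le[symmetric])
    then show ?thesis by (rule finite_subset) simp
  qed
  have state: "par (case_prod C) (?S {..<k}) = N k" for k
  proof (induction k)
    case 0
    then show ?case using N0 by simp
  next
    case (Suc k)
    have "?S {..<Suc k} = ?S {..<k} \<union> Pair k ` {..<n k}" unfolding FR by (auto simp: less_Suc_eq)
    moreover have "par (case_prod C) (?S {..<k} \<union> Pair k ` {..<n k})
        = sym_diff (par (case_prod C) (?S {..<k})) (par (case_prod C) (Pair k ` {..<n k}))"
    proof (rule par_Un)
      show "finite {x \<in> ?S {..<k} \<union> Pair k ` {..<n k}. e \<in> set (case_prod C x)}" for e
        by (rule finite_subset[OF _ fin[of e]]) (auto simp: FR)
    qed auto
    moreover have "par (case_prod C) (Pair k ` {..<n k}) = par (C k) {..<n k}"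
      by (subst par_image) (auto simp: inj_on_def comp_def)
    ultimately show ?case using Suc Cpar[of k] by auto
  qed
  have "reaches M (par (case_prod C) (?S (Field natLeq)))"
  proof (rule reaches_concat)
    show "Well_order natLeq" by (rule natLeq_Well_order)
    show "Well_order (?R k)" for k by (rule natLeq_on_Well_order)
    show "finite {x \<in> ?S (Field natLeq). e \<in> set (case_prod C x)}" for e
      unfolding FN by (rule fin)
    fix k i assume "i \<in> Field (?R k)"
    then have "i < n k" using FR by auto
    then show "set (C k i) \<subseteq> M \<and>
        dicycle (sym_diff (par (case_prod C) (?S (underS natLeq k))) (par (C k) (underS (?R k) i))) (C k i)"
      using cyc[of i k] Csub[of i k] sub[of k] sub[of "Suc k"] state uN uR by auto
  qed
  moreover have "par (case_prod C) (?S (UNIV :: nat set)) = L"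
  proof (rule set_eqI)
    fix e
    obtain k where k: "\<And>j. j \<ge> k \<Longrightarrow> e \<in> N j \<longleftrightarrow> e \<in> L" using lim by blast
    have "{x \<in> ?S (UNIV :: nat set). e \<in> set (case_prod C x)} = {x \<in> ?S {..<k}. e \<in> set (case_prod C x)}"
    proof -
      have "e \<notin> set (C j i)" if "i < n j" "j \<ge> k" for i j
        using Csub[OF that(1)] k[of j] k[of "Suc j"] that(2) by auto
      then show ?thesis unfolding FR by (auto simp: not_le[symmetric])
    qed
    then have "e \<in> par (case_prod C) (?S (UNIV :: nat set)) \<longleftrightarrow> e \<in> par (case_prod C) (?S {..<k})"
      by (simp add: par_def)
    then show "e \<in> par (case_prod C) (?S (UNIV :: nat set)) \<longleftrightarrow> e \<in> L" using state[of k] k[of k] by auto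
  qed
  ultimately show ?thesis unfolding FN by simp
qed

text \<open>A reversed cycle lies inside a strong component, so reversions create no new reachability.\<close>

lemma reaches_reach:
  assumes "reaches M F" "(x, y) \<in> (step F M)\<^sup>*"
  shows "(x, y) \<in> (step {} M)\<^sup>*"
proof -
  obtain r :: "('e \<times> nat) rel" and C where rs: "revseq M r C" and F: "F = par C (Field r)"
    using assms(1) unfolding reaches_def by blast
  \<comment> \<open>For an edge of \<open>M\<close> this means that it lies on a closed walk of the
    initial orientation, so that reversing it creates no new reachability.\<close>
  define cl where "cl e \<longleftrightarrow> (h e, t e) \<in> (step {} M)\<^sup>*" for e
  have steps: "step G M \<subseteq> (step {} M)\<^sup>*" if "\<And>e. e \<in> G \<Longrightarrow> cl e" for G
  proof
    fix p assume "p \<in> step G M"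
    then obtain e where e: "e \<in> M" "p = (src G e, trg G e)" by (auto simp: step_def)
    show "p \<in> (step {} M)\<^sup>*"
    proof (cases "e \<in> G")
      case True
      then show ?thesis using that[OF True] e by (simp add: cl_def src_def trg_def)
    next
      case False
      then show ?thesis using stepI[OF e(1), of "{}"] e(2) by (auto simp: src_def trg_def)
    qed
  qed
  have "wf (r - Id)" using rs Well_order_wf by (auto simp: revseq_def)
  then have all: "i \<in> Field r \<longrightarrow> (\<forall>e\<in>set (C i). cl e)" for i
  proof (induction i rule: wf_induct_rule)
    case (less i)
    show ?case
    proof (intro impI ballI)
      fix e assume i: "i \<in> Field r" and e: "e \<in> set (C i)"
      let ?G = "par C (underS r i)"
      have G: "cl e" if "e \<in> ?G" for e
      proof -
        have "?G \<subseteq> {e. cl e}"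
          using less Order_Relation.underS_Field[of r i] by (intro par_subset) (auto simp: underS_def)
        then show ?thesis using that by blast
      qed
      have "dicycle ?G (C i)" "set (C i) \<subseteq> M" using rs i by (auto simp: revseq_def)
      then have "(trg ?G e, src ?G e) \<in> (step ?G M)\<^sup>*"
        using dicycle_reach_back[OF _ e] reach_mono by metis
      then have "(trg ?G e, src ?G e) \<in> (step {} M)\<^sup>*"
        using rtrancl_subset_rtrancl[OF steps[OF G]] by blast
      then show "cl e" using G[of e] by (cases "e \<in> ?G") (auto simp: cl_def src_def trg_def)
    qed
  qed
  have "F \<subseteq> {e. cl e}" unfolding F using all by (intro par_subset) auto
  then have "step F M \<subseteq> (step {} M)\<^sup>*" by (intro steps) auto
  then show ?thesis using rtrancl_subset_rtrancl assms(2) by blast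
qed

end

subsection \<open>Countable graphs\<close>


text \<open>Szpilrajn's extension theorem relative to a transitive relation \<open>Q\<close>. It is
  applied to infinite connectivity in \<open>countable_case\<close> and to \<open>UNIV\<close> in
  \<open>resolvable\<close>.\<close>

lemma strict_order_extension:
  fixes R Q :: "'a rel"
  assumes R: "trans R" "irrefl R" "R \<subseteq> Q" and Q: "trans Q"
  obtains A where "R \<subseteq> A" "A \<subseteq> Q" "trans A" "irrefl A"
    "\<And>u v. (u, v) \<in> Q \<Longrightarrow> u \<noteq> v \<Longrightarrow> (u, v) \<in> A \<or> (v, u) \<in> A"
proof -
  define Z where "Z = {A. R \<subseteq> A \<and> A \<subseteq> Q \<and> trans A \<and> irrefl A}"
  have "\<exists>M\<in>Z. \<forall>X\<in>Z. M \<subseteq> X \<longrightarrow> X = M"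
  proof (rule subset_Zorn_nonempty)
    show "Z \<noteq> {}" using R by (auto simp: Z_def)
  next
    fix \<C> assume ne: "\<C> \<noteq> {}" and ch: "subset.chain Z \<C>"
    have sub: "\<C> \<subseteq> Z" and cmp: "\<And>X Y. X \<in> \<C> \<Longrightarrow> Y \<in> \<C> \<Longrightarrow> X \<subseteq> Y \<or> Y \<subseteq> X"
      using ch by (auto simp: subset_chain_def)
    have "trans (\<Union>\<C>)"
    proof (rule transI)
      fix x y z assume "(x, y) \<in> \<Union>\<C>" "(y, z) \<in> \<Union>\<C>"
      then obtain X Y where "X \<in> \<C>" "Y \<in> \<C>" "(x, y) \<in> X" "(y, z) \<in> Y" by blast
      then obtain W where W: "W \<in> \<C>" "(x, y) \<in> W" "(y, z) \<in> W" using cmp by blast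
      then have "trans W" using sub by (auto simp: Z_def)
      then show "(x, z) \<in> \<Union>\<C>" using W by (meson UnionI transD)
    qed
    moreover have "irrefl (\<Union>\<C>)" using sub by (auto simp: Z_def irrefl_def)
    ultimately show "\<Union>\<C> \<in> Z" using ne sub by (auto simp: Z_def)
  qed
  then obtain A where AZ: "A \<in> Z" and max: "\<And>X. X \<in> Z \<Longrightarrow> A \<subseteq> X \<Longrightarrow> X = A" by blast
  have A: "R \<subseteq> A" "A \<subseteq> Q" "trans A" "irrefl A" using AZ by (auto simp: Z_def)
  have "(u, v) \<in> A \<or> (v, u) \<in> A" if uv: "(u, v) \<in> Q" "u \<noteq> v" for u v
  proof (rule ccontr)
    assume n: "\<not> ?thesis"
    \<comment> \<open>The transitive closure of \<open>A\<close> with the incomparable pair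
      \<open>(u, v)\<close> added; transitivity of \<open>Q\<close> keeps it inside
      \<open>Q\<close>.\<close>
    define B where "B = A \<union> {(a, b). (a = u \<or> (a, u) \<in> A) \<and> (b = v \<or> (v, b) \<in> A)}"
    have "trans B"
    proof (rule transI)
      fix x y z assume "(x, y) \<in> B" "(y, z) \<in> B"
      then show "(x, z) \<in> B" using n uv(2) A(3) unfolding B_def by (auto dest: transD)
    qed
    moreover have "irrefl B"
      using n uv(2) A(3,4) unfolding B_def irrefl_def by (auto dest: transD)
    moreover have "B \<subseteq> Q"
    proof
      fix p assume "p \<in> B"
      then consider "p \<in> A" | a b where "p = (a, b)" "a = u \<or> (a, u) \<in> Q" "b = v \<or> (v, b) \<in> Q"
        using A(2) unfolding B_def by blast
      then show "p \<in> Q"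
      proof cases
        case 2
        then have "(a, v) \<in> Q" using uv(1) Q by (blast dest: transD)
        then show ?thesis using 2 Q by (blast dest: transD)
      qed (use A(2) in blast)
    qed
    ultimately have "B \<in> Z" using A(1) by (auto simp: Z_def B_def)
    then have "B = A" using max by (auto simp: B_def)
    then show False using n by (auto simp: B_def)
  qed
  then show ?thesis using that A by blast
qed

lemma rtrancl_distinct_path:
  assumes "(x, y) \<in> R\<^sup>*"
  obtains xs where "xs \<noteq> []" "hd xs = x" "last xs = y" "distinct xs" "successively (\<lambda>a b. (a, b) \<in> R) xs"
proof -
  have "\<exists>xs. xs \<noteq> [] \<and> hd xs = x \<and> last xs = y \<and> distinct xs \<and> successively (\<lambda>a b. (a, b) \<in> R) xs"
    using assms
  proof (induction rule: converse_rtrancl_induct)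
    case base
    show ?case by (rule exI[of _ "[y]"]) simp
  next
    case (step x z)
    then obtain xs where xs: "xs \<noteq> []" "hd xs = z" "last xs = y" "distinct xs"
      "successively (\<lambda>a b. (a, b) \<in> R) xs" by blast
    show ?case
    proof (cases "x \<in> set xs")
      case False
      then show ?thesis using xs step.hyps
        by (intro exI[of _ "x # xs"]) (auto simp: successively_Cons)
    next
      case True
      then obtain p q where pq: "xs = p @ x # q" by (auto dest: split_list)
      then show ?thesis using xs
        by (intro exI[of _ "x # q"]) (auto simp: successively_append_iff)
    qed
  qed
  then show ?thesis using that by blast
qed

text \<open>A walk uses finitely many pairs, so one member of a directed family contains all of
  them.\<close>

lemma rtrancl_UN_directed:
  assumes "(x, y) \<in> (\<Union>i\<in>I. W i)\<^sup>*" "I \<noteq> {}"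
    and dir: "\<And>i j. i \<in> I \<Longrightarrow> j \<in> I \<Longrightarrow> \<exists>k\<in>I. W i \<subseteq> W k \<and> W j \<subseteq> W k"
  obtains i where "i \<in> I" "(x, y) \<in> (W i)\<^sup>*"
proof -
  have "\<exists>i\<in>I. (x, y) \<in> (W i)\<^sup>*"
    using assms(1)
  proof (induction rule: rtrancl_induct)
    case base
    then show ?case using assms(2) by blast
  next
    case (step y z)
    then obtain i j where ij: "i \<in> I" "(x, y) \<in> (W i)\<^sup>*" "j \<in> I" "(y, z) \<in> W j" by blast
    then obtain k where k: "k \<in> I" "W i \<subseteq> W k" "W j \<subseteq> W k" using dir by metis
    then have "(x, y) \<in> (W k)\<^sup>*" "(y, z) \<in> W k" using ij rtrancl_mono by blast+
    then show ?case using k(1) by (meson rtrancl.rtrancl_into_rtrancl)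
  qed
  then show ?thesis using that by blast
qed

text \<open>A diagonal argument: infinite index sets are shrunk so that the trace on
  \<open>H k\<close> is constant on the \<open>k\<close>-th one, which is possible as
  \<open>H k\<close> has finitely many subsets; \<open>\<phi> k\<close> is picked from the
  \<open>k\<close>-th set.\<close>

lemma convergent_traces:
  fixes N H :: "nat \<Rightarrow> 'a set"
  assumes fin: "\<And>k. finite (H k)" and mono: "mono H"
  obtains \<phi> L where "\<And>k. k \<le> \<phi> k" "\<And>k. N (\<phi> k) \<inter> H k = L \<inter> H k" "L \<subseteq> (\<Union>k. N k)"
proof -
  have step: "\<exists>Y. Y \<subseteq> X \<and> infinite Y \<and> (\<exists>T. \<forall>j\<in>Y. N j \<inter> H k = T)" if "infinite X" for X k
  proof -
    have "finite ((\<lambda>j. N j \<inter> H k) ` X)"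
      by (rule finite_subset[of _ "Pow (H k)"]) (use fin[of k] in auto)
    from pigeonhole_infinite[OF that this] obtain a where
      "infinite {b \<in> X. N b \<inter> H k = N a \<inter> H k}" by blast
    then show ?thesis by (intro exI[of _ "{b \<in> X. N b \<inter> H k = N a \<inter> H k}"]) auto
  qed
  have "\<exists>X :: nat \<Rightarrow> nat set. \<forall>k. (infinite (X k) \<and> (\<exists>T. \<forall>j\<in>X k. N j \<inter> H k = T)) \<and> X (Suc k) \<subseteq> X k"
  proof (rule dependent_nat_choice)
    show "\<exists>X. infinite X \<and> (\<exists>T. \<forall>j\<in>X. N j \<inter> H 0 = T)" using step[of UNIV 0] by auto
  next
    fix X k assume "infinite X \<and> (\<exists>T. \<forall>j\<in>X. N j \<inter> H k = T)"
    then show "\<exists>Y. (infinite Y \<and> (\<exists>T. \<forall>j\<in>Y. N j \<inter> H (Suc k) = T)) \<and> Y \<subseteq> X"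
      using step[of X "Suc k"] by blast
  qed
  then obtain X :: "nat \<Rightarrow> nat set" where
    X: "\<forall>k. (infinite (X k) \<and> (\<exists>T. \<forall>j\<in>X k. N j \<inter> H k = T)) \<and> X (Suc k) \<subseteq> X k" ..
  have inf: "infinite (X k)" and T: "\<exists>T. \<forall>j\<in>X k. N j \<inter> H k = T" and dec: "X (Suc k) \<subseteq> X k" for k
    using spec[OF X, of k] by simp_all
  have "\<forall>k. \<exists>j. k \<le> j \<and> j \<in> X k"
    using inf unfolding infinite_nat_iff_unbounded_le by blast
  from choice[OF this] obtain \<phi> where \<phi>: "\<And>k. k \<le> \<phi> k" "\<And>k. \<phi> k \<in> X k" by blast
  have anti: "X j \<subseteq> X k" if "k \<le> j" for j k using dec that by (rule lift_Suc_antimono_le)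
  have tr: "N (\<phi> j) \<inter> H k = N (\<phi> k) \<inter> H k" if "k \<le> j" for j k
    using T[of k] \<phi>(2)[of k] \<phi>(2)[of j] anti[OF that] by (metis subsetD)
  define L where "L = (\<Union>k. N (\<phi> k) \<inter> H k)"
  have "N (\<phi> k) \<inter> H k = L \<inter> H k" for k
  proof -
    have "e \<in> N (\<phi> k)" if "e \<in> N (\<phi> j)" "e \<in> H j" "e \<in> H k" for e j
      using tr[of k j] tr[of j k] that by (cases "k \<le> j") auto
    then show ?thesis by (auto simp: L_def)
  qed
  moreover have "L \<subseteq> (\<Union>k. N k)" by (auto simp: L_def)
  ultimately show ?thesis using that[of \<phi> L] \<phi>(1) by metis
qed

section \<open>Infinite connectivity, finite stages and their limits\<close>

context edge_ends
begin

definition infconn :: "'e set \<Rightarrow> 'e set \<Rightarrow> 'v \<Rightarrow> 'v \<Rightarrow> bool" where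
  "infconn F M u v \<longleftrightarrow> (\<forall>G. finite G \<longrightarrow> (u, v) \<in> (step F (M - G))\<^sup>*)"

text \<open>The goal phrased with separators: no infinite connection inside a strong component.
  \<open>finite_connectivity\<close> turns it into a bound on path systems.\<close>

definition resolved :: "'e set \<Rightarrow> 'e set \<Rightarrow> bool" where
  "resolved F M \<longleftrightarrow> (\<forall>u v. u \<noteq> v \<longrightarrow> infconn F M u v \<longrightarrow> (v, u) \<notin> (step F M)\<^sup>*)"

text \<open>Deleting the finitely many reversed edges together with \<open>G\<close> leaves only
  edges that kept their initial orientation.\<close>

lemma infconn_finite_change:
  assumes "infconn {} M u v" "finite N"
  shows "infconn N M u v"
  unfolding infconn_def
proof (intro allI impI)
  fix G :: "'e set" assume "finite G"
  then have "(u, v) \<in> (step {} (M - (G \<union> N)))\<^sup>*" using assms by (auto simp: infconn_def)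
  moreover have "step {} (M - (G \<union> N)) = step N (M - (G \<union> N))" by (rule step_cong) auto
  ultimately show "(u, v) \<in> (step N (M - G))\<^sup>*" using reach_mono[of "M - (G \<union> N)" "M - G"] by auto
qed

text \<open>Each jump of \<^term>\<open>A\<close> is replaced by a walk that avoids \<^term>\<open>H\<close>.\<close>

lemma path_with_jumps:
  fixes w :: "'v \<Rightarrow> int"
  assumes "successively (\<lambda>x y. (x, y) \<in> step F H \<union> A) xs" "distinct xs" "xs \<noteq> []"
    and fin: "finite H" and "H \<subseteq> M" and A: "\<And>x y. (x, y) \<in> A \<Longrightarrow> infconn F M x y \<and> w x \<le> w y"
  shows "\<exists>S. finite S \<and> S \<subseteq> M \<and> (\<forall>f. sum (rise F f) S = f (last xs) - f (hd xs)) \<and>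
    (\<forall>e\<in>S \<inter> H. src F e \<in> set xs) \<and> sum (rise F w) (S \<inter> H) \<le> w (last xs) - w (hd xs)"
  using assms(1-3)
proof (induction xs rule: induct_list012)
  case (2 x)
  show ?case by (rule exI[of _ "{}"]) simp
next
  case (3 x y zs)
  then have xy: "(x, y) \<in> step F H \<union> A" and x: "x \<notin> set (y # zs)" by auto
  obtain S where S: "finite S" "S \<subseteq> M" "\<And>f. sum (rise F f) S = f (last (y # zs)) - f y"
    "\<And>e. e \<in> S \<inter> H \<Longrightarrow> src F e \<in> set (y # zs)" "sum (rise F w) (S \<inter> H) \<le> w (last (y # zs)) - w y"
    using 3 by auto
  from xy show ?case
  proof
    assume "(x, y) \<in> step F H"
    then obtain e where e: "e \<in> H" "x = src F e" "y = trg F e" by (auto simp: step_def)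
    \<comment> \<open>The edges of \<open>S \<inter> H\<close> start at vertices of the remaining
      path, where \<open>x\<close> does not recur.\<close>
    then have eS: "e \<notin> S" using S(4)[of e] x by auto
    have r: "rise F f e = f y - f x" for f using e by (simp add: rise_def)
    have "insert e S \<inter> H = insert e (S \<inter> H)" using e by blast
    then have "sum (rise F w) (insert e S \<inter> H) = rise F w e + sum (rise F w) (S \<inter> H)"
      using eS S(1) by simp
    then show ?thesis
      using S e eS r assms(5) by (intro exI[of _ "insert e S"]) auto
  next
    assume "(x, y) \<in> A"
    then have c: "infconn F M x y" and w: "w x \<le> w y" using A by auto
    \<comment> \<open>The replacing walk avoids \<open>S\<close> to stay edge-disjoint from it, and
      \<open>H\<close> to contribute nothing to the rise on \<open>H\<close>. The jump itself
      accounts for the nonnegative \<open>w y - w x\<close>, which gives the inequality.\<close>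
    have "(x, y) \<in> (step F (M - (S \<union> H)))\<^sup>*" using c S(1) fin by (auto simp: infconn_def)
    then obtain p where p: "walk F x p y" "distinct (map (src F) p)" "set p \<subseteq> M - (S \<union> H)"
      by (rule reach_walk)
    have "sum (rise F f) (S \<union> set p) = sum (rise F f) S + (f y - f x)" for f
      using p S(1) sum_rise_walk[OF p(1), of f] by (subst sum.union_disjoint) (auto simp: distinct_map)
    moreover have "(S \<union> set p) \<inter> H = S \<inter> H" using p(3) by blast
    ultimately show ?thesis
      using S p(3) w by (intro exI[of _ "S \<union> set p"]) auto
  qed
qed simp

text \<open>Confining edges and jumps to the finite \<open>H\<close> and \<open>V\<close> keeps the
  heights and the total rise finite. The maximum ranges over balanced subsets of all of
  \<open>M\<close>, since the walks replacing jumps run outside \<open>H\<close>. The height counts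
  predecessors in \<open>V\<close>, so it strictly increases along each jump.\<close>

lemma finite_stage:
  assumes A: "trans A" "irrefl A" "\<And>u v. (u, v) \<in> A \<Longrightarrow> infconn {} M u v"
    and fin: "finite H" "finite V" and HM: "H \<subseteq> M"
  obtains N where "balanced {} N" "N \<subseteq> M"
    "\<And>u v. (u, v) \<in> A \<inter> V \<times> V \<Longrightarrow> (v, u) \<notin> (step N H \<union> A \<inter> V \<times> V)\<^sup>*"
proof -
  let ?A = "A \<inter> V \<times> V"
  define w :: "'v \<Rightarrow> int" where "w x = int (card {z \<in> V. (z, x) \<in> A})" for x
  have w: "w x < w y" if "(x, y) \<in> ?A" for x y
  proof -
    have "{z \<in> V. (z, x) \<in> A} \<subset> {z \<in> V. (z, y) \<in> A}"
      using that A(1,2) by (auto simp: irrefl_def dest: transD)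
    then show ?thesis using fin(2) by (simp add: w_def psubset_card_mono)
  qed
  define \<Phi> where "\<Phi> N = sum (rise N w) H" for N
  let ?B = "{N. balanced {} N \<and> N \<subseteq> M}"
  \<comment> \<open>Only the part of \<open>N\<close> inside \<open>H\<close> counts, so the
    potential takes finitely many values even if there are infinitely many balanced sets.\<close>
  have "\<Phi> N = \<Phi> (N \<inter> H)" for N
    unfolding \<Phi>_def by (intro sum.cong refl) (auto simp: rise_def src_def trg_def)
  then have "\<Phi> ` ?B \<subseteq> \<Phi> ` Pow H" by (metis (no_types, lifting) Int_lower2 PowI image_iff image_subsetI)
  then have finB: "finite (\<Phi> ` ?B)" using fin(1) by (meson finite_Pow_iff finite_imageI finite_subset)
  have "{} \<in> ?B" by (simp add: balanced_def)
  then have "Max (\<Phi> ` ?B) \<in> \<Phi> ` ?B" using finB by (intro Max_in) auto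
  then obtain N where N: "balanced {} N" "N \<subseteq> M" and max: "Max (\<Phi> ` ?B) = \<Phi> N" by blast
  have "(v, u) \<notin> (step N H \<union> ?A)\<^sup>*" if uv: "(u, v) \<in> ?A" for u v
  proof
    assume "(v, u) \<in> (step N H \<union> ?A)\<^sup>*"
    then obtain xs where xs: "xs \<noteq> []" "hd xs = v" "last xs = u" "distinct xs"
      "successively (\<lambda>a b. (a, b) \<in> step N H \<union> ?A) xs" by (rule rtrancl_distinct_path)
    have NA: "infconn N M x y \<and> w x \<le> w y" if "(x, y) \<in> ?A" for x y
      using that A(3) infconn_finite_change N(1) w[OF that] by (auto simp: balanced_def)
    obtain S where S: "finite S" "S \<subseteq> M" "\<And>f. sum (rise N f) S = f u - f v"
      "sum (rise N w) (S \<inter> H) \<le> w u - w v"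
      using path_with_jumps[OF xs(5,4,1) fin(1) HM NA] xs(2,3) by auto
    have "(u, v) \<in> (step N (M - (S \<union> H)))\<^sup>*" using NA[OF uv] S(1) fin(1) by (auto simp: infconn_def)
    then obtain p where p: "walk N u p v" "distinct (map (src N) p)" "set p \<subseteq> M - (S \<union> H)"
      by (rule reach_walk)
    define Z where "Z = S \<union> set p"
    have "sum (rise N f) Z = 0" for f
      using p S(1,3) sum_rise_walk[OF p(1), of f] unfolding Z_def
      by (subst sum.union_disjoint) (auto simp: distinct_map)
    then have "balanced N Z" using S(1) by (simp add: balanced_def Z_def)
    then have "balanced {} (sym_diff N Z)" using balanced_sym_diff[of "{}" N Z] N(1) by simp
    then have "sym_diff N Z \<in> ?B" using N(2) S(2) p(3) by (auto simp: Z_def)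
    then have "\<Phi> (sym_diff N Z) \<le> \<Phi> N" using finB Max_ge[of "\<Phi> ` ?B"] unfolding max by blast
    \<comment> \<open>Reversing \<open>Z\<close> negates the rise on \<open>S \<inter> H\<close>.
      That rise is at most \<open>w u - w v < 0\<close>, so the potential would exceed its
      maximum.\<close>
    moreover have "\<Phi> (sym_diff N Z) = \<Phi> N - 2 * sum (rise N w) (S \<inter> H)"
    proof -
      have "Z \<inter> H = S \<inter> H" using p(3) by (auto simp: Z_def)
      have "\<Phi> (sym_diff N Z) = (\<Sum>e\<in>H. rise N w e - 2 * (if e \<in> Z then rise N w e else 0))"
        unfolding \<Phi>_def by (intro sum.cong refl) (simp add: rise_sym_diff)
      also have "\<dots> = \<Phi> N - 2 * (\<Sum>e\<in>H. if e \<in> Z then rise N w e else 0)"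
        by (simp add: \<Phi>_def sum_subtractf sum_distrib_left)
      also have "(\<Sum>e\<in>H. if e \<in> Z then rise N w e else 0) = sum (rise N w) (H \<inter> Z)"
        using fin(1) by (simp add: sum.inter_restrict)
      finally show ?thesis using \<open>Z \<inter> H = S \<inter> H\<close> by (simp add: Int_commute)
    qed
    moreover have "w u < w v" using w[OF uv] .
    ultimately show False using S(4) by linarith
  qed
  then show ?thesis using that N by blast
qed

text \<open>With the indicator of \<open>X\<close> as potential, a balanced set crosses the boundary
  of \<open>X\<close> equally often in both directions, and reversal exchanges the two kinds of
  edges. The in-cut may be infinite.\<close>

lemma balanced_cut:
  assumes bal: "balanced {} N" and NM: "N \<subseteq> M"
    and fin: "finite {e \<in> M. src {} e \<in> X \<and> trg {} e \<notin> X}"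
  shows "finite {e \<in> M. src N e \<in> X \<and> trg N e \<notin> X} \<and>
    card {e \<in> M. src N e \<in> X \<and> trg N e \<notin> X} = card {e \<in> M. src {} e \<in> X \<and> trg {} e \<notin> X}"
proof -
  let ?O = "{e \<in> M. src {} e \<in> X \<and> trg {} e \<notin> X}"
  let ?I = "{e \<in> N. src {} e \<notin> X \<and> trg {} e \<in> X}"
  have fN: "finite N" using bal by (simp add: balanced_def)
  define f :: "'v \<Rightarrow> int" where "f x = (if x \<in> X then 1 else 0)" for x
  have "0 = sum (rise {} f) N" using bal by (simp add: balanced_def)
  also have "\<dots> = (\<Sum>e\<in>N. (if e \<in> ?I then 1 else 0) - (if e \<in> ?O then 1 else 0))"
    using NM by (intro sum.cong refl) (auto simp: rise_def f_def)
  also have "\<dots> = int (card (N \<inter> ?I)) - int (card (N \<inter> ?O))"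
    using fN by (simp add: sum_subtractf sum.If_cases Int_def)
  finally have "card (N \<inter> ?O) = card ?I" by (simp add: Int_def)
  moreover have eq: "{e \<in> M. src N e \<in> X \<and> trg N e \<notin> X} = (?O - N) \<union> ?I"
    using NM by (auto simp: src_def trg_def)
  moreover have "card ((?O - N) \<union> ?I) = card (?O - N) + card ?I"
    using fin fN by (intro card_Un_disjoint) auto
  moreover have "card ?O = card (?O - N) + card (N \<inter> ?O)"
    using fin by (subst card_Un_disjoint[symmetric]) (auto intro: arg_cong[where f = card])
  ultimately show ?thesis using fin fN by auto
qed

text \<open>A finite separator yields a set \<open>X\<close> with finite out-cut. All stages keep
  its size, and each finite part of the out-cut in the limit is already present at some stage. So
  the out-cut is finite in the limit too and still separates \<open>v\<close> from
  \<open>u\<close>.\<close>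

lemma infconn_limit:
  fixes N :: "nat \<Rightarrow> 'e set"
  assumes bal: "\<And>k. balanced {} (N k)" and sub: "\<And>k. N k \<subseteq> M"
    and lim: "\<And>e. \<exists>k. \<forall>j\<ge>k. e \<in> N j \<longleftrightarrow> e \<in> L"
    and inf: "infconn L M u v"
  shows "infconn {} M u v"
proof (rule ccontr)
  assume "\<not> ?thesis"
  then obtain G where G: "finite G" "(u, v) \<notin> (step {} (M - G))\<^sup>*" by (auto simp: infconn_def)
  define X where "X = {x. (u, x) \<in> (step {} (M - G))\<^sup>*}"
  define out where "out F = {e \<in> M. src F e \<in> X \<and> trg F e \<notin> X}" for F
  have "out {} \<subseteq> G"
  proof
    fix e assume e: "e \<in> out {}"
    show "e \<in> G"
    proof (rule ccontr)
      assume "e \<notin> G"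
      then have "(src {} e, trg {} e) \<in> step {} (M - G)" using e by (intro stepI) (auto simp: out_def)
      then show False using e rtrancl_into_rtrancl[of u "src {} e" _ "trg {} e"]
        by (auto simp: out_def X_def)
    qed
  qed
  then have "finite (out {})" using G(1) finite_subset by blast
  then have out: "finite (out (N k)) \<and> card (out (N k)) = card (out {})" for k
    unfolding out_def by (intro balanced_cut bal sub)
  have "finite (out L)"
  proof (rule ccontr)
    assume "infinite (out L)"
    then obtain T where T: "T \<subseteq> out L" "finite T" "card T = Suc (card (out {}))"
      using infinite_arbitrarily_large by blast
    have "\<forall>e. \<exists>k. \<forall>j\<ge>k. e \<in> N j \<longleftrightarrow> e \<in> L" using lim by blast
    from choice[OF this] obtain k where k: "\<And>e j. j \<ge> k e \<Longrightarrow> e \<in> N j \<longleftrightarrow> e \<in> L" by blast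
    define j where "j = Max (k ` T)"
    have "e \<in> N j \<longleftrightarrow> e \<in> L" if "e \<in> T" for e
      using T(2) that k[of e j] by (auto simp: j_def)
    then have "T \<subseteq> out (N j)" using T(1) by (auto simp: out_def src_def trg_def)
    then show False using out[of j] T(3) card_mono[of "out (N j)" T] by auto
  qed
  then have "(u, v) \<in> (step L (M - out L))\<^sup>*" using inf by (simp add: infconn_def)
  then have "v \<in> X"
  proof (induction rule: rtrancl_induct)
    case base
    show ?case by (simp add: X_def)
  next
    case (step y z)
    then show ?case by (auto simp: step_def out_def)
  qed
  then show False using G(2) by (simp add: X_def)
qed

text \<open>A closed walk through a jump is finite, so it would already exist at a stage. An
  infinite connection of the limit is an initial one by \<open>infconn_limit\<close>, hence
  comparable in \<open>A\<close>, and so it has no way back.\<close>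

lemma countable_case:
  assumes M: "countable M" and R: "trans R" "irrefl R" "\<And>u v. (u, v) \<in> R \<Longrightarrow> infconn {} M u v"
  obtains L where "reaches M L" "\<And>u v. (u, v) \<in> R \<Longrightarrow> (v, u) \<notin> (step L M \<union> R)\<^sup>*" "resolved L M"
proof -
  define Q where "Q = {(u, v). infconn {} M u v}"
  have "trans Q" unfolding Q_def infconn_def by (rule transI) (auto intro: rtrancl_trans)
  moreover have "R \<subseteq> Q" using R(3) by (auto simp: Q_def)
  ultimately obtain A where A: "R \<subseteq> A" "A \<subseteq> Q" "trans A" "irrefl A"
    and tot: "\<And>u v. (u, v) \<in> Q \<Longrightarrow> u \<noteq> v \<Longrightarrow> (u, v) \<in> A \<or> (v, u) \<in> A"
    using strict_order_extension[OF R(1,2)] by metis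
  have Ainf: "infconn {} M u v" if "(u, v) \<in> A" for u v using that A(2) by (auto simp: Q_def)
  define H where "H k = {e \<in> M. to_nat_on M e < k}" for k
  have finH: "finite (H k)" for k
  proof -
    have "inj_on (to_nat_on M) (H k)"
      using inj_on_to_nat_on[OF M] by (rule inj_on_subset) (auto simp: H_def)
    moreover have "to_nat_on M ` H k \<subseteq> {..<k}" by (auto simp: H_def)
    ultimately show ?thesis by (rule inj_on_finite) simp
  qed
  have monoH: "mono H" by (rule monoI) (auto simp: H_def)
  have HM: "H k \<subseteq> M" for k by (auto simp: H_def)
  have UH: "(\<Union>k. H k) = M" by (auto simp: H_def)
  define V where "V k = ends (H k)" for k
  have finV: "finite (V k)" for k using finH by (simp add: V_def ends_def)
  have monoV: "V k \<subseteq> V j" if "k \<le> j" for k j unfolding V_def using ends_mono monoD[OF monoH that] .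
  have "\<forall>k. \<exists>N. balanced {} N \<and> N \<subseteq> M \<and>
    (\<forall>u v. (u, v) \<in> A \<inter> V k \<times> V k \<longrightarrow> (v, u) \<notin> (step N (H k) \<union> A \<inter> V k \<times> V k)\<^sup>*)"
  proof (rule allI, rule finite_stage[OF A(3,4) Ainf finH finV HM])
    fix k N assume "balanced {} N" "N \<subseteq> M"
      and *: "\<And>u v. (u, v) \<in> A \<inter> V k \<times> V k \<Longrightarrow> (v, u) \<notin> (step N (H k) \<union> A \<inter> V k \<times> V k)\<^sup>*"
    then show "\<exists>N. balanced {} N \<and> N \<subseteq> M \<and>
        (\<forall>u v. (u, v) \<in> A \<inter> V k \<times> V k \<longrightarrow> (v, u) \<notin> (step N (H k) \<union> A \<inter> V k \<times> V k)\<^sup>*)"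
      by (intro exI[of _ N] conjI allI impI *)
  qed
  from choice[OF this] obtain N where N: "\<And>k. balanced {} (N k)" "\<And>k. N k \<subseteq> M"
    "\<And>k u v. (u, v) \<in> A \<inter> V k \<times> V k \<Longrightarrow> (v, u) \<notin> (step (N k) (H k) \<union> A \<inter> V k \<times> V k)\<^sup>*"
    by metis
  obtain \<phi> L where \<phi>: "\<And>k. k \<le> \<phi> k" and L: "\<And>k. N (\<phi> k) \<inter> H k = L \<inter> H k" "L \<subseteq> (\<Union>k. N k)"
    using convergent_traces[OF finH monoH] by metis
  have LM: "L \<subseteq> M" using L(2) N(2) by blast
  \<comment> \<open>Shifted by one, so that the sequence starts from the initial
    orientation.\<close>
  define N' where "N' k = (case k of 0 \<Rightarrow> {} | Suc j \<Rightarrow> N (\<phi> j))" for k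
  have N'0: "N' 0 = {}" by (simp add: N'_def)
  have N'bal: "balanced {} (N' k)" and N'M: "N' k \<subseteq> M" for k
    using N(1,2) by (auto simp: N'_def balanced_def split: nat.splits)
  have lim: "\<exists>k. \<forall>j\<ge>k. e \<in> N' j \<longleftrightarrow> e \<in> L" for e
  proof (cases "e \<in> M")
    case False
    then show ?thesis using LM N'M by blast
  next
    case True
    then obtain k where k: "e \<in> H k" using UH by blast
    have "e \<in> N' j \<longleftrightarrow> e \<in> L" if j: "j \<ge> Suc k" for j
    proof -
      obtain i where i: "j = Suc i" "k \<le> i" using j by (cases j) auto
      then have "e \<in> H i" using k monoH by (meson monoD subsetD)
      then show ?thesis using L(1)[of i] i(1) by (auto simp: N'_def)
    qed
    then show ?thesis by blast
  qed
  have 1: "reaches M L" by (rule reaches_limit[OF N'0 N'bal N'M lim])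
  have 2: "(v, u) \<notin> (step L M \<union> A)\<^sup>*" if uv: "(u, v) \<in> A" for u v
  proof
    assume vu: "(v, u) \<in> (step L M \<union> A)\<^sup>*"
    let ?W = "\<lambda>k. step L (H k) \<union> A \<inter> V k \<times> V k"
    have Wmono: "?W k \<subseteq> ?W j" if "k \<le> j" for k j
      using step_mono[OF monoD[OF monoH that], of L] monoV[OF that] by blast
    have UV: "\<exists>k. x \<in> V k \<and> y \<in> V k" if "(x, y) \<in> A" for x y
    proof -
      have "(x, y) \<in> (step {} M)\<^sup>*" using Ainf[OF that] unfolding infconn_def by (metis Diff_empty finite.emptyI)
      moreover have "x \<noteq> y" using that A(4) by (auto simp: irrefl_def)
      ultimately have "x \<in> ends M" "y \<in> ends M" by (auto dest: reach_ends)
      then have "x \<in> (\<Union>k. V k)" "y \<in> (\<Union>k. V k)" unfolding V_def by (auto simp: ends_UN[symmetric] UH)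
      then obtain i j where "x \<in> V i" "y \<in> V j" by blast
      then show ?thesis using monoV[of i "max i j"] monoV[of j "max i j"] by auto
    qed
    have "step L M \<union> A \<subseteq> (\<Union>k. ?W k)"
    proof
      fix p assume "p \<in> step L M \<union> A"
      then show "p \<in> (\<Union>k. ?W k)"
      proof
        assume "p \<in> step L M"
        then have "p \<in> (\<Union>k. step L (H k))" unfolding step_UN[symmetric] UH .
        then show ?thesis by blast
      next
        assume "p \<in> A"
        then show ?thesis using UV[of "fst p" "snd p"] by (cases p) auto
      qed
    qed
    then have "(v, u) \<in> (\<Union>k\<in>UNIV. ?W k)\<^sup>*" using vu rtrancl_mono by blast
    then obtain i where i: "(v, u) \<in> (?W i)\<^sup>*"
    proof (rule rtrancl_UN_directed)
      show "\<exists>k\<in>UNIV. ?W i \<subseteq> ?W k \<and> ?W j \<subseteq> ?W k" for i j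
        using Wmono[of i "max i j"] Wmono[of j "max i j"] by (intro bexI[of _ "max i j"]) simp_all
    qed auto
    obtain j where j: "u \<in> V j" "v \<in> V j" using UV[OF uv] by blast
    define k where "k = max i j"
    \<comment> \<open>Stage \<open>\<phi> k\<close> agrees with \<open>L\<close> on
      \<open>H k\<close>, while its guarantee covers the larger set
      \<open>H (\<phi> k)\<close>.\<close>
    have "step L (H k) = step (N (\<phi> k)) (H k)" using L(1)[of k] by (intro step_cong) simp
    also have "\<dots> \<subseteq> step (N (\<phi> k)) (H (\<phi> k))" by (intro step_mono monoD[OF monoH] \<phi>)
    finally have "?W k \<subseteq> step (N (\<phi> k)) (H (\<phi> k)) \<union> A \<inter> V (\<phi> k) \<times> V (\<phi> k)"
      using monoV[OF \<phi>[of k]] by blast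
    moreover have "(v, u) \<in> (?W k)\<^sup>*" using i rtrancl_mono[OF Wmono[of i k]] by (auto simp: k_def)
    ultimately have "(v, u) \<in> (step (N (\<phi> k)) (H (\<phi> k)) \<union> A \<inter> V (\<phi> k) \<times> V (\<phi> k))\<^sup>*"
      using rtrancl_mono by blast
    moreover have "(u, v) \<in> A \<inter> V (\<phi> k) \<times> V (\<phi> k)"
      using uv j monoV[of j "\<phi> k"] \<phi>[of k] by (auto simp: k_def)
    ultimately show False using N(3) by blast
  qed
  have 3: "resolved L M"
    unfolding resolved_def
  proof (intro allI impI notI)
    fix u v assume uv: "u \<noteq> v" "infconn L M u v" and vu: "(v, u) \<in> (step L M)\<^sup>*"
    have "infconn {} M u v" by (rule infconn_limit[OF N'bal N'M lim uv(2)])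
    then have "(u, v) \<in> A \<or> (v, u) \<in> A" using tot uv(1) by (auto simp: Q_def)
    moreover have "(u, v) \<in> (step L M)\<^sup>*" using uv(2) unfolding infconn_def by (metis Diff_empty finite.emptyI)
    moreover have "(step L M)\<^sup>* \<subseteq> (step L M \<union> A)\<^sup>*" by (rule rtrancl_mono) blast
    ultimately show False using 2 vu by blast
  qed
  have "(v, u) \<notin> (step L M \<union> R)\<^sup>*" if "(u, v) \<in> R" for u v
    using 2[of u v] that A(1) rtrancl_mono[of "step L M \<union> R" "step L M \<union> A"] by blast
  then show ?thesis using that 1 3 by blast
qed

end

subsection \<open>Chains of subgraphs\<close>


unbundle cardinal_syntax

text \<open>An initial and a final part in \<open>T\<close> are split off; in between, each
  excursion through \<open>T\<close> from \<open>V\<close> back to \<open>V\<close> is contracted to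
  a single pair.\<close>

lemma rtrancl_Un_split:
  assumes "(x, y) \<in> (S \<union> T)\<^sup>*" and S: "S \<subseteq> V \<times> V"
  shows "(x, y) \<in> T\<^sup>* \<or>
    (\<exists>a b. a \<in> V \<and> b \<in> V \<and> (x, a) \<in> T\<^sup>* \<and> (a, b) \<in> (S \<union> T\<^sup>* \<inter> V \<times> V)\<^sup>* \<and> (b, y) \<in> T\<^sup>*)"
  using assms(1)
proof (induction rule: rtrancl_induct)
  case (step y z)
  show ?case
  proof (cases "(y, z) \<in> T")
    case True
    then show ?thesis using step.IH by (meson rtrancl.rtrancl_into_rtrancl)
  next
    case False
    then have yz: "(y, z) \<in> S" "y \<in> V" "z \<in> V" using step.hyps S by auto
    from step.IH show ?thesis
    proof
      assume "(x, y) \<in> T\<^sup>*"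
      moreover have "(y, z) \<in> (S \<union> T\<^sup>* \<inter> V \<times> V)\<^sup>*" using yz by blast
      ultimately show ?thesis using yz by blast
    next
      assume "\<exists>a b. a \<in> V \<and> b \<in> V \<and> (x, a) \<in> T\<^sup>* \<and> (a, b) \<in> (S \<union> T\<^sup>* \<inter> V \<times> V)\<^sup>* \<and> (b, y) \<in> T\<^sup>*"
      then obtain a b where ab: "a \<in> V" "b \<in> V" "(x, a) \<in> T\<^sup>*"
        "(a, b) \<in> (S \<union> T\<^sup>* \<inter> V \<times> V)\<^sup>*" "(b, y) \<in> T\<^sup>*" by blast
      have "(b, y) \<in> S \<union> T\<^sup>* \<inter> V \<times> V" "(y, z) \<in> S \<union> T\<^sup>* \<inter> V \<times> V" using ab yz by auto
      then have "(a, z) \<in> (S \<union> T\<^sup>* \<inter> V \<times> V)\<^sup>*"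
        using ab(4) by (meson rtrancl.rtrancl_into_rtrancl)
      then show ?thesis using ab yz by blast
    qed
  qed
qed simp

lemma rtrancl_Un_jump:
  assumes "(x, y) \<in> (S \<union> J)\<^sup>*"
  shows "(x, y) \<in> S\<^sup>* \<or> (\<exists>a b. (a, b) \<in> J \<and> (x, a) \<in> (S \<union> J)\<^sup>* \<and> (b, y) \<in> (S \<union> J)\<^sup>*)"
  using assms
proof (induction rule: rtrancl_induct)
  case (step y z)
  show ?case
  proof (cases "(y, z) \<in> J")
    case True
    then show ?thesis using step.hyps(1) by blast
  next
    case False
    then have "(y, z) \<in> S" using step.hyps(2) by blast
    then show ?thesis using step.IH step.hyps(2) by (meson rtrancl.rtrancl_into_rtrancl)
  qed
qed simp

context edge_ends
begin

text \<open>For infinite \<open>X\<close> the second disjunct covers the first. For finite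
  \<open>X\<close> the first one admits \<open>G = X\<close>, which reduces \<open>strong X\<close>
  to equality; it also makes \<open>strong M\<close> imply \<open>infconn {} M\<close> for every
  countable \<open>M\<close>.\<close>

definition strong :: "'e set \<Rightarrow> 'v rel" where
  "strong X = {(u, v). \<forall>G\<subseteq>X. finite G \<or> |G| <o |X| \<longrightarrow> (u, v) \<in> (step {} (X - G))\<^sup>*}"

lemma strong_reach: "(u, v) \<in> strong X \<Longrightarrow> (u, v) \<in> (step {} X)\<^sup>*"
  unfolding strong_def by (auto dest: spec[of _ "{}"])

lemma trans_strong: "trans (strong X)"
  by (rule transI) (auto simp: strong_def intro: rtrancl_trans)

lemma resolved_cong: "F \<inter> M = G \<inter> M \<Longrightarrow> resolved F M \<longleftrightarrow> resolved G M"
proof -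
  assume "F \<inter> M = G \<inter> M"
  then have "step F (M - X) = step G (M - X)" for X by (intro step_cong) blast
  from this this[of "{}"] show ?thesis by (simp add: resolved_def infconn_def)
qed

end

section \<open>Chains of edge sets and the jumps of their members\<close>

locale edge_chain = edge_ends t h
  for t h :: "'e \<Rightarrow> 'v" +
  fixes M :: "'e set" and r :: "'i rel" and N :: "'i \<Rightarrow> 'e set"
    and F :: "'e set" and ord :: "'v rel"
  assumes r: "Well_order r"
    and N_mono: "(a, b) \<in> r \<Longrightarrow> N a \<subseteq> N b"
    and N_cover: "(\<Union>a\<in>Field r. N a) = M"
    and ord: "trans ord" "irrefl ord" "\<And>u v. u \<noteq> v \<Longrightarrow> (u, v) \<in> ord \<or> (v, u) \<in> ord"
begin

definition B :: "'i \<Rightarrow> 'e set" where "B a = (\<Union>b\<in>underS r a. N b)"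

definition P :: "'i \<Rightarrow> 'e set" where "P a = N a - B a"

text \<open>The trace on \<open>X\<close> of walks outside \<open>X\<close>. Only the initial
  orientation enters, so jumps do not depend on \<open>F\<close>, and \<open>ord\<close> admits at
  most one direction of each pair.\<close>

definition jumps :: "'e set \<Rightarrow> 'v rel" where
  "jumps X = {(u, v) \<in> ord. u \<in> ends X \<and> v \<in> ends X \<and> (u, v) \<in> (step {} (M - X))\<^sup>*}"

text \<open>These are the members of the chain, completed by the unions of initial parts; the parts
  that are solved separately are the differences \<open>P a\<close>.\<close>

definition layer :: "'e set \<Rightarrow> bool" where
  "layer Y \<longleftrightarrow> (\<exists>a\<in>Field r. Y = N a \<or> Y = B a)"

lemma NM: "a \<in> Field r \<Longrightarrow> N a \<subseteq> M"
  using N_cover by blast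

lemma r_facts: "trans r" "antisym r" "total_on (Field r) r" "refl_on (Field r) r"
  using r by (auto simp: order_on_defs)

lemma r_linear: "a \<in> Field r \<Longrightarrow> b \<in> Field r \<Longrightarrow> (a, b) \<in> r \<or> (b, a) \<in> r"
  using r_facts(3,4) by (cases "a = b") (auto simp: total_on_def refl_on_def)

lemma B_sub_N: "B a \<subseteq> N a"
  using N_mono by (auto simp: B_def underS_def)

lemma N_eq: "N a = B a \<union> P a"
  using B_sub_N by (auto simp: P_def)

lemma B_directed:
  assumes "b \<in> underS r a" "c \<in> underS r a"
  obtains d where "d \<in> underS r a" "(b, d) \<in> r" "(c, d) \<in> r"
proof -
  have "b \<in> Field r" "c \<in> Field r" using assms by (auto simp: underS_def Field_def)
  then have "(b, c) \<in> r \<or> (c, b) \<in> r" "(b, b) \<in> r" "(c, c) \<in> r"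
    using r_linear by blast+
  then show ?thesis using assms that by blast
qed

lemma N_directed:
  assumes "b \<in> Field r" "c \<in> Field r"
  obtains d where "d \<in> Field r" "(b, d) \<in> r" "(c, d) \<in> r"
  using r_linear[OF assms] r_linear[OF assms(1,1)] r_linear[OF assms(2,2)] assms that by blast

lemma jumps_restrict:
  assumes "X \<subseteq> Y"
  shows "jumps Y \<inter> ends X \<times> ends X \<subseteq> jumps X"
  using reach_mono[of "M - Y" "M - X"] assms by (auto simp: jumps_def)

text \<open>A walk is finite and the index set directed, so a single \<open>N b\<close> contains its
  edges and the ends of its jumps. \<open>W\<close> carries a deletion of edges through the
  argument, and \<open>b0\<close> provides an index from which on given vertices are
  present.\<close>

lemma walk_in_layer:
  assumes xy: "(x, y) \<in> (step F (X \<inter> W) \<union> J)\<^sup>*" and X: "X = (\<Union>b\<in>I. N b)"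
    and J: "J \<subseteq> ends X \<times> ends X" and ne: "I \<noteq> {}"
    and dir: "\<And>b c. b \<in> I \<Longrightarrow> c \<in> I \<Longrightarrow> \<exists>d\<in>I. (b, d) \<in> r \<and> (c, d) \<in> r" and b0: "b0 \<in> I"
  obtains b where "b \<in> I" "(b0, b) \<in> r" "(x, y) \<in> (step F (N b \<inter> W) \<union> J \<inter> ends (N b) \<times> ends (N b))\<^sup>*"
proof -
  let ?W = "\<lambda>b. step F (N b \<inter> W) \<union> J \<inter> ends (N b) \<times> ends (N b)"
  have W_mono: "?W b \<subseteq> ?W c" if "(b, c) \<in> r" for b c
    using step_mono[of "N b \<inter> W" "N c \<inter> W"] ends_mono[OF N_mono[OF that]] N_mono[OF that] by blast
  have "J \<subseteq> (\<Union>b\<in>I. ?W b)"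
  proof
    fix p assume p: "p \<in> J"
    obtain u v where uv: "p = (u, v)" by (cases p)
    then have "u \<in> ends X" "v \<in> ends X" using J p by auto
    then obtain b c where bc: "b \<in> I" "c \<in> I" "u \<in> ends (N b)" "v \<in> ends (N c)"
      unfolding X ends_UN by blast
    obtain d where d: "d \<in> I" "(b, d) \<in> r" "(c, d) \<in> r" using dir bc(1,2) by blast
    then have "u \<in> ends (N d)" "v \<in> ends (N d)" using bc ends_mono[OF N_mono] by blast+
    then show "p \<in> (\<Union>b\<in>I. ?W b)" using d(1) p uv by blast
  qed
  moreover have "step F (X \<inter> W) \<subseteq> (\<Union>b\<in>I. ?W b)"
  proof -
    have "X \<inter> W = (\<Union>b\<in>I. N b \<inter> W)" using X by blast
    then have "step F (X \<inter> W) = (\<Union>b\<in>I. step F (N b \<inter> W))" by (simp only: step_UN)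
    then show ?thesis by blast
  qed
  ultimately have "(x, y) \<in> (\<Union>b\<in>I. ?W b)\<^sup>*" using xy rtrancl_mono by (meson Un_least subsetD)
  then obtain b where b: "b \<in> I" "(x, y) \<in> (?W b)\<^sup>*"
  proof (rule rtrancl_UN_directed[OF _ ne])
    fix i j assume "i \<in> I" "j \<in> I"
    then obtain d where "d \<in> I" "(i, d) \<in> r" "(j, d) \<in> r" using dir by blast
    then show "\<exists>k\<in>I. ?W i \<subseteq> ?W k \<and> ?W j \<subseteq> ?W k" using W_mono by blast
  qed
  obtain d where "d \<in> I" "(b0, d) \<in> r" "(b, d) \<in> r" using dir b(1) b0 by blast
  then show ?thesis using that[of d] b(2) rtrancl_mono[OF W_mono] by blast
qed

lemma layer_below:
  assumes "layer Y" "a \<in> Field r" "Y \<subseteq> N a"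
  shows "Y = N a \<or> Y = B a \<or> (\<exists>c\<in>underS r a. Y \<subseteq> N c)"
proof -
  obtain c where c: "c \<in> Field r" "Y = N c \<or> Y = B c" using assms(1) by (auto simp: layer_def)
  show ?thesis
  proof (cases "c \<in> underS r a")
    case True
    then show ?thesis using c B_sub_N by blast
  next
    case False
    then have ac: "c = a \<or> (a, c) \<in> r \<and> a \<noteq> c"
      using r_linear[OF c(1) assms(2)] by (auto simp: underS_def)
    then have "c \<noteq> a \<Longrightarrow> N a \<subseteq> B c" unfolding B_def by (auto simp: underS_def)
    then show ?thesis using c assms(3) B_sub_N ac by blast
  qed
qed

end

text \<open>\<open>wide_after\<close> turns the jumps of \<open>N a\<close> into prescribed jumps of
  the piece \<open>P a\<close>; \<open>wide_before\<close> and \<open>ord_one_way\<close> force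
  excursions from \<open>B a\<close> into \<open>P a\<close> to follow \<open>ord\<close>. The three
  assumptions on pieces are what the induction on cardinality delivers for
  \<open>P a\<close>.\<close>

locale edge_chain_solution = edge_chain t h M r N F ord
  for t h :: "'e \<Rightarrow> 'v" and M :: "'e set" and r :: "'i rel" and N :: "'i \<Rightarrow> 'e set"
    and F :: "'e set" and ord :: "'v rel" +
  assumes wide_after: "\<And>a u v. a \<in> Field r \<Longrightarrow> u \<in> ends (N a) \<Longrightarrow> v \<in> ends (N a) \<Longrightarrow> u \<noteq> v \<Longrightarrow>
      (u, v) \<in> (step {} (M - N a))\<^sup>* \<Longrightarrow> (u, v) \<in> strong (P a)"
    and wide_before: "\<And>a u v. a \<in> Field r \<Longrightarrow> u \<in> ends (B a) \<Longrightarrow> v \<in> ends (B a) \<Longrightarrow> u \<noteq> v \<Longrightarrow>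
      (u, v) \<in> (step {} (M - B a))\<^sup>* \<Longrightarrow> (u, v) \<in> strong (P a)"
    and ord_one_way: "\<And>a u v. a \<in> Field r \<Longrightarrow> (u, v) \<in> (step {} (M - B a))\<^sup>* \<Longrightarrow>
      (v, u) \<notin> (step {} (M - B a))\<^sup>* \<Longrightarrow> (u, v) \<in> ord"
    and piece_reaches: "\<And>a. a \<in> Field r \<Longrightarrow> reaches (P a) (F \<inter> P a)"
    and piece_jumps: "\<And>a u v. a \<in> Field r \<Longrightarrow> (u, v) \<in> ord \<inter> strong (P a) \<Longrightarrow>
      (v, u) \<notin> (step F (P a) \<union> ord \<inter> strong (P a))\<^sup>*"
    and piece_resolved: "\<And>a. a \<in> Field r \<Longrightarrow> resolved F (P a)"
begin

section \<open>No jump lies on a closed walk\<close>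

definition T :: "'i \<Rightarrow> 'v rel" where
  "T a = step F (P a) \<union> ord \<inter> strong (P a)"

lemma T_reach:
  assumes a: "a \<in> Field r" and "(x, y) \<in> (T a)\<^sup>*"
  shows "(x, y) \<in> (step {} (P a))\<^sup>*"
proof -
  have "T a \<subseteq> (step {} (P a))\<^sup>*"
  proof
    fix p assume p: "p \<in> T a"
    show "p \<in> (step {} (P a))\<^sup>*"
    proof (cases "p \<in> step F (P a)")
      case True
      then have "p \<in> step (F \<inter> P a) (P a)" using step_cong[of F "P a" "F \<inter> P a"] by auto
      then show ?thesis using reaches_reach[OF piece_reaches[OF a], of "fst p" "snd p"]
        by (cases p) auto
    next
      case False
      then show ?thesis using p strong_reach by (cases p) (auto simp: T_def)
    qed
  qed
  then show ?thesis using assms(2) rtrancl_subset_rtrancl by blast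
qed

text \<open>An excursion from \<open>x\<close> to \<open>y\<close> against \<open>ord\<close> cannot
  be one-way outside \<open>B a\<close>, by \<open>ord_one_way\<close>. Then
  \<open>wide_before\<close> makes \<open>(y, x)\<close> a prescribed jump of the piece, and the
  excursion closes it, contrary to \<open>piece_jumps\<close>.\<close>

lemma T_jump:
  assumes a: "a \<in> Field r" and xy: "(x, y) \<in> (T a)\<^sup>*" "x \<in> ends (B a)" "y \<in> ends (B a)" "x \<noteq> y"
  shows "(x, y) \<in> jumps (B a)"
proof -
  have "P a \<subseteq> M - B a" using NM[OF a] by (auto simp: P_def)
  then have reach: "(x, y) \<in> (step {} (M - B a))\<^sup>*"
    using T_reach[OF a xy(1)] reach_mono by blast
  have "(x, y) \<in> ord"
  proof (rule ccontr)
    assume n: "(x, y) \<notin> ord"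
    then have yx: "(y, x) \<in> ord" using ord(3) xy(4) by blast
    have "(y, x) \<in> (step {} (M - B a))\<^sup>*" using ord_one_way[OF a reach] n by blast
    then have "(y, x) \<in> strong (P a)" using wide_before[OF a] xy(2-4) by blast
    then show False using piece_jumps[OF a, of y x] yx xy(1) by (auto simp: T_def)
  qed
  then show ?thesis using reach xy by (auto simp: jumps_def)
qed

lemma jumps_N_sub: "a \<in> Field r \<Longrightarrow> jumps (N a) \<subseteq> ord \<inter> strong (P a)"
  using wide_after ord(2) by (auto simp: jumps_def irrefl_def)

text \<open>A closed walk inside the piece is excluded by \<open>piece_jumps\<close>. Otherwise it
  meets \<open>B a\<close>, and the part around the jump from \<open>u\<close> to \<open>v\<close>
  is an excursion from \<open>y\<close> to \<open>x\<close>. By \<open>T_jump\<close> all excursions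
  become jumps of \<open>B a\<close>, which yields a closed walk there through the jump
  \<open>(y, x)\<close>.\<close>

lemma jumps_acyclic_step:
  assumes a: "a \<in> Field r"
    and IH: "\<And>u v. (u, v) \<in> jumps (B a) \<Longrightarrow> (v, u) \<notin> (step F (B a) \<union> jumps (B a))\<^sup>*"
    and uv: "(u, v) \<in> jumps (N a)"
  shows "(v, u) \<notin> (step F (N a) \<union> jumps (N a))\<^sup>*"
proof
  assume vu: "(v, u) \<in> (step F (N a) \<union> jumps (N a))\<^sup>*"
  have uvT: "(u, v) \<in> ord \<inter> strong (P a)" using jumps_N_sub[OF a] uv by blast
  have "step F (N a) \<union> jumps (N a) \<subseteq> step F (B a) \<union> T a"
    using jumps_N_sub[OF a] unfolding N_eq[of a] T_def step_Un by blast
  then have vu': "(v, u) \<in> (step F (B a) \<union> T a)\<^sup>*" using vu rtrancl_mono by blast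
  have nT: "(v, u) \<notin> (T a)\<^sup>*" using piece_jumps[OF a uvT] by (simp add: T_def)
  obtain x y where xy: "x \<in> ends (B a)" "y \<in> ends (B a)" "(v, x) \<in> (T a)\<^sup>*" "(y, u) \<in> (T a)\<^sup>*"
    "(x, y) \<in> (step F (B a) \<union> (T a)\<^sup>* \<inter> ends (B a) \<times> ends (B a))\<^sup>*"
    using rtrancl_Un_split[OF vu' step_ends] nT by blast
  have "(T a)\<^sup>* \<inter> ends (B a) \<times> ends (B a) \<subseteq> (jumps (B a))\<^sup>="
    using T_jump[OF a] by auto
  then have "step F (B a) \<union> (T a)\<^sup>* \<inter> ends (B a) \<times> ends (B a) \<subseteq> (step F (B a) \<union> jumps (B a))\<^sup>*"
    by auto
  then have conv: "(x, y) \<in> (step F (B a) \<union> jumps (B a))\<^sup>*"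
    using xy(5) rtrancl_subset_rtrancl by blast
  have "(u, v) \<in> T a" using uvT by (simp add: T_def)
  then have "(y, x) \<in> (T a)\<^sup>*"
    using xy(3,4) by (meson rtrancl.rtrancl_into_rtrancl rtrancl_trans)
  show False
  proof (cases "x = y")
    case True
    then show False using xy(3,4) nT rtrancl_trans by metis
  next
    case False
    then have "(y, x) \<in> jumps (B a)" using T_jump[OF a \<open>(y, x) \<in> (T a)\<^sup>*\<close>] xy by auto
    then show False using IH conv by blast
  qed
qed

lemma jumps_acyclic_union:
  assumes IH: "\<And>b u v. b \<in> underS r a \<Longrightarrow> (u, v) \<in> jumps (N b) \<Longrightarrow> (v, u) \<notin> (step F (N b) \<union> jumps (N b))\<^sup>*"
    and uv: "(u, v) \<in> jumps (B a)"
  shows "(v, u) \<notin> (step F (B a) \<union> jumps (B a))\<^sup>*"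
proof
  assume vu: "(v, u) \<in> (step F (B a) \<union> jumps (B a))\<^sup>*"
  have dir: "\<exists>d\<in>underS r a. (b, d) \<in> r \<and> (c, d) \<in> r" if "b \<in> underS r a" "c \<in> underS r a" for b c
    using B_directed[OF that] by blast
  have "u \<in> ends (B a)" "v \<in> ends (B a)" using uv by (auto simp: jumps_def)
  then obtain b c where bc: "b \<in> underS r a" "c \<in> underS r a" "u \<in> ends (N b)" "v \<in> ends (N c)"
    unfolding B_def ends_UN by blast
  obtain b0 where b0: "b0 \<in> underS r a" "(b, b0) \<in> r" "(c, b0) \<in> r" using dir bc(1,2) by blast
  have sub: "jumps (B a) \<subseteq> ends (B a) \<times> ends (B a)" by (auto simp: jumps_def)
  have ne: "underS r a \<noteq> {}" using b0 by blast
  have "(v, u) \<in> (step F (B a \<inter> UNIV) \<union> jumps (B a))\<^sup>*" using vu by simp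
  then obtain d where d: "d \<in> underS r a" "(b0, d) \<in> r"
    "(v, u) \<in> (step F (N d \<inter> UNIV) \<union> jumps (B a) \<inter> ends (N d) \<times> ends (N d))\<^sup>*"
    by (rule walk_in_layer[OF _ B_def sub ne dir b0(1)])
  have NB: "N d \<subseteq> B a" using d(1) by (auto simp: B_def)
  have "step F (N d \<inter> UNIV) \<union> jumps (B a) \<inter> ends (N d) \<times> ends (N d) \<subseteq> step F (N d) \<union> jumps (N d)"
    using jumps_restrict[OF NB] by auto
  then have "(v, u) \<in> (step F (N d) \<union> jumps (N d))\<^sup>*" using d(3) rtrancl_mono by blast
  moreover have "u \<in> ends (N d)" "v \<in> ends (N d)"
    using bc b0 d(2) ends_mono[OF N_mono] by blast+
  then have "(u, v) \<in> jumps (N d)" using jumps_restrict[OF NB] uv by blast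
  ultimately show False using IH d(1) by blast
qed

lemma jumps_acyclic_N:
  "a \<in> Field r \<Longrightarrow> (u, v) \<in> jumps (N a) \<Longrightarrow> (v, u) \<notin> (step F (N a) \<union> jumps (N a))\<^sup>*"
proof (induction a arbitrary: u v rule: wf_induct_rule[OF Well_order_wf[OF r]])
  case (1 a)
  show ?case
  proof (rule jumps_acyclic_step[OF 1(2) _ 1(3)])
    fix u v assume "(u, v) \<in> jumps (B a)"
    then show "(v, u) \<notin> (step F (B a) \<union> jumps (B a))\<^sup>*"
    proof (rule jumps_acyclic_union[rotated])
      fix b u v assume b: "b \<in> underS r a" and uv: "(u, v) \<in> jumps (N b)"
      have "(b, a) \<in> r - Id" "b \<in> Field r" using b by (auto simp: underS_def Field_def)
      then show "(v, u) \<notin> (step F (N b) \<union> jumps (N b))\<^sup>*" using 1(1) uv by blast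
    qed
  qed
qed

lemma jumps_acyclic:
  assumes "layer Y" "(u, v) \<in> jumps Y"
  shows "(v, u) \<notin> (step F Y \<union> jumps Y)\<^sup>*"
proof -
  obtain a where a: "a \<in> Field r" "Y = N a \<or> Y = B a" using assms(1) by (auto simp: layer_def)
  have "(v, u) \<notin> (step F (B a) \<union> jumps (B a))\<^sup>*" if "(u, v) \<in> jumps (B a)"
  proof (rule jumps_acyclic_union[OF _ that])
    fix b u v assume "b \<in> underS r a" "(u, v) \<in> jumps (N b)"
    then show "(v, u) \<notin> (step F (N b) \<union> jumps (N b))\<^sup>*"
      using jumps_acyclic_N by (auto simp: underS_def Field_def)
  qed
  then show ?thesis using a jumps_acyclic_N assms(2) by blast
qed

section \<open>Projection of walks to members of the chain\<close>

lemma project_step: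
  assumes a: "a \<in> Field r" and xy: "x \<in> ends (B a)" "y \<in> ends (B a)"
    "(x, y) \<in> (step F (N a \<inter> W) \<union> jumps (N a))\<^sup>*"
  shows "(x, y) \<in> (step F (B a \<inter> W) \<union> jumps (B a))\<^sup>*"
proof -
  let ?V = "ends (B a)"
  let ?D = "step F (B a \<inter> W) \<union> jumps (B a)"
  have "N a \<inter> W = (B a \<inter> W) \<union> (P a \<inter> W)" using N_eq[of a] by blast
  \<comment> \<open>Excursions may use any edge of the piece, since they become jumps; only the
    steps inside \<open>B a\<close> have to stay in \<open>W\<close>.\<close>
  moreover have "step F (P a \<inter> W) \<subseteq> step F (P a)" by (rule step_mono) blast
  ultimately have "step F (N a \<inter> W) \<union> jumps (N a) \<subseteq> step F (B a \<inter> W) \<union> T a"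
    using jumps_N_sub[OF a] by (auto simp: step_Un T_def)
  then have xy': "(x, y) \<in> (step F (B a \<inter> W) \<union> T a)\<^sup>*" using xy(3) rtrancl_mono by blast
  have S: "step F (B a \<inter> W) \<subseteq> ?V \<times> ?V"
    using step_ends[of F "B a \<inter> W"] ends_mono[of "B a \<inter> W" "B a"] by blast
  have sub: "(T a)\<^sup>* \<inter> ?V \<times> ?V \<subseteq> ?D\<^sup>*" using T_jump[OF a] by auto
  then have sub': "step F (B a \<inter> W) \<union> (T a)\<^sup>* \<inter> ?V \<times> ?V \<subseteq> ?D\<^sup>*" by auto
  from rtrancl_Un_split[OF xy' S] show ?thesis
  proof
    assume "(x, y) \<in> (T a)\<^sup>*"
    then show ?thesis using sub xy by blast
  next
    assume "\<exists>u v. u \<in> ?V \<and> v \<in> ?V \<and> (x, u) \<in> (T a)\<^sup>* \<and>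
      (u, v) \<in> (step F (B a \<inter> W) \<union> (T a)\<^sup>* \<inter> ?V \<times> ?V)\<^sup>* \<and> (v, y) \<in> (T a)\<^sup>*"
    then obtain u v where uv: "u \<in> ?V" "v \<in> ?V" "(x, u) \<in> (T a)\<^sup>*" "(v, y) \<in> (T a)\<^sup>*"
      "(u, v) \<in> (step F (B a \<inter> W) \<union> (T a)\<^sup>* \<inter> ?V \<times> ?V)\<^sup>*" by blast
    have "(x, u) \<in> ?D\<^sup>*" "(v, y) \<in> ?D\<^sup>*" using sub xy uv by blast+
    moreover have "(u, v) \<in> ?D\<^sup>*" using rtrancl_subset_rtrancl[OF sub'] uv(5) by blast
    ultimately show ?thesis by (meson rtrancl_trans)
  qed
qed

text \<open>Descent along the well-order: \<open>project_step\<close> leads from \<open>N a\<close>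
  to \<open>B a\<close>, and finiteness of the walk leads from \<open>B a\<close> to an earlier
  \<open>N d\<close> that still contains \<open>Y\<close>.\<close>

lemma project:
  "a \<in> Field r \<Longrightarrow> layer Y \<Longrightarrow> Y \<subseteq> N a \<Longrightarrow> x \<in> ends Y \<Longrightarrow> y \<in> ends Y \<Longrightarrow>
    (x, y) \<in> (step F (N a \<inter> W) \<union> jumps (N a))\<^sup>* \<Longrightarrow> (x, y) \<in> (step F (Y \<inter> W) \<union> jumps Y)\<^sup>*"
proof (induction a rule: wf_induct_rule[OF Well_order_wf[OF r]])
  case (1 a)
  consider "Y = N a" | "Y = B a" | c where "c \<in> underS r a" "Y \<subseteq> N c"
    using layer_below[OF 1(3,2,4)] by blast
  then show ?case
  proof cases
    case 1
    then show ?thesis using "1.prems" by simp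
  next
    case 2
    then show ?thesis using project_step[OF "1.prems"(1)] "1.prems" by blast
  next
    case (3 c)
    have NB: "N b \<subseteq> B a" if "b \<in> underS r a" for b using that by (auto simp: B_def)
    have "Y \<subseteq> B a" using 3 NB by blast
    then have "x \<in> ends (B a)" "y \<in> ends (B a)" using "1.prems"(4,5) ends_mono by blast+
    then have xy: "(x, y) \<in> (step F (B a \<inter> W) \<union> jumps (B a))\<^sup>*"
      using project_step[OF "1.prems"(1)] "1.prems"(6) by blast
    have sub: "jumps (B a) \<subseteq> ends (B a) \<times> ends (B a)" by (auto simp: jumps_def)
    have ne: "underS r a \<noteq> {}" using 3 by blast
    have dir: "\<exists>d\<in>underS r a. (b, d) \<in> r \<and> (c, d) \<in> r" if "b \<in> underS r a" "c \<in> underS r a" for b c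
      using B_directed[OF that] by blast
    obtain d where d: "d \<in> underS r a" "(c, d) \<in> r"
      "(x, y) \<in> (step F (N d \<inter> W) \<union> jumps (B a) \<inter> ends (N d) \<times> ends (N d))\<^sup>*"
      by (rule walk_in_layer[OF xy B_def sub ne dir 3(1)])
    have "(x, y) \<in> (step F (N d \<inter> W) \<union> jumps (N d))\<^sup>*"
      using d(3) jumps_restrict[OF NB[OF d(1)]] rtrancl_mono[of _ "step F (N d \<inter> W) \<union> jumps (N d)"]
      by blast
    moreover have "Y \<subseteq> N d" using 3(2) N_mono[OF d(2)] by blast
    moreover have "(d, a) \<in> r - Id" "d \<in> Field r" using d(1) by (auto simp: underS_def Field_def)
    ultimately show ?thesis using "1.IH" "1.prems" by blast
  qed
qed

lemma layer_sub_N: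
  assumes "layer Y"
  obtains a where "a \<in> Field r" "Y \<subseteq> N a"
  using assms B_sub_N unfolding layer_def by blast

lemma project_M:
  assumes Y: "layer Y" and W: "W \<subseteq> M" and xy: "x \<in> ends Y" "y \<in> ends Y" "(x, y) \<in> (step F W)\<^sup>*"
  shows "(x, y) \<in> (step F (Y \<inter> W) \<union> jumps Y)\<^sup>*"
proof -
  obtain a where a: "a \<in> Field r" "Y \<subseteq> N a" by (rule layer_sub_N[OF Y])
  have ne: "Field r \<noteq> {}" using a by blast
  have dir: "\<exists>d\<in>Field r. (b, d) \<in> r \<and> (c, d) \<in> r" if "b \<in> Field r" "c \<in> Field r" for b c
    using N_directed[OF that] by blast
  have MW: "M \<inter> W = W" using W by blast
  have xyM: "(x, y) \<in> (step F (M \<inter> W) \<union> {})\<^sup>*" unfolding MW using xy(3) by simp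
  obtain b where b: "b \<in> Field r" "(a, b) \<in> r"
    "(x, y) \<in> (step F (N b \<inter> W) \<union> {} \<inter> ends (N b) \<times> ends (N b))\<^sup>*"
    by (rule walk_in_layer[OF xyM N_cover[symmetric] empty_subsetI ne dir a(1)])
  have "(x, y) \<in> (step F (N b \<inter> W) \<union> jumps (N b))\<^sup>*"
    using b(3) rtrancl_mono[of "step F (N b \<inter> W)" "step F (N b \<inter> W) \<union> jumps (N b)"] by auto
  moreover have "Y \<subseteq> N b" using a(2) N_mono[OF b(2)] by blast
  ultimately show ?thesis using project[OF b(1) Y] xy by blast
qed

text \<open>Both the walk and a return walk project to \<open>Y\<close> with jumps. If the
  projection used a jump, the two would form a closed walk through it, contrary to
  \<open>jumps_acyclic\<close>.\<close>

lemma inside: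
  assumes Y: "layer Y" and W: "W \<subseteq> M" and uv: "u \<in> ends Y" "v \<in> ends Y" "(u, v) \<in> (step F W)\<^sup>*"
    and vu: "(v, u) \<in> (step F M)\<^sup>*"
  shows "(u, v) \<in> (step F (Y \<inter> W))\<^sup>*"
proof (rule ccontr)
  assume "(u, v) \<notin> (step F (Y \<inter> W))\<^sup>*"
  then obtain a b where ab: "(a, b) \<in> jumps Y" "(u, a) \<in> (step F (Y \<inter> W) \<union> jumps Y)\<^sup>*"
    "(b, v) \<in> (step F (Y \<inter> W) \<union> jumps Y)\<^sup>*"
    using rtrancl_Un_jump[OF project_M[OF Y W uv]] by blast
  have "step F (Y \<inter> X) \<union> jumps Y \<subseteq> step F Y \<union> jumps Y" for X
    using step_mono[of "Y \<inter> X" Y F] by blast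
  then have mono: "(x, y) \<in> (step F (Y \<inter> X) \<union> jumps Y)\<^sup>* \<Longrightarrow> (x, y) \<in> (step F Y \<union> jumps Y)\<^sup>*" for X x y
    using rtrancl_mono by blast
  have "(v, u) \<in> (step F Y \<union> jumps Y)\<^sup>*" using mono[OF project_M[OF Y order_refl uv(2,1) vu]] .
  then have "(b, a) \<in> (step F Y \<union> jumps Y)\<^sup>*" using mono[OF ab(2)] mono[OF ab(3)] by (meson rtrancl_trans)
  then show False using jumps_acyclic[OF Y ab(1)] by blast
qed

text \<open>The case of \<open>inside\<close> in which every edge of \<open>Y\<close> is deleted:
  the projected walk has no step left.\<close>

lemma outside:
  assumes Y: "layer Y" and xy: "x \<in> ends Y" "y \<in> ends Y" "(x, y) \<in> (step F (M - Y))\<^sup>*"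
    and yx: "(y, x) \<in> (step F M)\<^sup>*"
  shows "x = y"
proof -
  have "(x, y) \<in> (step F (Y \<inter> (M - Y)))\<^sup>*" by (rule inside[OF Y _ xy yx]) blast
  moreover have "step F (Y \<inter> (M - Y)) = {}" by (auto simp: step_def)
  ultimately show ?thesis by simp
qed

text \<open>A bad pair is taken at the least stage \<open>a\<close> that contains both vertices, so
  they do not both lie in \<open>B a\<close>. By \<open>inside\<close> its connections run in
  \<open>N a\<close>; they are split at \<open>K\<close>, the old vertices of its strong component.
  By \<open>outside\<close>, vertices of \<open>K\<close> joined within the piece coincide, so
  detours through old vertices collapse, and a bad pair of the piece \<open>P a\<close> itself
  appears.\<close>

lemma all_resolved: "resolved F M"
proof (rule ccontr)
  assume "\<not> ?thesis"
  define bad where "bad u v \<longleftrightarrow> u \<noteq> v \<and> infconn F M u v \<and> (v, u) \<in> (step F M)\<^sup>*" for u v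
  obtain u v where uv: "bad u v" using \<open>\<not> resolved F M\<close> by (auto simp: resolved_def bad_def)
  define Q where "Q = {a \<in> Field r. \<exists>u v. bad u v \<and> u \<in> ends (N a) \<and> v \<in> ends (N a)}"
  have in_layer: "\<exists>c\<in>I. u \<in> ends (N c) \<and> v \<in> ends (N c)"
    if mem: "u \<in> ends (\<Union>b\<in>I. N b)" "v \<in> ends (\<Union>b\<in>I. N b)"
      and dir: "\<And>b c. b \<in> I \<Longrightarrow> c \<in> I \<Longrightarrow> \<exists>d\<in>I. (b, d) \<in> r \<and> (c, d) \<in> r" for u v I
  proof -
    obtain b c where bc: "b \<in> I" "c \<in> I" "u \<in> ends (N b)" "v \<in> ends (N c)"
      using mem unfolding ends_UN by blast
    then obtain d where "d \<in> I" "(b, d) \<in> r" "(c, d) \<in> r" using dir by blast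
    then show ?thesis using bc ends_mono[OF N_mono] by blast
  qed
  have "v \<in> ends M" "u \<in> ends M" using uv reach_ends[of v u F M] by (auto simp: bad_def)
  then have uvU: "u \<in> ends (\<Union>b\<in>Field r. N b)" "v \<in> ends (\<Union>b\<in>Field r. N b)"
    by (simp_all only: N_cover)
  have "\<exists>c\<in>Field r. u \<in> ends (N c) \<and> v \<in> ends (N c)"
  proof (rule in_layer[OF uvU])
    fix b c assume "b \<in> Field r" "c \<in> Field r"
    then show "\<exists>d\<in>Field r. (b, d) \<in> r \<and> (c, d) \<in> r" using N_directed[of b c] by blast
  qed
  then obtain a0 where "a0 \<in> Q" using uv unfolding Q_def by blast
  then obtain a where a: "a \<in> Q" "\<And>b. (b, a) \<in> r - Id \<Longrightarrow> b \<notin> Q"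
    using wfE_min[OF Well_order_wf[OF r], of a0 Q] by blast
  then obtain u v where bad: "bad u v" and uvN: "u \<in> ends (N a)" "v \<in> ends (N a)" and aF: "a \<in> Field r"
    by (auto simp: Q_def)
  have notB: "\<not> (u \<in> ends (B a) \<and> v \<in> ends (B a))"
  proof
    assume "u \<in> ends (B a) \<and> v \<in> ends (B a)"
    then have uvU: "u \<in> ends (\<Union>b\<in>underS r a. N b)" "v \<in> ends (\<Union>b\<in>underS r a. N b)"
      by (simp_all add: B_def)
    have "\<exists>c\<in>underS r a. u \<in> ends (N c) \<and> v \<in> ends (N c)"
    proof (rule in_layer[OF uvU])
      fix b c assume "b \<in> underS r a" "c \<in> underS r a"
      then show "\<exists>d\<in>underS r a. (b, d) \<in> r \<and> (c, d) \<in> r" using B_directed[of b a c] by blast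
    qed
    then obtain c where c: "c \<in> underS r a" "u \<in> ends (N c)" "v \<in> ends (N c)" by blast
    then have "(c, a) \<in> r - Id" "c \<in> Field r" by (auto simp: underS_def Field_def)
    then show False using a(2) c bad by (auto simp: Q_def)
  qed
  have layers: "layer (N a)" "layer (B a)" using aF by (auto simp: layer_def)
  have neq: "u \<noteq> v" and vuM: "(v, u) \<in> (step F M)\<^sup>*" and inf: "infconn F M u v"
    using bad by (auto simp: bad_def)
  have uvG: "(u, v) \<in> (step F (M - G))\<^sup>*" if "finite G" for G using inf that by (auto simp: infconn_def)
  have uvM: "(u, v) \<in> (step F M)\<^sup>*" using uvG[of "{}"] by simp
  have PM: "P a \<subseteq> M - B a" using NM[OF aF] by (auto simp: P_def)
  define R where "R G = (step F (P a - G))\<^sup>*" for G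
  have R_M: "(x, y) \<in> R G \<Longrightarrow> (x, y) \<in> (step F M)\<^sup>*" for x y G
    unfolding R_def using reach_mono[of "P a - G" M] PM by blast
  have R_R: "(x, y) \<in> R G \<Longrightarrow> (x, y) \<in> R {}" for x y G
    unfolding R_def using reach_mono[of "P a - G" "P a - {}"] by blast
  define K where "K = {x \<in> ends (B a). (u, x) \<in> (step F M)\<^sup>* \<and> (x, u) \<in> (step F M)\<^sup>*}"
  have uniq: "x = y" if "x \<in> K" "y \<in> K" "(x, y) \<in> R {}" for x y
  proof (rule outside[OF layers(2)])
    show "x \<in> ends (B a)" "y \<in> ends (B a)" using that by (auto simp: K_def)
    show "(x, y) \<in> (step F (M - B a))\<^sup>*" using that(3) reach_mono[of "P a" "M - B a"] PM by (auto simp: R_def)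
    show "(y, x) \<in> (step F M)\<^sup>*" using that by (auto simp: K_def intro: rtrancl_trans)
  qed
  have no_bad_piece: "\<not> ((\<forall>G. finite G \<longrightarrow> (x, y) \<in> R G) \<and> (y, x) \<in> R {})" if "x \<noteq> y" for x y
    using piece_resolved[OF aF] that by (auto simp: resolved_def infconn_def R_def)
  have split: "(x, y) \<in> R G \<or> (\<exists>c d. c \<in> ends (B a) \<and> d \<in> ends (B a) \<and> (x, c) \<in> R G \<and>
      (c, d) \<in> (step F M)\<^sup>* \<and> (d, y) \<in> R G)"
    if "(x, y) \<in> (step F (N a - G))\<^sup>*" for x y G
  proof -
    have "N a - G = (B a - G) \<union> (P a - G)" using N_eq[of a] by blast
    then have xy: "(x, y) \<in> (step F (B a - G) \<union> step F (P a - G))\<^sup>*" using that by (simp only: step_Un)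
    have S: "step F (B a - G) \<subseteq> ends (B a) \<times> ends (B a)"
      using step_ends[of F "B a - G"] ends_mono[of "B a - G" "B a"] by blast
    have "B a \<subseteq> M" using B_sub_N NM[OF aF] by blast
    then have "step F (B a - G) \<subseteq> (step F M)\<^sup>*" using step_mono[of "B a - G" M F] by blast
    then have "step F (B a - G) \<union> R G \<inter> ends (B a) \<times> ends (B a) \<subseteq> (step F M)\<^sup>*" using R_M by auto
    then have "(c, d) \<in> (step F (B a - G) \<union> R G \<inter> ends (B a) \<times> ends (B a))\<^sup>* \<Longrightarrow> (c, d) \<in> (step F M)\<^sup>*" for c d
      using rtrancl_subset_rtrancl by blast
    then show ?thesis using rtrancl_Un_split[OF xy S] unfolding R_def[symmetric] by blast
  qed
  have forth: "(u, v) \<in> R G \<or> (\<exists>c d. c \<in> K \<and> d \<in> K \<and> (u, c) \<in> R G \<and> (d, v) \<in> R G)"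
    if "finite G" for G
  proof -
    have "(u, v) \<in> (step F (N a \<inter> (M - G)))\<^sup>*"
      by (rule inside[OF layers(1) _ uvN uvG[OF that] vuM]) blast
    moreover have "N a \<inter> (M - G) = N a - G" using NM[OF aF] by blast
    ultimately have "(u, v) \<in> (step F (N a - G))\<^sup>*" by simp
    from split[OF this] show ?thesis
    proof
      assume "\<exists>c d. c \<in> ends (B a) \<and> d \<in> ends (B a) \<and> (u, c) \<in> R G \<and>
        (c, d) \<in> (step F M)\<^sup>* \<and> (d, v) \<in> R G"
      then obtain c d where cd: "c \<in> ends (B a)" "d \<in> ends (B a)" "(u, c) \<in> R G"
        "(c, d) \<in> (step F M)\<^sup>*" "(d, v) \<in> R G" by blast
      have "c \<in> K" "d \<in> K"
        unfolding K_def using cd R_M[OF cd(3)] R_M[OF cd(5)] vuM by (auto intro: rtrancl_trans)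
      then show ?thesis using cd by blast
    qed blast
  qed
  have backward: "(v, u) \<in> R {} \<or> (\<exists>c d. c \<in> K \<and> d \<in> K \<and> (v, c) \<in> R {} \<and> (d, u) \<in> R {})"
  proof -
    have "(v, u) \<in> (step F (N a \<inter> M))\<^sup>*"
      by (rule inside[OF layers(1) order_refl uvN(2,1) vuM uvM])
    moreover have "N a \<inter> M = N a - {}" using NM[OF aF] by blast
    ultimately have "(v, u) \<in> (step F (N a - {}))\<^sup>*" by simp
    from split[OF this] show ?thesis
    proof
      assume "\<exists>c d. c \<in> ends (B a) \<and> d \<in> ends (B a) \<and> (v, c) \<in> R {} \<and>
        (c, d) \<in> (step F M)\<^sup>* \<and> (d, u) \<in> R {}"
      then obtain c d where cd: "c \<in> ends (B a)" "d \<in> ends (B a)" "(v, c) \<in> R {}"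
        "(c, d) \<in> (step F M)\<^sup>*" "(d, u) \<in> R {}" by blast
      have "c \<in> K" "d \<in> K"
        unfolding K_def using cd R_M[OF cd(3)] R_M[OF cd(5)] uvM by (auto intro: rtrancl_trans)
      then show ?thesis using cd by blast
    qed blast
  qed
  have R_trans: "(x, y) \<in> R {} \<Longrightarrow> (y, z) \<in> R {} \<Longrightarrow> (x, z) \<in> R {}" for x y z
    unfolding R_def by (rule rtrancl_trans)
  have uK: "u \<in> K" if "u \<in> ends (B a)" using that by (simp add: K_def)
  have vK: "v \<in> K" if "v \<in> ends (B a)" using that uvM vuM by (simp add: K_def)
  have KB: "x \<in> K \<Longrightarrow> x \<in> ends (B a)" for x by (simp add: K_def)
  consider "u \<in> ends (B a)" "v \<notin> ends (B a)" | "u \<notin> ends (B a)" "v \<in> ends (B a)"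
    | "u \<notin> ends (B a)" "v \<notin> ends (B a)" using notB by blast
  then show False
  proof cases
    case 1
    obtain c where c: "c \<in> K" "(v, c) \<in> R {}" using backward uK[OF 1(1)] by blast
    \<comment> \<open>For each \<open>G\<close> the walk enters the piece from some \<open>d\<close>
      in \<open>K\<close>; going on through \<open>v\<close> to \<open>c\<close> shows
      \<open>d = c\<close>, so the entry does not depend on \<open>G\<close>.\<close>
    have "(c, v) \<in> R G" if G: "finite G" for G
    proof -
      obtain d where d: "d \<in> K" "(d, v) \<in> R G" using forth[OF G] uK[OF 1(1)] by blast
      have "(d, c) \<in> R {}" using R_trans[OF R_R[OF d(2)] c(2)] .
      then show ?thesis using uniq[OF d(1) c(1)] d(2) by simp
    qed
    moreover have "c \<noteq> v" using KB[OF c(1)] 1(2) by blast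
    ultimately show False using no_bad_piece[of c v] c(2) by blast
  next
    case 2
    obtain d where d: "d \<in> K" "(d, u) \<in> R {}" using backward vK[OF 2(2)] by blast
    have "(u, d) \<in> R G" if G: "finite G" for G
    proof -
      obtain c where c: "c \<in> K" "(u, c) \<in> R G" using forth[OF G] vK[OF 2(2)] by blast
      have "(d, c) \<in> R {}" using R_trans[OF d(2) R_R[OF c(2)]] .
      then show ?thesis using uniq[OF d(1) c(1)] c(2) by simp
    qed
    moreover have "u \<noteq> d" using KB[OF d(1)] 2(1) by blast
    ultimately show False using no_bad_piece[of u d] d(2) by blast
  next
    case 3
    show False
    proof (cases "(v, u) \<in> R {}")
      case True
      \<comment> \<open>A detour that leaves the piece at \<open>c\<close> and re-enters it at
        \<open>d\<close> collapses: \<open>d\<close> reaches \<open>c\<close> within the piece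
        through \<open>v\<close> and \<open>u\<close>, so \<open>d = c\<close>.\<close>
      have "(u, v) \<in> R G" if G: "finite G" for G
        using forth[OF G]
      proof
        assume "\<exists>c d. c \<in> K \<and> d \<in> K \<and> (u, c) \<in> R G \<and> (d, v) \<in> R G"
        then obtain c d where cd: "c \<in> K" "d \<in> K" "(u, c) \<in> R G" "(d, v) \<in> R G" by blast
        have "(d, c) \<in> R {}" using R_trans[OF R_R[OF cd(4)] R_trans[OF True R_R[OF cd(3)]]] .
        then have "d = c" using uniq cd by blast
        then show ?thesis using cd(3,4) unfolding R_def by (meson rtrancl_trans)
      qed
      then show False using no_bad_piece[OF neq] True by blast
    next
      case False
      then obtain c d where cd: "c \<in> K" "d \<in> K" "(v, c) \<in> R {}" "(d, u) \<in> R {}" using backward by blast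
      have "c \<noteq> d" using False R_trans cd(3,4) by blast
      \<comment> \<open>A direct walk from \<open>u\<close> to \<open>v\<close> would join
        \<open>d\<close> to \<open>c\<close> inside the piece. So the walk leaves through
        \<open>K\<close>, and \<open>d\<close> is the only possible exit because \<open>d\<close>
        reaches \<open>u\<close> within the piece.\<close>
      have "(u, d) \<in> R G" if G: "finite G" for G
        using forth[OF G]
      proof
        assume "(u, v) \<in> R G"
        then have "(d, c) \<in> R {}" using R_trans[OF cd(4) R_trans[OF R_R cd(3)]] by blast
        then show ?thesis using uniq[OF cd(2,1)] \<open>c \<noteq> d\<close> by blast
      next
        assume "\<exists>c d. c \<in> K \<and> d \<in> K \<and> (u, c) \<in> R G \<and> (d, v) \<in> R G"
        then obtain x where x: "x \<in> K" "(u, x) \<in> R G" by blast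
        have "(d, x) \<in> R {}" using R_trans[OF cd(4) R_R[OF x(2)]] .
        then show ?thesis using uniq[OF cd(2) x(1)] x(2) by simp
      qed
      moreover have "u \<noteq> d" using KB[OF cd(2)] 3(1) by blast
      ultimately show False using no_bad_piece[of u d] cd(4) by blast
    qed
  qed
qed

text \<open>A closed walk lies in a single \<open>N d\<close>, and by \<open>after\<close> the
  prescribed pairs with both vertices there are jumps of \<open>N d\<close>.\<close>

lemma no_prescribed_cycle:
  assumes ne: "Field r \<noteq> {}" and R: "R \<subseteq> ord" "R \<subseteq> ends M \<times> ends M"
    and after: "\<And>a u v. a \<in> Field r \<Longrightarrow> (u, v) \<in> R \<Longrightarrow> (u, v) \<in> (step {} (M - N a))\<^sup>*"
    and uv: "(u, v) \<in> R"
  shows "(v, u) \<notin> (step F M \<union> R)\<^sup>*"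
proof
  assume vu: "(v, u) \<in> (step F M \<union> R)\<^sup>*"
  have dir: "\<exists>d\<in>Field r. (b, d) \<in> r \<and> (c, d) \<in> r" if "b \<in> Field r" "c \<in> Field r" for b c
    using N_directed[OF that] by blast
  have "u \<in> ends (\<Union>a\<in>Field r. N a)" "v \<in> ends (\<Union>a\<in>Field r. N a)" using uv R(2) N_cover by auto
  then obtain b c where bc: "b \<in> Field r" "c \<in> Field r" "u \<in> ends (N b)" "v \<in> ends (N c)"
    unfolding ends_UN by blast
  obtain a where a: "a \<in> Field r" "(b, a) \<in> r" "(c, a) \<in> r" using dir bc(1,2) by blast
  have vuM: "(v, u) \<in> (step F (M \<inter> UNIV) \<union> R)\<^sup>*" using vu by simp
  obtain d where d: "d \<in> Field r" "(a, d) \<in> r"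
    "(v, u) \<in> (step F (N d \<inter> UNIV) \<union> R \<inter> ends (N d) \<times> ends (N d))\<^sup>*"
    by (rule walk_in_layer[OF vuM N_cover[symmetric] R(2) ne dir a(1)])
  have sub: "R \<inter> ends (N d) \<times> ends (N d) \<subseteq> jumps (N d)"
    using R(1) after[OF d(1)] by (auto simp: jumps_def)
  then have "step F (N d \<inter> UNIV) \<union> R \<inter> ends (N d) \<times> ends (N d) \<subseteq> step F (N d) \<union> jumps (N d)" by auto
  then have "(v, u) \<in> (step F (N d) \<union> jumps (N d))\<^sup>*" using d(3) rtrancl_mono by blast
  moreover have "u \<in> ends (N d)" "v \<in> ends (N d)"
    using bc a d(2) ends_mono[OF N_mono] by blast+
  then have "(u, v) \<in> jumps (N d)" using sub uv by blast
  ultimately show False using jumps_acyclic_N[OF d(1)] by blast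
qed

end

subsection \<open>Graphs of arbitrary cardinality\<close>


lemma card_of_not_leq: "\<not> |A| \<le>o |B| \<longleftrightarrow> |B| <o |A|"
  by (rule not_ordLeq_iff_ordLess) (rule card_of_Well_order)+

lemma finite_card_of_less: "finite A \<Longrightarrow> infinite B \<Longrightarrow> |A| <o |B|"
  unfolding card_of_not_leq[symmetric] using card_of_ordLeq_finite by blast

lemma card_of_Un_leq: "infinite C \<Longrightarrow> |A| \<le>o |C| \<Longrightarrow> |B| \<le>o |C| \<Longrightarrow> |A \<union> B| \<le>o |C|"
  using card_of_Un_ordLeq_infinite_Field[of "|C|" A B, OF _ _ _ card_of_Card_order, unfolded Field_card_of] .

lemma uncountable_card_of: "uncountable A \<longleftrightarrow> |UNIV :: nat set| <o |A|"
proof -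
  have "countable A \<longleftrightarrow> |A| \<le>o |UNIV :: nat set|"
    unfolding countable_def card_of_ordLeq[symmetric] by auto
  then show ?thesis using card_of_not_leq by blast
qed

lemma disjnt_family_card:
  assumes "pairwise disjnt \<Q>" "\<And>Q. Q \<in> \<Q> \<Longrightarrow> Q \<inter> X \<noteq> {}"
  shows "|\<Q>| \<le>o |X|"
proof -
  have "\<forall>Q\<in>\<Q>. \<exists>e. e \<in> Q \<inter> X" using assms(2) by blast
  from bchoice[OF this] obtain g where g: "\<And>Q. Q \<in> \<Q> \<Longrightarrow> g Q \<in> Q \<inter> X" by blast
  have "inj_on g \<Q>"
  proof (rule inj_onI, rule ccontr)
    fix Q Q' assume q: "Q \<in> \<Q>" "Q' \<in> \<Q>" "g Q = g Q'" "Q \<noteq> Q'"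
    then have "disjnt Q Q'" using assms(1) by (auto simp: pairwise_def)
    then show False using g[OF q(1)] g[OF q(2)] q(3) by (auto simp: disjnt_def)
  qed
  moreover have "g ` \<Q> \<subseteq> X" using g by blast
  ultimately show ?thesis using card_of_ordLeq by blast
qed

lemma disjnt_family_avoid:
  assumes "pairwise disjnt \<Q>" "|G| <o |\<Q>|"
  obtains Q where "Q \<in> \<Q>" "Q \<inter> G = {}"
proof -
  have "\<not> |\<Q>| \<le>o |G|" using assms(2) card_of_not_leq by blast
  then show ?thesis using disjnt_family_card[OF assms(1), of G] that by blast
qed

lemma subset_of_card:
  assumes "|A| \<le>o |B|"
  obtains C where "C \<subseteq> B" "|C| =o |A|"
proof -
  obtain g where g: "inj_on g A" "g ` A \<subseteq> B" using assms unfolding card_of_ordLeq[symmetric] by blast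
  then have "bij_betw g A (g ` A)" by (simp add: bij_betw_def)
  then have "|A| =o |g ` A|" unfolding card_of_ordIso[symmetric] by blast
  then show ?thesis using that[OF g(2)] ordIso_symmetric by metis
qed

section \<open>Links, the construction of the chain, and the induction on cardinality\<close>

context edge_ends
begin

text \<open>Links are nonempty so that each meets itself, which the maximality argument uses, and so
  that a disjoint family of them has distinct representatives in \<open>M\<close>.\<close>

definition link :: "'e set \<Rightarrow> 'v \<Rightarrow> 'v \<Rightarrow> 'e set \<Rightarrow> bool" where
  "link M u v Q \<longleftrightarrow> finite Q \<and> Q \<subseteq> M \<and> Q \<noteq> {} \<and> (u, v) \<in> (step {} Q)\<^sup>*"

lemma maximal_links:
  "\<exists>\<Q>. (\<forall>Q\<in>\<Q>. link M u v Q) \<and> pairwise disjnt \<Q> \<and> (\<forall>Q. link M u v Q \<longrightarrow> (\<exists>Q'\<in>\<Q>. Q \<inter> Q' \<noteq> {}))"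
proof -
  define Z where "Z = {\<Q>. (\<forall>Q\<in>\<Q>. link M u v Q) \<and> pairwise disjnt \<Q>}"
  have "\<exists>\<Q>\<in>Z. \<forall>X\<in>Z. \<Q> \<subseteq> X \<longrightarrow> X = \<Q>"
  proof (rule subset_Zorn')
    fix \<C> assume ch: "subset.chain Z \<C>"
    then have sub: "\<C> \<subseteq> Z" and cmp: "\<And>X Y. X \<in> \<C> \<Longrightarrow> Y \<in> \<C> \<Longrightarrow> X \<subseteq> Y \<or> Y \<subseteq> X"
      by (auto simp: subset_chain_def)
    have "pairwise disjnt (\<Union>\<C>)"
    proof (rule pairwiseI)
      fix P Q assume "P \<in> \<Union>\<C>" "Q \<in> \<Union>\<C>" and ne: "P \<noteq> Q"
      then obtain X Y where "X \<in> \<C>" "Y \<in> \<C>" "P \<in> X" "Q \<in> Y" by blast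
      then obtain W where W: "W \<in> \<C>" "P \<in> W" "Q \<in> W" using cmp by blast
      then have "pairwise disjnt W" using sub by (auto simp: Z_def)
      then show "disjnt P Q" using W ne by (auto simp: pairwise_def)
    qed
    then show "\<Union>\<C> \<in> Z" using sub by (auto simp: Z_def)
  qed
  then obtain \<Q> where Q: "\<Q> \<in> Z" and max: "\<And>X. X \<in> Z \<Longrightarrow> \<Q> \<subseteq> X \<Longrightarrow> X = \<Q>" by blast
  have "\<exists>Q'\<in>\<Q>. Q \<inter> Q' \<noteq> {}" if l: "link M u v Q" for Q
  proof (rule ccontr)
    assume n: "\<not> ?thesis"
    then have "insert Q \<Q> \<in> Z" using Q l by (auto simp: Z_def pairwise_insert disjnt_def)
    then have "Q \<in> \<Q>" using max by blast
    then show False using n l by (auto simp: link_def)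
  qed
  then show ?thesis using Q by (intro exI[of _ \<Q>]) (simp add: Z_def)
qed

lemma reach_link:
  assumes "(u, v) \<in> (step {} X)\<^sup>*" "u \<noteq> v" "X \<subseteq> M"
  obtains Q where "link M u v Q" "Q \<subseteq> X"
proof -
  obtain Q where Q: "finite Q" "Q \<subseteq> X" "(u, v) \<in> (step {} Q)\<^sup>*" by (rule reach_finite[OF assms(1)])
  have "Q \<noteq> {}" using Q(3) assms(2) by (auto simp: step_def)
  then show ?thesis using that Q assms(3) by (auto simp: link_def)
qed

text \<open>The embedding of a maximal family of links into the well-order decides at which stage a link is
  absorbed. That a family is either absorbed completely by stage \<^term>\<open>a\<close>, or larger than the initial
  segment below \<^term>\<open>a\<close>, is thereby preserved at limits.\<close>

lemma chain_exists:
  fixes M :: "'e set"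
  assumes M: "uncountable M"
  obtains N :: "'e \<Rightarrow> 'e set" where
    "\<And>a b. (a, b) \<in> |M| \<Longrightarrow> N a \<subseteq> N b" "(\<Union>a\<in>M. N a) = M"
    "\<And>a. a \<in> M \<Longrightarrow> |N a| <o |M|" "\<And>a. a \<in> M \<Longrightarrow> |\<Union>b\<in>underS |M| a. N b| <o |M|"
    "\<And>a u v. a \<in> M \<Longrightarrow> u \<in> ends (N a) \<Longrightarrow> v \<in> ends (N a) \<Longrightarrow> u \<noteq> v \<Longrightarrow>
      (u, v) \<in> (step {} (M - N a))\<^sup>* \<Longrightarrow> (u, v) \<in> strong (N a - (\<Union>b\<in>underS |M| a. N b))"
    "\<And>a u v. a \<in> M \<Longrightarrow> u \<in> ends (\<Union>b\<in>underS |M| a. N b) \<Longrightarrow> v \<in> ends (\<Union>b\<in>underS |M| a. N b) \<Longrightarrow> u \<noteq> v \<Longrightarrow>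
      (u, v) \<in> (step {} (M - (\<Union>b\<in>underS |M| a. N b)))\<^sup>* \<Longrightarrow>
      (u, v) \<in> strong (N a - (\<Union>b\<in>underS |M| a. N b))"
proof -
  let ?r = "|M|"
  have r: "Well_order ?r" "Card_order ?r" by (rule card_of_Well_order, rule card_of_Card_order)
  have Fr: "Field ?r = M" by (rule Field_card_of)
  have tr: "trans ?r" "antisym ?r" "total_on M ?r" "refl_on M ?r"
    using r(1) Fr by (auto simp: order_on_defs)
  have infM: "infinite M" using M uncountable_infinite by blast
  define PP where "PP u v = (SOME \<Q>. (\<forall>Q\<in>\<Q>. link M u v Q) \<and> pairwise disjnt \<Q> \<and>
    (\<forall>Q. link M u v Q \<longrightarrow> (\<exists>Q'\<in>\<Q>. Q \<inter> Q' \<noteq> {})))" for u v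
  have PP: "(\<forall>Q\<in>PP u v. link M u v Q) \<and> pairwise disjnt (PP u v) \<and>
      (\<forall>Q. link M u v Q \<longrightarrow> (\<exists>Q'\<in>PP u v. Q \<inter> Q' \<noteq> {}))" for u v
    unfolding PP_def by (rule someI_ex) (rule maximal_links)
  have PP_link: "link M u v Q" if "Q \<in> PP u v" for u v Q using PP that by blast
  have PP_disj: "pairwise disjnt (PP u v)" for u v using PP by blast
  have "Q \<inter> M \<noteq> {}" if "Q \<in> PP u v" for u v Q
    using PP_link[OF that] by (auto simp: link_def)
  then have "|PP u v| \<le>o ?r" for u v by (rule disjnt_family_card[OF PP_disj])
  then have ex_f: "\<exists>f. embed |PP u v| ?r f" for u v by (auto simp: ordLeq_def)
  define f where "f u v = (SOME f. embed |PP u v| ?r f)" for u v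
  have f: "embed |PP u v| ?r (f u v)" for u v
    using someI_ex[OF ex_f[of u v]] by (simp add: f_def)
  have f_inj: "inj_on (f u v) (PP u v)" for u v
    using embed_inj_on[OF card_of_Well_order f[of u v]] by (simp add: Field_card_of)
  have f_in: "f u v Q \<in> M" if "Q \<in> PP u v" for u v Q
    using embed_in_Field[OF f[of u v]] that by (simp add: Field_card_of)
  \<comment> \<open>The size bound for \<open>N a\<close>: the initial segment below
    \<open>a\<close>, made infinite by the summand \<open>nat\<close>. It stays below
    \<open>|M|\<close> because \<open>M\<close> is uncountable.\<close>
  define L where "L a = underS ?r a <+> (UNIV :: nat set)" for a
  have infL: "infinite (L a)" for a by (simp add: L_def finite_Plus_iff)
  have natL: "|UNIV :: nat set| \<le>o |L a|" for a unfolding L_def by (rule card_of_Plus2)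
  have underL: "|underS ?r a| \<le>o |L a|" for a unfolding L_def by (rule card_of_Plus1)
  have finL: "|X| \<le>o |L a|" if "finite X" for X :: "'x set" and a
    using finite_card_of_less[OF that infL] by (rule ordLess_imp_ordLeq)
  have L_mono: "|L b| \<le>o |L a|" if "(b, a) \<in> ?r" for a b
  proof -
    have "underS ?r b \<subseteq> underS ?r a" using tr(1,2) that by (rule underS_incr)
    then have "L b \<subseteq> L a" by (auto simp: L_def)
    then show ?thesis by (rule card_of_mono1)
  qed
  have L_less: "|L a| <o |M|" if "a \<in> M" for a
    unfolding L_def
  proof (rule card_of_Plus_ordLess_infinite[OF infM])
    show "|underS ?r a| <o |M|" using card_of_underS[OF r(2), of a] that Fr by simp
    show "|UNIV :: nat set| <o |M|" using M uncountable_card_of by blast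
  qed
  \<comment> \<open>The links due by stage \<open>a\<close>. Countable families are absorbed at
    once, so a link that is still missing certifies an uncountable family, which outweighs the
    summand \<open>nat\<close> of \<open>L a\<close>.\<close>
  define low where "low a u v = {Q \<in> PP u v. f u v Q \<in> under ?r a \<or> countable (PP u v)}" for a u v
  define wide where "wide a u v \<longleftrightarrow> |L a| <o |PP u v|" for a u v
  \<comment> \<open>At most \<open>|X|\<close> disjoint links meet \<open>X\<close>, so a wide
    family retains \<open>|L a|\<close> links that avoid \<open>X\<close>. With \<open>B a\<close>
    for \<open>X\<close>, they provide the high connectivity of the new piece.\<close>
  define fresh where "fresh a X u v = (if wide a u v \<and> |X| \<le>o |L a|
      then SOME \<Q>. \<Q> \<subseteq> PP u v \<and> (\<forall>Q\<in>\<Q>. Q \<inter> X = {}) \<and> |\<Q>| =o |L a| else {})" for a X u v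
  have fresh: "fresh a X u v \<subseteq> PP u v \<and> (\<forall>Q\<in>fresh a X u v. Q \<inter> X = {}) \<and> |fresh a X u v| =o |L a|"
    if w: "wide a u v" and X: "|X| \<le>o |L a|" for a X u v
  proof -
    let ?Y = "{Q \<in> PP u v. Q \<inter> X = {}}"
    let ?Z = "{Q \<in> PP u v. Q \<inter> X \<noteq> {}}"
    have "|?Z| \<le>o |X|"
      by (rule disjnt_family_card) (use PP_disj[of u v] in \<open>auto simp: pairwise_def\<close>)
    then have Z: "|?Z| \<le>o |L a|" using X by (rule ordLeq_transitive)
    have "|L a| \<le>o |?Y|"
    proof (rule ccontr)
      assume "\<not> ?thesis"
      then have "|?Y| \<le>o |L a|" unfolding card_of_not_leq by (rule ordLess_imp_ordLeq)
      then have "|?Y \<union> ?Z| \<le>o |L a|" using Z by (rule card_of_Un_leq[OF infL])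
      moreover have "?Y \<union> ?Z = PP u v" by blast
      ultimately show False using w unfolding wide_def card_of_not_leq[symmetric] by simp
    qed
    then obtain \<Q> where "\<Q> \<subseteq> ?Y" "|\<Q>| =o |L a|" by (rule subset_of_card)
    then have "\<exists>\<Q>. \<Q> \<subseteq> PP u v \<and> (\<forall>Q\<in>\<Q>. Q \<inter> X = {}) \<and> |\<Q>| =o |L a|" by blast
    from someI_ex[OF this] show ?thesis using w X by (simp add: fresh_def)
  qed
  have fresh_none: "fresh a X u v = {}" if "\<not> (wide a u v \<and> |X| \<le>o |L a| )" for a X u v
    unfolding fresh_def using that by (rule if_not_P)
  have fresh_sub: "fresh a X u v \<subseteq> PP u v" for a X u v
  proof (cases "wide a u v \<and> |X| \<le>o |L a|")
    case True
    then show ?thesis using fresh by blast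
  next
    case False
    then show ?thesis using fresh_none[OF False] by simp
  qed
  have low_card: "|low a u v| \<le>o |L a|" for a u v
  proof (cases "countable (PP u v)")
    case True
    then have "|PP u v| \<le>o |UNIV :: nat set|" using uncountable_card_of[of "PP u v"] card_of_not_leq by metis
    then have "|PP u v| \<le>o |L a|" using natL by (rule ordLeq_transitive)
    moreover have "|low a u v| \<le>o |PP u v|" by (rule card_of_mono1) (auto simp: low_def)
    ultimately show ?thesis using ordLeq_transitive by metis
  next
    case False
    then have "f u v ` low a u v \<subseteq> under ?r a" by (auto simp: low_def)
    moreover have "inj_on (f u v) (low a u v)" using f_inj[of u v] by (auto simp: low_def inj_on_def)
    ultimately have "|low a u v| \<le>o |under ?r a|" unfolding card_of_ordLeq[symmetric] by blast
    also have "|under ?r a| \<le>o |underS ?r a \<union> {a}|"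
      by (rule card_of_mono1) (auto simp: under_def underS_def)
    also have "|underS ?r a \<union> {a}| \<le>o |L a|"
      by (rule card_of_Un_leq[OF infL underL finL]) simp
    finally show ?thesis .
  qed
  have fresh_card: "|fresh a X u v| \<le>o |L a|" for a X u v
  proof (cases "wide a u v \<and> |X| \<le>o |L a|")
    case True
    then have "|fresh a X u v| =o |L a|" using fresh by blast
    then show ?thesis by (rule ordIso_imp_ordLeq)
  next
    case False
    then show ?thesis using fresh_none[OF False] finL[of "{} :: 'e set set"] by simp
  qed
  define A where "A a X u v = \<Union>(low a u v \<union> fresh a X u v)" for a X u v
  have A_card: "|A a X u v| \<le>o |L a|" for a X u v
  proof -
    have "|low a u v \<union> fresh a X u v| \<le>o |L a|"
      by (rule card_of_Un_leq[OF infL low_card fresh_card])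
    moreover have "\<forall>Q\<in>low a u v \<union> fresh a X u v. |Q| \<le>o |L a|"
      using PP_link fresh_sub[of a X u v] by (auto simp: low_def link_def intro!: finL)
    ultimately have "|\<Union>Q\<in>low a u v \<union> fresh a X u v. Q| \<le>o |L a|"
      by (rule card_of_UNION_ordLeq_infinite[OF infL])
    then show ?thesis by (simp add: A_def)
  qed
  have A_M: "A a X u v \<subseteq> M" for a X u v
    using PP_link fresh_sub[of a X u v] by (auto simp: A_def low_def link_def)
  define add where "add a X Y = Y \<union> (\<Union>p\<in>ends Y \<times> ends Y. A a X (fst p) (snd p))" for a X Y
  have add_card: "|add a X Y| \<le>o |L a|" if Y: "|Y| \<le>o |L a|" for a X Y
  proof -
    have "|t ` Y| \<le>o |L a|" "|h ` Y| \<le>o |L a|"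
      using card_of_image[of _ Y] Y ordLeq_transitive by metis+
    then have E: "|ends Y| \<le>o |L a|" unfolding ends_def by (rule card_of_Un_leq[OF infL])
    have "|ends Y \<times> ends Y| \<le>o |L a|"
      using card_of_Times_ordLeq_infinite_Field[of "|L a|", unfolded Field_card_of, OF infL E E]
        card_of_Card_order[of "L a"] by (simp only: Field_card_of)
    then have "|\<Union>p\<in>ends Y \<times> ends Y. A a X (fst p) (snd p)| \<le>o |L a|"
      using A_card by (intro card_of_UNION_ordLeq_infinite[OF infL]) auto
    then show ?thesis unfolding add_def by (rule card_of_Un_leq[OF infL Y])
  qed
  \<comment> \<open>New edges bring new vertices and hence new pairs to serve, so the additions are
    iterated countably often. Starting with \<open>a\<close> itself makes the chain exhaust
    \<open>M\<close>.\<close>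
  define cl where "cl a X = (\<Union>n. (add a X ^^ n) (insert a X))" for a X
  define N where "N = wfrec (?r - Id) (\<lambda>N a. cl a (\<Union>b\<in>underS ?r a. N b))"
  define B where "B a = (\<Union>b\<in>underS ?r a. N b)" for a
  have wf: "wf (?r - Id)" by (rule Well_order_wf[OF r(1)])
  have N: "N a = cl a (B a)" for a
  proof -
    have "N a = cl a (\<Union>b\<in>underS ?r a. cut N (?r - Id) a b)"
      unfolding N_def by (subst wfrec[OF wf]) simp
    moreover have "(\<Union>b\<in>underS ?r a. cut N (?r - Id) a b) = B a"
      unfolding B_def by (intro SUP_cong refl cut_apply) (auto simp: underS_def)
    ultimately show ?thesis by simp
  qed
  have cl_base: "insert a X \<subseteq> cl a X" for a X
    using UN_upper[of 0 UNIV "\<lambda>n. (add a X ^^ n) (insert a X)"] by (simp add: cl_def)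
  have cl_card: "|cl a X| \<le>o |L a|" if X: "|X| \<le>o |L a|" for a X
  proof -
    have "|{a} \<union> X| \<le>o |L a|" by (rule card_of_Un_leq[OF infL finL X]) simp
    then have "|(add a X ^^ n) (insert a X)| \<le>o |L a|" for n
      by (induction n) (simp_all add: add_card)
    then show ?thesis unfolding cl_def by (intro card_of_UNION_ordLeq_infinite[OF infL natL]) blast
  qed
  have cl_M: "cl a X \<subseteq> M" if "insert a X \<subseteq> M" for a X
  proof -
    have "(add a X ^^ n) (insert a X) \<subseteq> M" for n
    proof (induction n)
      case (Suc n)
      then show ?case unfolding funpow.simps comp_apply add_def[of _ _ "(add a X ^^ n) (insert a X)"]
        using A_M by blast
    qed (use that in simp)
    then show ?thesis by (auto simp: cl_def)
  qed
  have cl_closed: "A a X u v \<subseteq> cl a X" if uv: "u \<in> ends (cl a X)" "v \<in> ends (cl a X)" for a X u v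
  proof -
    let ?Y = "\<lambda>n. (add a X ^^ n) (insert a X)"
    have mono: "?Y m \<subseteq> ?Y n" if "m \<le> n" for m n
      using that by (rule lift_Suc_mono_le[rotated]) (auto simp: add_def)
    obtain m n where mn: "u \<in> ends (?Y m)" "v \<in> ends (?Y n)"
      using uv unfolding cl_def ends_UN by blast
    then have "u \<in> ends (?Y (max m n))" "v \<in> ends (?Y (max m n))"
      using ends_mono[OF mono[of m "max m n"]] ends_mono[OF mono[of n "max m n"]] by auto
    then have "(u, v) \<in> ends (?Y (max m n)) \<times> ends (?Y (max m n))" by simp
    then have "A a X (fst (u, v)) (snd (u, v)) \<subseteq> add a X (?Y (max m n))" unfolding add_def by blast
    then have "A a X u v \<subseteq> ?Y (Suc (max m n))" by simp
    then show ?thesis unfolding cl_def by blast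
  qed
  have N_card: "|N a| \<le>o |L a| \<and> |B a| \<le>o |L a|" for a
  proof (induction a rule: wf_induct_rule[OF wf])
    case (1 a)
    have "\<forall>b\<in>underS ?r a. |N b| \<le>o |L a|"
    proof
      fix b assume b: "b \<in> underS ?r a"
      then have "|N b| \<le>o |L b|" using 1 by (auto simp: underS_def)
      moreover have "|L b| \<le>o |L a|" using b by (intro L_mono) (auto simp: underS_def)
      ultimately show "|N b| \<le>o |L a|" by (rule ordLeq_transitive)
    qed
    then have "|B a| \<le>o |L a|" unfolding B_def by (rule card_of_UNION_ordLeq_infinite[OF infL underL])
    then show ?case using cl_card N by simp
  qed
  have B_N: "B a \<subseteq> N a" and a_N: "a \<in> N a" for a using cl_base[of a "B a"] N by auto
  have N_mono: "N b \<subseteq> N a" if "(b, a) \<in> ?r" for a b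
  proof (cases "b = a")
    case False
    then have "N b \<subseteq> B a" using that by (auto simp: B_def underS_def)
    then show ?thesis using B_N by blast
  qed simp
  have N_M: "a \<in> M \<longrightarrow> N a \<subseteq> M" for a
  proof (induction a rule: wf_induct_rule[OF wf])
    case (1 a)
    have "N b \<subseteq> M" if "b \<in> underS ?r a" for b
    proof -
      have "(b, a) \<in> ?r - Id" using that by (auto simp: underS_def)
      moreover from this have "b \<in> M" using Fr by (auto simp: Field_def)
      ultimately show ?thesis using 1 by blast
    qed
    then have "B a \<subseteq> M" by (auto simp: B_def)
    then show ?case using cl_M[of a "B a"] N by auto
  qed
  have A_N: "A a (B a) u v \<subseteq> N a" if "u \<in> ends (N a)" "v \<in> ends (N a)" for a u v
    using cl_closed that N by auto
  have linear: "(a, b) \<in> ?r \<or> (b, a) \<in> ?r" if "a \<in> M" "b \<in> M" for a b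
    using tr(3,4) that by (cases "a = b") (auto simp: total_on_def refl_on_def)
  \<comment> \<open>Since \<open>f u v\<close> is an embedding, the segment below \<open>a\<close>
    injects into a proper initial segment of \<open>|PP u v|\<close>, which is smaller because that
    order is a cardinal.\<close>
  have wideI: "wide a u v" if a: "a \<in> M" and Q: "Q \<in> PP u v" "f u v Q \<notin> underS ?r a" and unc: "uncountable (PP u v)"
    for a u v Q
  proof -
    have fQ: "f u v Q \<in> M" using f_in Q(1) .
    have "(a, f u v Q) \<in> ?r" using linear[OF a fQ] linear[OF a a] Q(2) by (auto simp: underS_def)
    then have "underS ?r a \<subseteq> underS ?r (f u v Q)" using tr(1,2) underS_incr by metis
    also have "\<dots> = f u v ` underS |PP u v| Q"
      using embed_underS[OF card_of_Well_order f[of u v], of Q] Q(1)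
      by (simp add: Field_card_of bij_betw_def)
    finally have "|underS ?r a| \<le>o |f u v ` underS |PP u v| Q|" by (rule card_of_mono1)
    then have "|underS ?r a| \<le>o |underS |PP u v| Q|" using card_of_image by (rule ordLeq_transitive)
    moreover have "|underS |PP u v| Q| <o |PP u v|"
      using card_of_underS[OF card_of_Card_order, of Q "PP u v"] Q(1) by (simp add: Field_card_of)
    ultimately have "|underS ?r a| <o |PP u v|" by (rule ordLeq_ordLess_trans)
    moreover have "|UNIV :: nat set| <o |PP u v|" using unc uncountable_card_of by blast
    ultimately show ?thesis unfolding wide_def L_def
      by (rule card_of_Plus_ordLess_infinite[OF uncountable_infinite[OF unc]])
  qed
  \<comment> \<open>Fewer than \<open>|L a|\<close> deleted edges miss one of the
    \<open>|L a|\<close> disjoint fresh links, which all lie in \<open>N a - B a\<close>.\<close>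
  have strong: "(u, v) \<in> strong (N a - B a)"
    if uv: "u \<in> ends (N a)" "v \<in> ends (N a)" and w: "wide a u v" for a u v
    unfolding strong_def
  proof (clarify)
    fix G assume G: "G \<subseteq> N a - B a" "finite G \<or> |G| <o |N a - B a|"
    have "|N a - B a| \<le>o |N a|" by (rule card_of_mono1) blast
    then have "|N a - B a| \<le>o |L a|" using N_card[of a] ordLeq_transitive by metis
    then have less: "|G| <o |L a|" using G(2) finite_card_of_less[OF _ infL, of G a] ordLess_ordLeq_trans by metis
    have fr: "fresh a (B a) u v \<subseteq> PP u v" "\<And>Q. Q \<in> fresh a (B a) u v \<Longrightarrow> Q \<inter> B a = {}"
      "|fresh a (B a) u v| =o |L a|" using fresh[OF w] N_card[of a] by blast+
    have "|G| <o |fresh a (B a) u v|" using less ordIso_symmetric[OF fr(3)] by (rule ordLess_ordIso_trans)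
    moreover have "pairwise disjnt (fresh a (B a) u v)" using PP_disj fr(1) pairwise_subset by blast
    ultimately obtain Q where Q: "Q \<in> fresh a (B a) u v" "Q \<inter> G = {}" using disjnt_family_avoid by blast
    have "Q \<subseteq> A a (B a) u v" using Q(1) by (auto simp: A_def)
    then have "Q \<subseteq> N a - B a - G" using A_N[OF uv] fr(2)[OF Q(1)] Q(2) by blast
    moreover have "(u, v) \<in> (step {} Q)\<^sup>*" using PP_link fr(1) Q(1) by (auto simp: link_def)
    ultimately show "(u, v) \<in> (step {} (N a - B a - G))\<^sup>*" using reach_mono by blast
  qed
  \<comment> \<open>By maximality a link outside \<open>X\<close> meets some member of the family,
    which is therefore not contained in \<open>X\<close>.\<close>
  have escape: "\<exists>Q\<in>PP u v. \<not> Q \<subseteq> X" if uv: "(u, v) \<in> (step {} (M - X))\<^sup>*" "u \<noteq> v" for u v X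
  proof -
    obtain Q where Q: "link M u v Q" "Q \<subseteq> M - X" by (rule reach_link[OF uv Diff_subset])
    obtain Q' where "Q' \<in> PP u v" "Q \<inter> Q' \<noteq> {}" using conjunct2[OF conjunct2[OF PP[of u v]]] Q(1) by blast
    then show ?thesis using Q(2) by blast
  qed
  show ?thesis
  proof (rule that[of N], unfold B_def[symmetric])
    show "N a \<subseteq> N b" if "(a, b) \<in> |M|" for a b using N_mono that .
    show "(\<Union>a\<in>M. N a) = M" using N_M a_N by blast
    show "|N a| <o |M|" "|B a| <o |M|" if "a \<in> M" for a
      using N_card[of a] L_less[OF that] ordLeq_ordLess_trans by metis+
  next
    fix a u v assume a: "a \<in> M" and uv: "u \<in> ends (N a)" "v \<in> ends (N a)" "u \<noteq> v"
      and reach: "(u, v) \<in> (step {} (M - N a))\<^sup>*"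
    obtain Q where Q: "Q \<in> PP u v" "\<not> Q \<subseteq> N a" using escape[OF reach uv(3)] by blast
    have "Q \<notin> low a u v" using Q(2) A_N[OF uv(1,2)] by (auto simp: A_def)
    then have "f u v Q \<notin> under ?r a" "uncountable (PP u v)" using Q(1) by (auto simp: low_def)
    then have "wide a u v" using wideI[OF a Q(1)] by (auto simp: under_def underS_def)
    then show "(u, v) \<in> strong (N a - B a)" by (rule strong[OF uv(1,2)])
  next
    fix a u v assume a: "a \<in> M" and uv: "u \<in> ends (B a)" "v \<in> ends (B a)" "u \<noteq> v"
      and reach: "(u, v) \<in> (step {} (M - B a))\<^sup>*"
    obtain Q where Q: "Q \<in> PP u v" "\<not> Q \<subseteq> B a" using escape[OF reach uv(3)] by blast
    have dir: "\<exists>d\<in>underS ?r a. (b, d) \<in> ?r \<and> (c, d) \<in> ?r" if "b \<in> underS ?r a" "c \<in> underS ?r a" for b c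
    proof -
      have "b \<in> M" "c \<in> M" using that Fr by (auto simp: underS_def Field_def)
      then show ?thesis using linear[of b c] linear[of b b] linear[of c c] that by blast
    qed
    obtain b c where bc: "b \<in> underS ?r a" "c \<in> underS ?r a" "u \<in> ends (N b)" "v \<in> ends (N c)"
      using uv(1,2) unfolding B_def ends_UN by blast
    obtain d where d: "d \<in> underS ?r a" "(b, d) \<in> ?r" "(c, d) \<in> ?r" using dir bc(1,2) by blast
    have low: "Q \<notin> low e u v" if e: "e \<in> underS ?r a" "(d, e) \<in> ?r" for e
    proof
      assume l: "Q \<in> low e u v"
      have "(b, e) \<in> ?r" "(c, e) \<in> ?r" using d e(2) tr(1) by (blast dest: transD)+
      then have "u \<in> ends (N e)" "v \<in> ends (N e)" using bc ends_mono[OF N_mono] by blast+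
      then have "A e (B e) u v \<subseteq> N e" by (rule A_N)
      moreover have "Q \<subseteq> A e (B e) u v" unfolding A_def using l by blast
      ultimately have "Q \<subseteq> N e" by blast
      then show False using Q(2) e(1) by (auto simp: B_def)
    qed
    have "(d, d) \<in> ?r" using dir[OF d(1) d(1)] linear d(1) Fr by (auto simp: underS_def Field_def)
    then have "uncountable (PP u v)" using low[OF d(1)] Q(1) by (auto simp: low_def)
    \<comment> \<open>Otherwise a stage \<open>e\<close> below \<open>a\<close>, beyond both
      \<open>d\<close> and the value of \<open>f u v Q\<close>, would have absorbed \<open>Q\<close>
      into \<open>B a\<close>.\<close>
    moreover have "f u v Q \<notin> underS ?r a"
    proof
      assume "f u v Q \<in> underS ?r a"
      then obtain e where e: "e \<in> underS ?r a" "(d, e) \<in> ?r" "(f u v Q, e) \<in> ?r" using dir d(1) by blast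
      then show False using low[OF e(1,2)] Q(1) by (auto simp: low_def under_def)
    qed
    ultimately have "wide a u v" using wideI[OF a Q(1)] by blast
    moreover have "u \<in> ends (N a)" "v \<in> ends (N a)" using uv ends_mono[OF B_N] by blast+
    ultimately show "(u, v) \<in> strong (N a - B a)" using strong by blast
  qed
qed

text \<open>The relation \<open>R\<close> strengthens the induction: the pieces of the chain have to
  respect prescribed jumps. Members of the chain have fewer than \<open>|M|\<close> edges, so
  \<open>R \<subseteq> strong M\<close> keeps each prescribed pair connected outside every
  member.\<close>

lemma resolvable:
  assumes "trans R" "irrefl R" "R \<subseteq> strong M"
  obtains F where "reaches M F" "\<And>u v. (u, v) \<in> R \<Longrightarrow> (v, u) \<notin> (step F M \<union> R)\<^sup>*" "resolved F M"
proof -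
  let ?P = "\<lambda>M R F. reaches M F \<and> (\<forall>u v. (u, v) \<in> R \<longrightarrow> (v, u) \<notin> (step F M \<union> R)\<^sup>*) \<and> resolved F M"
  have "wf (inv_image ordLess (card_of :: 'e set \<Rightarrow> 'e rel))" by (rule wf_inv_image) (rule wf_ordLess)
  then have "\<forall>R. trans R \<longrightarrow> irrefl R \<longrightarrow> R \<subseteq> strong M \<longrightarrow> (\<exists>F. ?P M R F)"
  proof (induction M rule: wf_induct_rule)
    case (less M)
    have IH: "\<exists>F. ?P X R F" if "|X| <o |M|" "trans R" "irrefl R" "R \<subseteq> strong X" for X R
      using less that by simp
    show ?case
    proof (intro allI impI)
      fix R :: "'v rel" assume R: "trans R" "irrefl R" "R \<subseteq> strong M"
      show "\<exists>F. ?P M R F"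
      proof (cases "countable M")
        case True
        have "infconn {} M u v" if uv: "(u, v) \<in> R" for u v
          unfolding infconn_def
        proof (intro allI impI)
          fix G :: "'e set" assume "finite G"
          then have "(u, v) \<in> (step {} (M - (G \<inter> M)))\<^sup>*"
            using R(3) uv unfolding strong_def by blast
          moreover have "M - G \<inter> M = M - G" by blast
          ultimately show "(u, v) \<in> (step {} (M - G))\<^sup>*" by simp
        qed
        then obtain L where L: "reaches M L"
          "\<And>u v. (u, v) \<in> R \<Longrightarrow> (v, u) \<notin> (step L M \<union> R)\<^sup>*" "resolved L M"
          by (rule countable_case[OF True R(1,2)]) (assumption, rule that)
        then show ?thesis by (intro exI[of _ L] conjI allI impI L)
      next
        case False
        let ?r = "|M|"
        have Fr: "Field ?r = M" by (rule Field_card_of)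
        have wo: "Well_order ?r" by (rule card_of_Well_order)
        obtain N :: "'e \<Rightarrow> 'e set" where
          mono: "\<And>a b. (a, b) \<in> ?r \<Longrightarrow> N a \<subseteq> N b" and cover: "(\<Union>a\<in>M. N a) = M"
          and N_card: "\<And>a. a \<in> M \<Longrightarrow> |N a| <o |M|"
          and B_card: "\<And>a. a \<in> M \<Longrightarrow> |\<Union>b\<in>underS ?r a. N b| <o |M|"
          and after: "\<And>a u v. a \<in> M \<Longrightarrow> u \<in> ends (N a) \<Longrightarrow> v \<in> ends (N a) \<Longrightarrow> u \<noteq> v \<Longrightarrow>
            (u, v) \<in> (step {} (M - N a))\<^sup>* \<Longrightarrow> (u, v) \<in> strong (N a - (\<Union>b\<in>underS ?r a. N b))"
          and before: "\<And>a u v. a \<in> M \<Longrightarrow> u \<in> ends (\<Union>b\<in>underS ?r a. N b) \<Longrightarrow>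
            v \<in> ends (\<Union>b\<in>underS ?r a. N b) \<Longrightarrow> u \<noteq> v \<Longrightarrow>
            (u, v) \<in> (step {} (M - (\<Union>b\<in>underS ?r a. N b)))\<^sup>* \<Longrightarrow>
            (u, v) \<in> strong (N a - (\<Union>b\<in>underS ?r a. N b))"
          by (rule chain_exists[OF False]) (rule that)
        define B where "B a = (\<Union>b\<in>underS ?r a. N b)" for a
        define P where "P a = N a - B a" for a
        define C where "C a = (step {} (M - B a))\<^sup>*" for a
        have C_trans: "(x, y) \<in> C a \<Longrightarrow> (y, z) \<in> C a \<Longrightarrow> (x, z) \<in> C a" for x y z a
          unfolding C_def by (rule rtrancl_trans)
        have C_mono: "C b \<subseteq> C a" if "(a, b) \<in> ?r" for a b
        proof -
          have "underS ?r a \<subseteq> underS ?r b" using wo that by (intro underS_incr) (auto simp: order_on_defs)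
          then have "M - B b \<subseteq> M - B a" by (auto simp: B_def)
          then show ?thesis unfolding C_def by (intro rtrancl_mono step_mono)
        qed
        have linear: "(a, b) \<in> ?r \<or> (b, a) \<in> ?r" if "a \<in> M" "b \<in> M" for a b
          using wo Fr that by (cases "a = b") (auto simp: order_on_defs total_on_def refl_on_def)
        have small: "(u, v) \<in> (step {} (M - X))\<^sup>*" if "(u, v) \<in> R" "X \<subseteq> M" "|X| <o |M|" for u v X
          using R(3) that unfolding strong_def by blast
        have NM: "N a \<subseteq> M" if "a \<in> M" for a using cover that by blast
        have BM: "B a \<subseteq> M" for a
        proof -
          have "underS ?r a \<subseteq> M" using Order_Relation.underS_Field[of ?r a] Fr by simp
          then show ?thesis unfolding B_def using NM by blast
        qed
        have RC: "(u, v) \<in> C a" if "(u, v) \<in> R" "a \<in> M" for u v a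
          unfolding C_def using small[OF that(1) BM] B_card[OF that(2)] by (simp add: B_def)
        \<comment> \<open>\<open>C a\<close> decreases with \<open>a\<close>, so two one-way pairs
          can be compared at the smaller index, and their composite is one-way there. Pairs of
          \<open>R\<close> lie in every \<open>C a\<close>. This makes \<open>D\<close>
          transitive.\<close>
        define D where "D = R \<union> {(u, v). \<exists>a\<in>M. (u, v) \<in> C a \<and> (v, u) \<notin> C a}"
        have "trans D"
        proof (rule transI)
          fix x y z assume xy: "(x, y) \<in> D" and yz: "(y, z) \<in> D"
          have DC: "\<exists>a\<in>M. (x, y) \<in> C a \<and> (y, z) \<in> C a \<and> ((y, x) \<notin> C a \<or> (z, y) \<notin> C a)"
            if "(x, y) \<notin> R \<or> (y, z) \<notin> R"
          proof (cases "(x, y) \<in> R \<or> (y, z) \<in> R")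
            case True
            then show ?thesis using that xy yz RC unfolding D_def by blast
          next
            case False
            then obtain a b where ab: "a \<in> M" "b \<in> M" "(x, y) \<in> C a" "(y, x) \<notin> C a"
              "(y, z) \<in> C b" "(z, y) \<notin> C b" using xy yz unfolding D_def by blast
            then show ?thesis using linear[of a b] C_mono by blast
          qed
          show "(x, z) \<in> D"
          proof (cases "(x, y) \<in> R \<and> (y, z) \<in> R")
            case True
            then show ?thesis using R(1) unfolding D_def by (blast dest: transD)
          next
            case False
            then obtain a where a: "a \<in> M" "(x, y) \<in> C a" "(y, z) \<in> C a" "(y, x) \<notin> C a \<or> (z, y) \<notin> C a"
              using DC by blast
            then have "(x, z) \<in> C a" "(z, x) \<notin> C a" using C_trans by blast+
            then show ?thesis using a(1) unfolding D_def by blast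
          qed
        qed
        moreover have "irrefl D" using R(2) unfolding D_def irrefl_def by blast
        ultimately obtain ord where ord: "D \<subseteq> ord" "trans ord" "irrefl ord"
          "\<And>u v. u \<noteq> v \<Longrightarrow> (u, v) \<in> ord \<or> (v, u) \<in> ord"
          using strict_order_extension[of D UNIV] by (metis UNIV_I subset_UNIV trans_def)
        have "\<exists>F. ?P (P a) (ord \<inter> strong (P a)) F" if "a \<in> M" for a
        proof (rule IH)
          have "|P a| \<le>o |N a|" by (rule card_of_mono1) (auto simp: P_def)
          then show "|P a| <o |M|" using N_card[OF that] by (rule ordLeq_ordLess_trans)
          show "trans (ord \<inter> strong (P a))" using ord(2) trans_strong by (rule trans_Int)
          show "irrefl (ord \<inter> strong (P a))" using ord(3) by (auto simp: irrefl_def)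
        qed blast
        then have "\<forall>a\<in>M. \<exists>F. ?P (P a) (ord \<inter> strong (P a)) F" by blast
        from bchoice[OF this] obtain FF where FF: "\<And>a. a \<in> M \<Longrightarrow> ?P (P a) (ord \<inter> strong (P a)) (FF a)"
          by blast
        define F where "F = (\<Union>a\<in>M. FF a)"
        have P_disj: "P a \<inter> P b = {}" if ab: "a \<in> M" "b \<in> M" "a \<noteq> b" for a b
        proof -
          have *: "P c \<inter> P d = {}" if "(c, d) \<in> ?r" "c \<noteq> d" for c d
            using that by (auto simp: P_def B_def underS_def)
          show ?thesis using linear[OF ab(1,2)] *[of a b] *[of b a] ab(3) by blast
        qed
        have FF_sub: "FF a \<subseteq> P a" if "a \<in> M" for a using FF[OF that] reaches_subset by blast
        have F_P: "F \<inter> P a = FF a" if "a \<in> M" for a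
        proof
          show "FF a \<subseteq> F \<inter> P a" using FF_sub that by (auto simp: F_def)
          show "F \<inter> P a \<subseteq> FF a"
          proof
            fix e assume "e \<in> F \<inter> P a"
            then obtain b where b: "b \<in> M" "e \<in> FF b" "e \<in> P a" by (auto simp: F_def)
            then have "e \<in> P b" using FF_sub by blast
            then have "b = a" using P_disj[OF b(1) that] b(3) by blast
            then show "e \<in> FF a" using b(2) by simp
          qed
        qed
        have steps: "step F (P a) = step (FF a) (P a)" if "a \<in> M" for a
          using F_P[OF that] by (intro step_cong) blast
        have P_cover: "(\<Union>a\<in>M. P a) = M"
        proof
          show "(\<Union>a\<in>M. P a) \<subseteq> M" using NM by (auto simp: P_def)
          show "M \<subseteq> (\<Union>a\<in>M. P a)"
          proof
            fix e assume "e \<in> M"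
            then obtain a0 where "a0 \<in> {a \<in> M. e \<in> N a}" using cover by blast
            then obtain a where a: "a \<in> {a \<in> M. e \<in> N a}"
              "\<And>b. (b, a) \<in> ?r - Id \<Longrightarrow> b \<notin> {a \<in> M. e \<in> N a}"
              by (rule wfE_min[OF Well_order_wf[OF wo]]) (rule that)
            have "e \<notin> N b" if "b \<in> underS ?r a" for b
            proof -
              have "(b, a) \<in> ?r - Id" using that by (auto simp: underS_def)
              moreover from this have "b \<in> M" using Fr by (auto simp: Field_def)
              ultimately show ?thesis using a(2) by blast
            qed
            then show "e \<in> (\<Union>a\<in>M. P a)" using a(1) by (auto simp: P_def B_def)
          qed
        qed
        interpret chain: edge_chain t h M ?r N F ord
          by unfold_locales (use wo mono cover Fr ord in auto)
        have cB: "chain.B a = B a" for a by (simp add: chain.B_def B_def)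
        have cP: "chain.P a = P a" for a by (simp add: chain.P_def P_def cB)
        interpret sol: edge_chain_solution t h M ?r N F ord
        proof (unfold_locales, unfold Fr cB cP)
          show "(u, v) \<in> strong (P a)"
            if "a \<in> M" "u \<in> ends (N a)" "v \<in> ends (N a)" "u \<noteq> v" "(u, v) \<in> (step {} (M - N a))\<^sup>*" for a u v
            using after[OF that] by (simp add: P_def B_def)
          show "(u, v) \<in> strong (P a)"
            if "a \<in> M" "u \<in> ends (B a)" "v \<in> ends (B a)" "u \<noteq> v" "(u, v) \<in> (step {} (M - B a))\<^sup>*" for a u v
            using before[of a u v] that by (simp add: P_def B_def)
          show "(u, v) \<in> ord"
            if "a \<in> M" "(u, v) \<in> (step {} (M - B a))\<^sup>*" "(v, u) \<notin> (step {} (M - B a))\<^sup>*" for a u v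
            using ord(1) that by (auto simp: D_def C_def)
          show "reaches (P a) (F \<inter> P a)" if "a \<in> M" for a using FF[OF that] F_P[OF that] by simp
          show "(v, u) \<notin> (step F (P a) \<union> ord \<inter> strong (P a))\<^sup>*"
            if "a \<in> M" "(u, v) \<in> ord \<inter> strong (P a)" for a u v
            using FF[OF that(1)] that(2) steps[OF that(1)] by simp
          show "resolved F (P a)" if "a \<in> M" for a
          proof -
            have "F \<inter> P a = FF a \<inter> P a" using F_P[OF that] by blast
            then show ?thesis using resolved_cong FF[OF that] by blast
          qed
        qed
        have "reaches (\<Union>a\<in>Field ?r. P a) (\<Union>a\<in>Field ?r. FF a)"
          by (rule reaches_disjoint[OF wo]) (use FF P_disj Fr in auto)
        then have 1: "reaches M F" unfolding Fr P_cover F_def[symmetric] .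
        have "(v, u) \<notin> (step F M \<union> R)\<^sup>*" if uv: "(u, v) \<in> R" for u v
        proof (rule sol.no_prescribed_cycle[OF _ _ _ _ uv])
          show "Field ?r \<noteq> {}" using False Fr by auto
          show "R \<subseteq> ord" using ord(1) by (auto simp: D_def)
          show "R \<subseteq> ends M \<times> ends M"
          proof (clarify)
            fix x y assume xy: "(x, y) \<in> R"
            then have "(x, y) \<in> (step {} M)\<^sup>*" using R(3) strong_reach by blast
            moreover have "x \<noteq> y" using xy R(2) by (auto simp: irrefl_def)
            ultimately show "x \<in> ends M \<and> y \<in> ends M" using reach_ends by blast
          qed
          show "(x, y) \<in> (step {} (M - N a))\<^sup>*" if "a \<in> Field ?r" "(x, y) \<in> R" for a x y
            using small[OF that(2) NM N_card] that(1) Fr by simp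
        qed
        then show ?thesis using 1 sol.all_resolved by blast
      qed
    qed
  qed
  then show ?thesis using assms that by blast
qed

end

subsection \<open>Reorientations of digraphs\<close>

lemma reverse_arcs_simps [simp]:
  "arcs (reverse_arcs F D) = arcs D" "verts (reverse_arcs F D) = verts D"
  "tail (reverse_arcs F D) = edge_ends.src (tail D) (head D) F"
  "head (reverse_arcs F D) = edge_ends.trg (tail D) (head D) F"
  by (auto simp: reverse_arcs_def edge_ends.src_def edge_ends.trg_def)

context
  fixes D :: "('v, 'e) pre_digraph"
  assumes D: "graph_orientation D"
begin

interpretation edge_ends "tail D" "head D" .

lemma map_src_trg: "walk F u p v \<Longrightarrow> map (src F) p @ [v] = u # map (trg F) p"
  by (induction p arbitrary: u) auto

lemma cas_walk: "pre_digraph.cas (reverse_arcs F D) u p v \<longleftrightarrow> walk F u p v"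
  by (induction p arbitrary: u) (simp_all add: pre_digraph.cas.simps)

lemma awalk_verts_walk:
  "walk F u p v \<Longrightarrow> pre_digraph.awalk_verts (reverse_arcs F D) u p = u # map (trg F) p"
  by (induction p arbitrary: u) (auto simp: pre_digraph.awalk_verts.simps)

lemma src_in_verts: "e \<in> arcs D \<Longrightarrow> src F e \<in> verts D"
  using D by (auto simp: graph_orientation_def src_def)

text \<open>The library asks for distinct targets, \<open>dicycle\<close> for distinct sources;
  along a closed walk both lists have the same multiset.\<close>

lemma dicycle_cycle:
  assumes p: "dicycle F p" "set p \<subseteq> arcs D"
  shows "pre_digraph.cycle (reverse_arcs F D) p"
proof -
  obtain u where u: "walk F u p u" and ne: "p \<noteq> []" and dist: "distinct (map (src F) p)"
    using p(1) by (auto simp: dicycle_def)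
  have "mset (map (src F) p @ [u]) = mset (u # map (trg F) p)" using map_src_trg[OF u] by simp
  then have "mset (map (src F) p) = mset (map (trg F) p)" by simp
  then have "distinct (map (trg F) p)" using dist mset_eq_imp_distinct_iff by blast
  moreover obtain e q where "p = e # q" using ne by (cases p) auto
  then have "u \<in> verts D" using u p(2) src_in_verts by auto
  ultimately show ?thesis
    unfolding pre_digraph.cycle_def pre_digraph.awalk_def
    using u ne p(2) cas_walk awalk_verts_walk[OF u] by auto
qed

lemma reverse_arcs_reverse_arcs:
  "reverse_arcs G (reverse_arcs F D) = reverse_arcs (sym_diff F G) D"
  by (simp add: reverse_arcs_def fun_eq_iff)

text \<open>An initial segment is empty, has a last element, or has none, which matches the three
  rules. In the last case the finitely many indices of cycles through an edge have a strict upper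
  bound inside the segment, beyond which the orientation of that edge is constant.\<close>

lemma revseq_reorients:
  assumes rs: "revseq (arcs D) r C" and J: "wo_rel.ofilter r J"
  shows "reorients_to D r C J (reverse_arcs (par C J) D)"
proof -
  have wo: "Well_order r" and fin: "\<And>e. finite {i \<in> Field r. e \<in> set (C i)}"
    using rs by (auto simp: revseq_def)
  have wor: "wo_rel r" using wo by (simp add: wo_rel_def)
  have lin: "(a, b) \<in> r \<or> (b, a) \<in> r" if "a \<in> Field r" "b \<in> Field r" for a b
    using wo that by (cases "a = b") (auto simp: order_on_defs total_on_def refl_on_def)
  have anti: "a = b" if "(a, b) \<in> r" "(b, a) \<in> r" for a b
    using wo that by (auto simp: order_on_defs antisym_def)
  have tr: "(a, c) \<in> r" if "(a, b) \<in> r" "(b, c) \<in> r" for a b c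
    using wo that unfolding order_on_defs by (blast dest: transD)
  have main: "reorients_to D r C J (reverse_arcs (par C J) D)"
    if J: "wo_rel.ofilter r J"
      and IH: "\<And>i. i \<in> J \<Longrightarrow> reorients_to D r C (underS r i) (reverse_arcs (par C (underS r i)) D)" for J
  proof -
    have JF: "J \<subseteq> Field r" and Jdown: "\<And>i. i \<in> J \<Longrightarrow> under r i \<subseteq> J"
      using J by (auto simp: wo_rel.ofilter_def[OF wor])
    consider "J = {}" | i where "i \<in> J" "\<And>j. j \<in> J \<Longrightarrow> (j, i) \<in> r"
      | "J \<noteq> {}" "\<forall>i\<in>J. \<exists>j\<in>J. j \<noteq> i \<and> (i, j) \<in> r"
      using lin JF by (metis subsetD)
    then show ?thesis
    proof cases
      case 1
      have "reverse_arcs {} D = D" by (simp add: reverse_arcs_def)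
      then show ?thesis using reorients_to.zero[of D r C] 1 by simp
    next
      case (2 i)
      have iF: "i \<in> Field r" using 2 JF by blast
      have Ju: "J = under r i" using 2 Jdown by (auto simp: under_def)
      have u: "under r i = underS r i \<union> {i}"
        using lin[OF iF iF] by (auto simp: under_def underS_def)
      have "par C (underS r i \<union> {i}) = sym_diff (par C (underS r i)) (par C {i})"
      proof (rule par_Un)
        show "underS r i \<inter> {i} = {}" by (auto simp: underS_def)
        show "finite {j \<in> underS r i \<union> {i}. e \<in> set (C j)}" for e
          by (rule finite_subset[OF _ fin[of e]]) (use JF Ju u in auto)
      qed
      then have eq: "par C J = sym_diff (par C (underS r i)) (set (C i))" using Ju u by simp
      have "pre_digraph.cycle (reverse_arcs (par C (underS r i)) D) (C i)"
        using rs iF by (intro dicycle_cycle) (auto simp: revseq_def)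
      from reorients_to.succ[OF iF IH[OF 2(1)] this]
      show ?thesis unfolding reverse_arcs_reverse_arcs eq[symmetric] using Ju by simp
    next
      case 3
      show ?thesis
      proof (rule reorients_to.limit[OF J 3])
        show "\<forall>i\<in>J. reorients_to D r C (underS r i) (reverse_arcs (par C (underS r i)) D)" using IH by blast
        have out: "e \<notin> par C J" if "e \<notin> arcs D" for e
        proof -
          have "par C J \<subseteq> arcs D" using rs JF by (intro par_subset) (auto simp: revseq_def)
          then show ?thesis using that by blast
        qed
        have stable: "\<exists>j\<in>J. \<forall>k\<in>J. (j, k) \<in> r \<longrightarrow> (e \<in> par C (underS r k) \<longleftrightarrow> e \<in> par C J)" for e
        proof -
          let ?E = "{i \<in> J. e \<in> set (C i)}"
          have "finite ?E" by (rule finite_subset[OF _ fin[of e]]) (use JF in auto)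
          moreover have "\<exists>j\<in>J. \<forall>i\<in>E. (i, j) \<in> r \<and> i \<noteq> j" if "finite E" "E \<subseteq> J" for E
            using that
          proof (induction E rule: finite_induct)
            case empty
            then show ?case using 3(1) by blast
          next
            case (insert a E)
            then obtain j where j: "j \<in> J" "\<forall>i\<in>E. (i, j) \<in> r \<and> i \<noteq> j" by blast
            obtain b where b: "b \<in> J" "b \<noteq> a" "(a, b) \<in> r" using 3(2) insert.prems by blast
            have "(j, b) \<in> r \<or> (b, j) \<in> r" using lin JF j(1) b(1) by blast
            then show ?case
            proof
              assume "(j, b) \<in> r"
              then show ?thesis using j b tr anti by (intro bexI[of _ b]) blast+
            next
              assume "(b, j) \<in> r"
              then show ?thesis using j b tr anti by (intro bexI[of _ j]) blast+
            qed
          qed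
          ultimately obtain j where j: "j \<in> J" "\<forall>i\<in>?E. (i, j) \<in> r \<and> i \<noteq> j" by blast
          have "e \<in> par C (underS r k) \<longleftrightarrow> e \<in> par C J" if k: "k \<in> J" "(j, k) \<in> r" for k
          proof -
            have "underS r k \<subseteq> J" using Jdown[OF k(1)] by (auto simp: under_def underS_def)
            moreover have "i \<in> underS r k" if "i \<in> ?E" for i
              using j(2) that k(2) tr anti unfolding underS_def by blast
            ultimately have "{i \<in> underS r k. e \<in> set (C i)} = ?E" by blast
            then show ?thesis by (simp add: par_def)
          qed
          then show ?thesis using j(1) by blast
        qed
        show "orientation_limit r J (\<lambda>i. reverse_arcs (par C (underS r i)) D) D (reverse_arcs (par C J) D)"
          unfolding orientation_limit_def
        proof (intro conjI ballI allI impI)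
          fix e assume "e \<in> arcs D"
          obtain j where j: "j \<in> J" "\<forall>k\<in>J. (j, k) \<in> r \<longrightarrow> (e \<in> par C (underS r k) \<longleftrightarrow> e \<in> par C J)"
            using stable by blast
          show "\<exists>j\<in>J. \<forall>k\<in>J. (j, k) \<in> r \<longrightarrow>
            arc_to_ends (reverse_arcs (par C (underS r k)) D) e = arc_to_ends (reverse_arcs (par C J) D) e"
            using j by (intro bexI[of _ j]) (simp_all add: arc_to_ends_def src_def trg_def)
        next
          fix e assume "e \<notin> arcs D"
          then show "arc_to_ends (reverse_arcs (par C J) D) e = arc_to_ends D e"
            using out by (simp add: arc_to_ends_def src_def trg_def)
        qed simp_all
      qed
    qed
  qed
  have under: "i \<in> Field r \<longrightarrow> reorients_to D r C (underS r i) (reverse_arcs (par C (underS r i)) D)" for i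
  proof (induction i rule: wf_induct_rule[OF Well_order_wf[OF wo]])
    case (1 i)
    show ?case
    proof (rule impI, rule main[OF wo_rel.underS_ofilter[OF wor]])
      fix j assume "j \<in> underS r i"
      then have "(j, i) \<in> r - Id" "j \<in> Field r" by (auto simp: underS_def Field_def)
      then show "reorients_to D r C (underS r j) (reverse_arcs (par C (underS r j)) D)" using 1 by blast
    qed
  qed
  show ?thesis
    by (rule main[OF J]) (use under J in \<open>auto simp: wo_rel.ofilter_def[OF wor]\<close>)
qed

lemma reachable_step:
  assumes "reachable (reverse_arcs F D) u v"
  shows "(u, v) \<in> (step F (arcs D))\<^sup>*"
proof -
  have "arcs_ends (reverse_arcs F D) = step F (arcs D)"
    by (simp add: arcs_ends_def arc_to_ends_def step_def)
  then have "(u, v) \<in> rtrancl_on (verts D) (step F (arcs D))" using assms by (simp add: reachable_def)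
  then show ?thesis by (induction rule: rtrancl_on_induct) auto
qed

text \<open>The easy half of Menger's theorem: edge-disjoint paths meet a finite separator in
  distinct edges.\<close>

lemma finite_connectivity:
  assumes "\<not> infconn F (arcs D) u v" "u \<noteq> v"
  shows "local_edge_connectivity (reverse_arcs F D) u v < \<infinity>"
proof -
  obtain G where G: "finite G" "(u, v) \<notin> (step F (arcs D - G))\<^sup>*" using assms(1) by (auto simp: infconn_def)
  have meets: "set p \<inter> G \<noteq> {}" if "pre_digraph.apath (reverse_arcs F D) u p v" for p
  proof
    assume n: "set p \<inter> G = {}"
    have "walk F u p v" "set p \<subseteq> arcs D"
      using that by (auto simp: pre_digraph.apath_def pre_digraph.awalk_def cas_walk)
    then show False using walk_reach[of F u p v] reach_mono[of "set p" "arcs D - G"] n G(2) by blast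
  qed
  have "(if finite X then enat (card X) else \<infinity>) \<le> enat (card G)"
    if X: "X \<in> edge_disjoint_path_systems (reverse_arcs F D) u v" for X
  proof -
    have "\<forall>p\<in>X. \<exists>e. e \<in> set p \<inter> G" using meets X by (auto simp: edge_disjoint_path_systems_def)
    from bchoice[OF this] obtain g where g: "\<And>p. p \<in> X \<Longrightarrow> g p \<in> set p \<inter> G" by blast
    have "inj_on g X"
    proof (rule inj_onI, rule ccontr)
      fix p q assume pq: "p \<in> X" "q \<in> X" "g p = g q" "p \<noteq> q"
      then have "set p \<inter> set q = {}" using X by (auto simp: edge_disjoint_path_systems_def pairwise_def)
      then show False using g[OF pq(1)] g[OF pq(2)] pq(3) by auto
    qed
    moreover have "g ` X \<subseteq> G" using g by blast
    ultimately have "finite X" "card X \<le> card G"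
      using inj_on_finite[of g X G] card_inj_on_le[of g X G] G(1) by auto
    then show ?thesis by simp
  qed
  then have "local_edge_connectivity (reverse_arcs F D) u v \<le> enat (card G)"
    unfolding local_edge_connectivity_def by (rule SUP_least)
  then show ?thesis using order.strict_trans1 by fastforce
qed

lemma reorientation_exists:
  "\<exists>(r :: ('e \<times> nat) rel) (C :: 'e \<times> nat \<Rightarrow> 'e list).
    (r, C) \<in> reversion_sequences D \<and>
    (\<forall>e\<in>arcs D. finite {i \<in> Field r. e \<in> set (C i)}) \<and>
    (\<forall>K\<in>pre_digraph.sccs_verts (reorient D (r, C)).
       \<forall>u\<in>K. \<forall>v\<in>K. u \<noteq> v \<longrightarrow> local_edge_connectivity (reorient D (r, C)) u v < \<infinity>)"
proof -
  obtain F where F: "reaches (arcs D) F" "resolved F (arcs D)"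
    by (rule resolvable[of "{}" "arcs D"]) (auto simp: irrefl_def)
  then obtain r :: "('e \<times> nat) rel" and C where rs: "revseq (arcs D) r C" and FC: "F = par C (Field r)"
    by (auto simp: reaches_def)
  have wo: "Well_order r" using rs by (simp add: revseq_def)
  have "wo_rel.ofilter r (Field r)" using wo by (simp add: wo_rel.Field_ofilter wo_rel_def)
  from revseq_reorients[OF rs this] have re: "reorients_to D r C (Field r) (reverse_arcs F D)"
    by (simp add: FC)
  have eq: "reorient D (r, C) = reverse_arcs F D" by (rule reorient_eq[OF wo re])
  show ?thesis
  proof (intro exI[of _ r] exI[of _ C] conjI ballI impI)
    show "(r, C) \<in> reversion_sequences D" using wo re by (auto simp: reversion_sequences_def)
    show "finite {i \<in> Field r. e \<in> set (C i)}" for e using rs by (simp add: revseq_def)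
  next
    fix K u v assume K: "K \<in> pre_digraph.sccs_verts (reorient D (r, C))" "u \<in> K" "v \<in> K" "u \<noteq> v"
    then have "reachable (reverse_arcs F D) v u" unfolding eq by (auto simp: pre_digraph.sccs_verts_def)
    then have "(v, u) \<in> (step F (arcs D))\<^sup>*" by (rule reachable_step)
    then have "\<not> infconn F (arcs D) u v" using F(2) K(4) unfolding resolved_def by blast
    then show "local_edge_connectivity (reorient D (r, C)) u v < \<infinity>"
      unfolding eq using finite_connectivity K(4) by blast
  qed
qed

end

theorem theorem1p7:
  fixes D :: "('v, 'e) pre_digraph"
  assumes "graph_orientation D"
  shows "\<exists>(r :: ('e \<times> nat) rel) (C :: 'e \<times> nat \<Rightarrow> 'e list).
    (r, C) \<in> reversion_sequences D \<and>
    (\<forall>e\<in>arcs D. finite {i \<in> Field r. e \<in> set (C i)}) \<and>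
    (\<forall>K\<in>pre_digraph.sccs_verts (reorient D (r, C)).
       \<forall>u\<in>K. \<forall>v\<in>K. u \<noteq> v \<longrightarrow> local_edge_connectivity (reorient D (r, C)) u v < \<infinity>)"
  using reorientation_exists[OF assms] .

end
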